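(* Let $\Omega$ be a slice domain in $\mathbb{H}$ and let $f:\Omega\to\mathbb{H}$ be a slice regular function. Let $U$ be a symmetric open subset of $\mathbb{H}$ such that $\overline{U}$ is compact and path-connected. If $\overline{U}\cap\mathbb{R}\neq\emptyset$, assume this intersection to be a closed interval of $\mathbb{R}$ included in $\Omega$. Suppose, for some $J_0\in\mathbb{S}$, that the boundary $\partial U_{J_0}$ is a finite union of disjoint rectifiable Jordan curves and that $$\overline{U}_{J_0}^+\subset\Omega_{J_0}^+ .$$ Then there exists a real number $\varepsilon>0$ such that, for all $I\in\mathbb{S}$ and for all $$q\in\bigcup_{J\in\mathbb{S},\,|J-J_0|<\varepsilon}U_J^+\cup(U\cap\mathbb{R}),$$ it holds $$f(q)=\int_{\partial U_I}(s-q)^{-*}(2\pi I)^{-1}\,ds\,\widetilde f(s),$$ where, for all $x+yJ\in\partial U$ (with $x,y\in\mathbb{R}$, $y>0$ and $J\in\mathbb{S}$), $$\widetilde f(x+yJ)=f^\circ_s(x+yJ_0)+yJf'_s(x+yJ_0)$$ and, for all $x\in\partial U\cap\mathbb{R}$, $\widetilde f(x)=f^\circ_s(x)=f(x)$.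
   Context: $\mathbb{H}$ is the real algebra of quaternions and $\mathbb{S}=\{J\in\mathbb{H}:J^2=-1\}$. For $I\in\mathbb{S}$: $L_I=\mathbb{R}+I\mathbb{R}$, $L_I^+=\{x+yI: x,y\in\mathbb{R},\,y>0\}$; for $T\subseteq\mathbb{H}$, $T_I=T\cap L_I$ and $T_I^+=T\cap L_I^+$ (so $\overline{U}_{J_0}^+=\overline{U}\cap L_{J_0}^+$); $\partial U_I$ is the boundary of $U_I$ in $L_I$, with the usual positive orientation. $T$ is symmetric if $x+yI\in T$ implies $x+y\mathbb{S}=\{x+yJ:J\in\mathbb{S}\}\subseteq T$. A domain is a nonempty open connected set; a slice domain is a domain $\Omega\subseteq\mathbb{H}$ with $\Omega\cap\mathbb{R}\neq\emptyset$ such that $\Omega_I$ is a domain of $L_I$ for every $I\in\mathbb{S}$. A function $f:\Omega\to\mathbb{H}$ is slice regular if, for every $I\in\mathbb{S}$, the restriction $f_I$ of $f$ to $\Omega_I$ has continuous partial derivatives and $\frac12\left(\frac{\partial}{\partial x}+I\frac{\partial}{\partial y}\right)f_I(x+yI)\equiv0$. Spherical value and derivative: for a slice regular $f$ on a slice domain $\Omega$ and $p_0=x_0+y_0I_0\in\Omega\setminus\mathbb{R}$ ($y_0>0$, $I_0\in\mathbb{S}$), it is known that there exist a neighborhood $V\subseteq\Omega$ of $p_0$ in $x_0+y_0\mathbb{S}$ and unique quaternions $b(p_0),c(p_0)$ (independent of $V$) with $f(x_0+y_0I)=b(p_0)+I\,c(p_0)$ for all $x_0+y_0I\in V$. Set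 $f^\circ_s(p_0)=b(p_0)$ and $f'_s(p_0)=y_0^{-1}c(p_0)$; for $p_0\in\Omega\cap\mathbb{R}$ set $f^\circ_s(p_0)=f(p_0)$. Kernel: $(s-q)^{-*}=(|s|^2-2q\operatorname{Re}(s)+q^2)^{-1}(\bar s-q)$. Integrals: for a rectifiable curve $\gamma_I$ in $L_I$ and continuous $\mathbb{H}$-valued functions $g,f$ on (a neighborhood in $L_I$ of) its support, choose $J\in\mathbb{S}$ with $J\perp I$ and write $f=F+GJ$, $g=H+JK$ with $F,G,H,K$ $L_I$-valued; then $\int_{\gamma_I}g(s)\,ds\,f(s)=\int_{\gamma_I}H\,ds\,F+\int_{\gamma_I}H\,ds\,G\,J+J\int_{\gamma_I}K\,ds\,F+J\int_{\gamma_I}K\,ds\,G\,J$, where the integrals on the right are ordinary complex line integrals in $L_I\cong\mathbb{C}$. *)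

theory Defs
  imports "HOL-Complex_Analysis.Complex_Analysis"
begin

section \<open>The real algebra of quaternions\<close>

codatatype quat = Quat (qre: real) (qi: real) (qj: real) (qk: real)

lemma quat_eq_iff: "p = q \<longleftrightarrow> qre p = qre q \<and> qi p = qi q \<and> qj p = qj q \<and> qk p = qk q"
  by (auto intro: quat.expand)

instantiation quat :: ab_group_add
begin

primcorec zero_quat where
  "qre 0 = 0" | "qi 0 = 0" | "qj 0 = 0" | "qk 0 = 0"

primcorec plus_quat where
  "qre (p + q) = qre p + qre q"
| "qi (p + q) = qi p + qi q"
| "qj (p + q) = qj p + qj q"
| "qk (p + q) = qk p + qk q"

primcorec uminus_quat where
  "qre (- p) = - qre p"
| "qi (- p) = - qi p"
| "qj (- p) = - qj p"
| "qk (- p) = - qk p"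

primcorec minus_quat where
  "qre (p - q) = qre p - qre q"
| "qi (p - q) = qi p - qi q"
| "qj (p - q) = qj p - qj q"
| "qk (p - q) = qk p - qk q"

instance
  by standard (simp_all add: quat_eq_iff)

end

instantiation quat :: ring_1
begin

primcorec one_quat where
  "qre 1 = 1" | "qi 1 = 0" | "qj 1 = 0" | "qk 1 = 0"

primcorec times_quat where
  "qre (p * q) = qre p * qre q - qi p * qi q - qj p * qj q - qk p * qk q"
| "qi (p * q) = qre p * qi q + qi p * qre q + qj p * qk q - qk p * qj q"
| "qj (p * q) = qre p * qj q - qi p * qk q + qj p * qre q + qk p * qi q"
| "qk (p * q) = qre p * qk q + qi p * qj q - qj p * qi q + qk p * qre q"

instance
  by standard (simp_all add: quat_eq_iff algebra_simps)

end

instantiation quat :: real_algebra_1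
begin

primcorec scaleR_quat where
  "qre (r *\<^sub>R q) = r * qre q"
| "qi (r *\<^sub>R q) = r * qi q"
| "qj (r *\<^sub>R q) = r * qj q"
| "qk (r *\<^sub>R q) = r * qk q"

instance
  by standard (simp_all add: quat_eq_iff algebra_simps)

end

instantiation quat :: real_inner
begin

definition inner_quat_def:
  "inner p q = qre p * qre q + qi p * qi q + qj p * qj q + qk p * qk q"

definition norm_quat_def:
  "norm q = sqrt ((qre q)\<^sup>2 + (qi q)\<^sup>2 + (qj q)\<^sup>2 + (qk q)\<^sup>2)"

definition sgn_quat_def: "sgn q = q /\<^sub>R norm q" for q :: quat

definition dist_quat_def: "dist p q = norm (p - q)" for p q :: quat

definition uniformity_quat_def [code del]:
  "(uniformity :: (quat \<times> quat) filter) = (INF e\<in>{0 <..}. principal {(x, y). dist x y < e})"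

definition open_quat_def [code del]:
  "open (U :: quat set) \<longleftrightarrow> (\<forall>x\<in>U. eventually (\<lambda>(x', y). x' = x \<longrightarrow> y \<in> U) uniformity)"

instance
proof
  fix x y z :: quat and r :: real and U :: "quat set"
  show "dist x y = norm (x - y)" by (rule dist_quat_def)
  show "sgn x = x /\<^sub>R norm x" by (rule sgn_quat_def)
  show "uniformity = (INF e\<in>{0 <..}. principal {(x :: quat, y). dist x y < e})"
    by (rule uniformity_quat_def)
  show "open U \<longleftrightarrow> (\<forall>x\<in>U. eventually (\<lambda>(x', y). x' = x \<longrightarrow> y \<in> U) uniformity)"
    by (rule open_quat_def)
  show "inner x y = inner y x" by (simp add: inner_quat_def mult.commute)
  show "inner (x + y) z = inner x z + inner y z" by (simp add: inner_quat_def distrib_right)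
  show "inner (r *\<^sub>R x) y = r * inner x y" by (simp add: inner_quat_def distrib_left)
  show "0 \<le> inner x x" by (simp add: inner_quat_def)
  show "inner x x = 0 \<longleftrightarrow> x = 0"
    by (simp add: inner_quat_def quat_eq_iff add_nonneg_eq_0_iff)
  show "norm x = sqrt (inner x x)"
    by (simp add: inner_quat_def norm_quat_def power2_eq_square)
qed

end

primcorec qcnj :: "quat \<Rightarrow> quat" where
  "qre (qcnj q) = qre q"
| "qi (qcnj q) = - qi q"
| "qj (qcnj q) = - qj q"
| "qk (qcnj q) = - qk q"

instantiation quat :: real_normed_div_algebra
begin

definition inverse_quat_def: "inverse q = qcnj q /\<^sub>R (norm q)\<^sup>2" for q :: quat

definition divide_quat_def: "p div q = p * inverse q" for p q :: quat

instance
proof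
  fix x y :: quat
  have n: "(norm q)\<^sup>2 = qre q * qre q + qi q * qi q + qj q * qj q + qk q * qk q" for q
    by (simp add: norm_quat_def power2_eq_square)
  have cl: "qcnj q * q = (norm q)\<^sup>2 *\<^sub>R 1" and cr: "q * qcnj q = (norm q)\<^sup>2 *\<^sub>R 1" for q
    by (simp_all add: quat_eq_iff n algebra_simps)
  show "inverse x * x = 1" if "x \<noteq> 0" using that by (simp add: inverse_quat_def cl)
  show "x * inverse x = 1" if "x \<noteq> 0" using that by (simp add: inverse_quat_def cr)
  show "x div y = x * inverse y" by (rule divide_quat_def)
  show "inverse (0 :: quat) = 0" by (simp add: inverse_quat_def quat_eq_iff)
  have "(norm (x * y))\<^sup>2 = (norm x * norm y)\<^sup>2"
    unfolding power_mult_distrib n by (simp add: algebra_simps)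
  then show "norm (x * y) = norm x * norm y" by simp
qed

end

section \<open>Slices\<close>

definition imag_units :: "quat set" where
  "imag_units = {J. J\<^sup>2 = - 1}"

definition slice_plane :: "quat \<Rightarrow> quat set" where
  "slice_plane I = {of_real x + of_real y * I | x y. True}"

definition upper_slice :: "quat \<Rightarrow> quat set" where
  "upper_slice I = {of_real x + of_real y * I | x y. y > 0}"

text \<open>The identification of the complex plane with the slice plane of \<open>I\<close>.  It carries the
  standard orientation to the one given by the basis \<open>1, I\<close>.\<close>

definition slice_emb :: "quat \<Rightarrow> complex \<Rightarrow> quat" where
  "slice_emb I z = of_real (Re z) + of_real (Im z) * I"

definition symmetric_set :: "quat set \<Rightarrow> bool" where
  "symmetric_set T \<longleftrightarrow>
     (\<forall>x y. \<forall>I\<in>imag_units. of_real x + of_real y * I \<in> T \<longrightarrow>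
        {of_real x + of_real y * J | J. J \<in> imag_units} \<subseteq> T)"

definition slice_domain :: "quat set \<Rightarrow> bool" where
  "slice_domain \<Omega> \<longleftrightarrow>
     \<Omega> \<noteq> {} \<and> open \<Omega> \<and> connected \<Omega> \<and> \<Omega> \<inter> \<real> \<noteq> {} \<and>
     (\<forall>I\<in>imag_units. \<Omega> \<inter> slice_plane I \<noteq> {} \<and>
        openin (top_of_set (slice_plane I)) (\<Omega> \<inter> slice_plane I) \<and>
        connected (\<Omega> \<inter> slice_plane I))"

text \<open>\<open>fx\<close> and \<open>fy\<close> are the partial derivatives of \<open>(x, y) \<mapsto> f (x + yI)\<close>.\<close>

definition slice_regular :: "quat set \<Rightarrow> (quat \<Rightarrow> quat) \<Rightarrow> bool" where
  "slice_regular \<Omega> f \<longleftrightarrow>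
     (\<forall>I\<in>imag_units. \<exists>fx fy :: real \<times> real \<Rightarrow> quat.
        continuous_on {(x, y). of_real x + of_real y * I \<in> \<Omega>} fx \<and>
        continuous_on {(x, y). of_real x + of_real y * I \<in> \<Omega>} fy \<and>
        (\<forall>x y. of_real x + of_real y * I \<in> \<Omega> \<longrightarrow>
           ((\<lambda>t. f (of_real t + of_real y * I)) has_vector_derivative fx (x, y)) (at x) \<and>
           ((\<lambda>t. f (of_real x + of_real t * I)) has_vector_derivative fy (x, y)) (at y) \<and>
           (1 / 2) *\<^sub>R (fx (x, y) + I * fy (x, y)) = 0))"

section \<open>Spherical value and spherical derivative\<close>

definition qim_norm :: "quat \<Rightarrow> real" where
  "qim_norm p = norm (p - of_real (qre p))"

text \<open>For nonreal \<open>p = x\<^sub>0 + y\<^sub>0I\<^sub>0\<close> with \<open>y\<^sub>0 > 0\<close>, one has \<open>x\<^sub>0 = qre p\<close> and \<open>y\<^sub>0 = qim_norm p\<close>.\<close>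

definition spherical_pair :: "(quat \<Rightarrow> quat) \<Rightarrow> quat set \<Rightarrow> quat \<Rightarrow> quat \<Rightarrow> quat \<Rightarrow> bool" where
  "spherical_pair f \<Omega> p b c \<longleftrightarrow>
     (\<exists>V. openin (top_of_set {of_real (qre p) + of_real (qim_norm p) * I | I. I \<in> imag_units}) V \<and>
          p \<in> V \<and> V \<subseteq> \<Omega> \<and>
          (\<forall>I\<in>imag_units. of_real (qre p) + of_real (qim_norm p) * I \<in> V \<longrightarrow>
             f (of_real (qre p) + of_real (qim_norm p) * I) = b + I * c))"

definition spherical_value :: "(quat \<Rightarrow> quat) \<Rightarrow> quat set \<Rightarrow> quat \<Rightarrow> quat" where
  "spherical_value f \<Omega> p =
     (if p \<in> \<real> then f p else (THE b. \<exists>c. spherical_pair f \<Omega> p b c))"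

definition spherical_deriv :: "(quat \<Rightarrow> quat) \<Rightarrow> quat set \<Rightarrow> quat \<Rightarrow> quat" where
  "spherical_deriv f \<Omega> p = (THE c. \<exists>b. spherical_pair f \<Omega> p b c) /\<^sub>R qim_norm p"

section \<open>Line integrals along rectifiable curves\<close>

definition rectifiable_path :: "(real \<Rightarrow> complex) \<Rightarrow> bool" where
  "rectifiable_path \<gamma> \<longleftrightarrow> path \<gamma> \<and>
     (\<exists>B. \<forall>D. D division_of {0..1} \<longrightarrow> (\<Sum>k\<in>D. dist (\<gamma> (Inf k)) (\<gamma> (Sup k))) \<le> B)"

text \<open>The library's contour integral uses the derivative of the path and so does not apply to
  arbitrary parametrisations of rectifiable curves.  The line integral is therefore taken as the
  Riemann--Stieltjes limit of \<open>\<Sum> h (\<gamma> t\<^sub>i) (\<gamma> b\<^sub>i - \<gamma> a\<^sub>i)\<close> over tagged divisions of mesh tending to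
  zero.\<close>

definition has_line_integral ::
    "(complex \<Rightarrow> complex) \<Rightarrow> complex \<Rightarrow> (real \<Rightarrow> complex) \<Rightarrow> bool" where
  "has_line_integral h v \<gamma> \<longleftrightarrow>
     (\<forall>e>0. \<exists>d>0. \<forall>D. D tagged_division_of {0..1} \<and> (\<forall>(t, k)\<in>D. diameter k < d) \<longrightarrow>
        norm ((\<Sum>(t, k)\<in>D. h (\<gamma> t) * (\<gamma> (Sup k) - \<gamma> (Inf k))) - v) < e)"

text \<open>\<open>v\<close> is the value of \<open>\<integral> g(s) ds f(s)\<close> along the curve \<open>slice_emb I \<circ> \<gamma>\<close>; here
  \<open>f = F + GJ\<close> and \<open>g = H + JK\<close> on the support.\<close>

definition has_slice_integral ::
    "quat \<Rightarrow> (real \<Rightarrow> complex) \<Rightarrow> (quat \<Rightarrow> quat) \<Rightarrow> (quat \<Rightarrow> quat) \<Rightarrow> quat \<Rightarrow> bool" where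
  "has_slice_integral I \<gamma> g f v \<longleftrightarrow>
     (\<exists>J\<in>imag_units. orthogonal I J \<and>
       (\<exists>F G H K :: complex \<Rightarrow> complex.
          (\<forall>z\<in>path_image \<gamma>.
             f (slice_emb I z) = slice_emb I (F z) + slice_emb I (G z) * J \<and>
             g (slice_emb I z) = slice_emb I (H z) + J * slice_emb I (K z)) \<and>
          (\<exists>v1 v2 v3 v4.
             has_line_integral (\<lambda>z. H z * F z) v1 \<gamma> \<and>
             has_line_integral (\<lambda>z. H z * G z) v2 \<gamma> \<and>
             has_line_integral (\<lambda>z. K z * F z) v3 \<gamma> \<and>
             has_line_integral (\<lambda>z. K z * G z) v4 \<gamma> \<and>
             v = slice_emb I v1 + slice_emb I v2 * J +
                 J * slice_emb I v3 + J * slice_emb I v4 * J)))"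

section \<open>Integrals over the boundary of a slice\<close>

text \<open>\<open>\<Gamma>\<close> parametrises the boundary of \<open>U \<inter> L\<^sub>I\<close> in \<open>L\<^sub>I\<close> by finitely many disjoint rectifiable Jordan
  curves, in the coordinates given by \<open>slice_emb I\<close>.\<close>

definition jordan_boundary :: "quat \<Rightarrow> quat set \<Rightarrow> (real \<Rightarrow> complex) set \<Rightarrow> bool" where
  "jordan_boundary I U \<Gamma> \<longleftrightarrow>
     finite \<Gamma> \<and>
     (\<forall>\<gamma>\<in>\<Gamma>. simple_path \<gamma> \<and> pathfinish \<gamma> = pathstart \<gamma> \<and> rectifiable_path \<gamma>) \<and>
     pairwise (\<lambda>\<gamma> \<delta>. disjnt (path_image \<gamma>) (path_image \<delta>)) \<Gamma> \<and>
     top_of_set (slice_plane I) frontier_of (U \<inter> slice_plane I) =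
       (\<Union>\<gamma>\<in>\<Gamma>. slice_emb I ` path_image \<gamma>)"

definition counterclockwise :: "(real \<Rightarrow> complex) \<Rightarrow> bool" where
  "counterclockwise \<gamma> \<longleftrightarrow> (\<forall>z\<in>inside (path_image \<gamma>). winding_number \<gamma> z = 1)"

text \<open>The positive orientation keeps \<open>E\<close> on the left.  Relative to the counterclockwise
  parametrisation of a boundary curve this is the sign \<open>1\<close> if \<open>E\<close> lies inside the curve near it and
  \<open>-1\<close> if \<open>E\<close> lies outside.  If \<open>E\<close> lies on both sides (as for a disc with a circle removed), the
  curve is traversed once in each direction, with total sign \<open>0\<close>.\<close>

definition boundary_sign :: "complex set \<Rightarrow> (real \<Rightarrow> complex) \<Rightarrow> real" where
  "boundary_sign E \<gamma> =
     (if path_image \<gamma> \<inter> closure (E \<inter> inside (path_image \<gamma>)) \<noteq> {} then 1 else 0) -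
     (if path_image \<gamma> \<inter> closure (E \<inter> outside (path_image \<gamma>)) \<noteq> {} then 1 else 0)"

text \<open>The integral \<open>\<integral> g(s) ds f(s)\<close> over the positively oriented boundary of \<open>U \<inter> L\<^sub>I\<close> exists and is
  \<open>v\<close>, whichever counterclockwise parametrisation is used (and there is one).\<close>

definition has_boundary_integral ::
    "quat \<Rightarrow> quat set \<Rightarrow> (quat \<Rightarrow> quat) \<Rightarrow> (quat \<Rightarrow> quat) \<Rightarrow> quat \<Rightarrow> bool" where
  "has_boundary_integral I U g f v \<longleftrightarrow>
     (\<exists>\<Gamma>. jordan_boundary I U \<Gamma> \<and> (\<forall>\<gamma>\<in>\<Gamma>. counterclockwise \<gamma>)) \<and>
     (\<forall>\<Gamma>. jordan_boundary I U \<Gamma> \<and> (\<forall>\<gamma>\<in>\<Gamma>. counterclockwise \<gamma>) \<longrightarrow>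
        (\<exists>w. (\<forall>\<gamma>\<in>\<Gamma>. has_slice_integral I \<gamma> g f (w \<gamma>)) \<and>
             v = (\<Sum>\<gamma>\<in>\<Gamma>. boundary_sign (slice_emb I -` U) \<gamma> *\<^sub>R w \<gamma>)))"

definition cauchy_kernel :: "quat \<Rightarrow> quat \<Rightarrow> quat" where
  "cauchy_kernel s q =
     inverse (of_real ((norm s)\<^sup>2) - 2 * q * of_real (qre s) + q\<^sup>2) * (qcnj s - q)"

end

theory Submission
  imports Defs
begin
text \<open>
  Because \<open>U\<close> is symmetric, all its slices are copies of one open set \<open>E\<close> in the complex plane, which
  is invariant under conjugation.  The statement splits into a Cauchy formula for \<open>E\<close> and a local
  representation of \<open>f\<close> by a holomorphic stem function.

  \<^bold>\<open>Representation.\<close>  The part of the closure of \<open>E\<close> in the closed upper half plane is compact and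
  connected, and the slice of \<open>\<Omega>\<close> at \<open>J\<^sub>0\<close> contains it and is connected.  Join it to the real axis
  inside that slice, and let \<open>N\<close> be a connected neighbourhood of the result.  If \<open>N\<close> is thin, then
  \<open>x + yJ\<close> lies in \<open>\<Omega>\<close> for \<open>x + iy \<in> N\<close> and all \<open>J\<close> near \<open>J\<^sub>0\<close>.  Two of these slices determine
  \<open>B\<close> and \<open>C\<close> with \<open>f (x + yJ) = B + J C\<close>; then \<open>(B, C)\<close> satisfies the Cauchy--Riemann equations, so
  \<open>B + J C\<close> is holomorphic for every \<open>J\<close>.  It agrees with \<open>f\<close> on the real points of \<open>N\<close>, hence on
  all of \<open>N\<close> by the identity theorem (\<open>local_representation\<close>).  Near real points of the closure
  of \<open>E\<close> every \<open>J\<close> is allowed, so there \<open>B\<close> is even and \<open>C\<close> is odd under conjugation; this makes it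
  possible to extend \<open>(B, C)\<close> by reflection to a neighbourhood of the closure of \<open>E\<close>
  (\<open>symmetric_stem\<close>).  The spherical value and derivative are \<open>B\<close> and \<open>C/y\<close>, so on \<open>\<partial>U\<close> the function
  \<open>ftilde\<close> is \<open>B + I C\<close> on the slice of \<open>I\<close>.

  \<^bold>\<open>Cauchy formula.\<close>  By Janiszewski's theorem two points off the boundary curves which lie inside
  the same curves are not separated by \<open>\<partial>E\<close>.  Hence the sum of the winding numbers of the boundary
  curves, with the orientation signs, jumps across each curve exactly as the indicator function of
  \<open>E\<close> does, and the two functions are equal (\<open>boundary_sign_winding_sum\<close>).  A rectifiable loop may be
  replaced by a nearby smooth one without changing integrals of holomorphic functions or winding
  numbers (\<open>rectifiable_loop_approximation\<close>), and the loops in one component of the domain can be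
  joined to a single loop (\<open>join_loops\<close>), to which the global form of Cauchy's theorem applies.  This
  yields the formula for holomorphic functions on a neighbourhood of the closure of \<open>E\<close>
  (\<open>Cauchy_formula_jordan_frontier\<close>).

  \<^bold>\<open>Kernel.\<close>  As a function of \<open>q = x + yM\<close> the kernel is a combination of its values at \<open>x + yI\<close>
  and \<open>x - yI\<close>, with the coefficients \<open>(1 - MI)/2\<close> and \<open>(1 + MI)/2\<close>; at these two points of the
  slice of \<open>I\<close> it is the ordinary Cauchy kernel (\<open>cauchy_kernel_slice\<close>).  The function \<open>B + M C\<close> is
  the same combination of its values at these points, so the formula at \<open>q\<close> follows from the
  complex one, applied to the components of \<open>B + I C\<close> (\<open>Cauchy_formula_slice\<close>).
\<close>

section \<open>Line integrals along rectifiable paths\<close>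

text \<open>The Riemann--Stieltjes sum of \<open>h\<close> along \<open>\<gamma>\<close> for the tagged division \<open>D\<close>.\<close>

definition stieltjes_sum :: "(complex \<Rightarrow> complex) \<Rightarrow> (real \<Rightarrow> complex) \<Rightarrow> (real \<times> real set) set \<Rightarrow> complex"
  where "stieltjes_sum h \<gamma> D = (\<Sum>(t, k)\<in>D. h (\<gamma> t) * (\<gamma> (Sup k) - \<gamma> (Inf k)))"

text \<open>A tagged division of the unit interval of mesh less than \<open>d\<close>.\<close>

definition mesh_division :: "real \<Rightarrow> (real \<times> real set) set \<Rightarrow> bool"
  where "mesh_division d D \<longleftrightarrow> D tagged_division_of {0..1} \<and> (\<forall>(t, k)\<in>D. diameter k < d)"

lemma has_line_integral_iff:
  "has_line_integral h v \<gamma> \<longleftrightarrow>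
     (\<forall>e>0. \<exists>d>0. \<forall>D. mesh_division d D \<longrightarrow> norm (stieltjes_sum h \<gamma> D - v) < e)"
  unfolding has_line_integral_def stieltjes_sum_def mesh_division_def ..

lemma mesh_division_mono: "mesh_division d D \<Longrightarrow> d \<le> d' \<Longrightarrow> mesh_division d' D"
  unfolding mesh_division_def by fastforce

lemma stieltjes_sum_add:
  "stieltjes_sum (\<lambda>z. f z + g z) \<gamma> D = stieltjes_sum f \<gamma> D + stieltjes_sum g \<gamma> D"
  unfolding stieltjes_sum_def sum.distrib[symmetric] by (intro sum.cong) (auto simp: algebra_simps)

lemma stieltjes_sum_cmult: "stieltjes_sum (\<lambda>z. c * f z) \<gamma> D = c * stieltjes_sum f \<gamma> D"
  unfolding stieltjes_sum_def sum_distrib_left by (intro sum.cong) (auto simp: algebra_simps)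

lemma stieltjes_sum_cong:
  assumes "D tagged_division_of {0..1}" "\<And>z. z \<in> path_image \<gamma> \<Longrightarrow> f z = g z"
  shows "stieltjes_sum f \<gamma> D = stieltjes_sum g \<gamma> D"
  unfolding stieltjes_sum_def
proof (intro sum.cong refl, clarify)
  fix t k assume "(t, k) \<in> D"
  then have "t \<in> {0..1}" using tagged_division_ofD(2,3)[OF assms(1)] by blast
  then have "\<gamma> t \<in> path_image \<gamma>" by (simp add: path_image_def)
  then show "f (\<gamma> t) * (\<gamma> (Sup k) - \<gamma> (Inf k)) = g (\<gamma> t) * (\<gamma> (Sup k) - \<gamma> (Inf k))"
    using assms(2) by simp
qed

lemma has_line_integral_add:
  assumes "has_line_integral f u \<gamma>" "has_line_integral g v \<gamma>"
  shows "has_line_integral (\<lambda>z. f z + g z) (u + v) \<gamma>"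
  unfolding has_line_integral_iff
proof (intro allI impI)
  fix e :: real assume "e > 0"
  then have e2: "e / 2 > 0" by simp
  obtain d1 where d1: "d1 > 0" "\<And>D. mesh_division d1 D \<Longrightarrow> norm (stieltjes_sum f \<gamma> D - u) < e / 2"
    using assms(1) e2 unfolding has_line_integral_iff by meson
  obtain d2 where d2: "d2 > 0" "\<And>D. mesh_division d2 D \<Longrightarrow> norm (stieltjes_sum g \<gamma> D - v) < e / 2"
    using assms(2) e2 unfolding has_line_integral_iff by meson
  show "\<exists>d>0. \<forall>D. mesh_division d D \<longrightarrow>
      norm (stieltjes_sum (\<lambda>z. f z + g z) \<gamma> D - (u + v)) < e"
  proof (intro exI[of _ "min d1 d2"] conjI allI impI)
    fix D assume "mesh_division (min d1 d2) D"
    then have "mesh_division d1 D" "mesh_division d2 D"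
      by (auto elim: mesh_division_mono)
    then have "norm ((stieltjes_sum f \<gamma> D - u) + (stieltjes_sum g \<gamma> D - v)) < e"
      using d1(2) d2(2) by (intro norm_triangle_lt) fastforce
    then show "norm (stieltjes_sum (\<lambda>z. f z + g z) \<gamma> D - (u + v)) < e"
      by (simp only: stieltjes_sum_add add_diff_add)
  qed (use d1(1) d2(1) in simp)
qed

lemma has_line_integral_cmult:
  assumes "has_line_integral f u \<gamma>"
  shows "has_line_integral (\<lambda>z. c * f z) (c * u) \<gamma>"
  unfolding has_line_integral_iff
proof (intro allI impI)
  fix e :: real assume "e > 0"
  have c: "norm c + 1 > 0" by (smt (verit) norm_ge_zero)
  then have e2: "e / (norm c + 1) > 0" using \<open>e > 0\<close> by simp
  obtain d where d: "d > 0"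
      "\<And>D. mesh_division d D \<Longrightarrow> norm (stieltjes_sum f \<gamma> D - u) < e / (norm c + 1)"
    using assms(1) e2 unfolding has_line_integral_iff by meson
  show "\<exists>d>0. \<forall>D. mesh_division d D \<longrightarrow>
      norm (stieltjes_sum (\<lambda>z. c * f z) \<gamma> D - c * u) < e"
  proof (intro exI[of _ d] conjI allI impI)
    fix D assume D: "mesh_division d D"
    have "norm (stieltjes_sum (\<lambda>z. c * f z) \<gamma> D - c * u) = norm c * norm (stieltjes_sum f \<gamma> D - u)"
      by (metis stieltjes_sum_cmult norm_mult right_diff_distrib)
    also have "\<dots> \<le> (norm c + 1) * norm (stieltjes_sum f \<gamma> D - u)"
      by (simp add: mult_right_mono)
    also have "\<dots> < e"
      using d(2)[OF D] c by (simp add: pos_less_divide_eq mult.commute)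
    finally show "norm (stieltjes_sum (\<lambda>z. c * f z) \<gamma> D - c * u) < e" .
  qed (rule d(1))
qed

lemma has_line_integral_cong:
  assumes "has_line_integral f v \<gamma>" "\<And>z. z \<in> path_image \<gamma> \<Longrightarrow> f z = g z"
  shows "has_line_integral g v \<gamma>"
proof -
  have "stieltjes_sum g \<gamma> D = stieltjes_sum f \<gamma> D" if "mesh_division d D" for d D
    using stieltjes_sum_cong[of D \<gamma> f g] assms(2) that unfolding mesh_division_def by simp
  then show ?thesis using assms(1) unfolding has_line_integral_iff by metis
qed

text \<open>A function whose increments are, on short intervals, close to those of a function \<open>\<Phi>\<close>,
  relative to the increments of the rectifiable path, has the total increment of \<open>\<Phi>\<close> as its line
  integral.\<close>

lemma has_line_integral_increments:
  assumes "rectifiable_path \<gamma>"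
    and "\<And>e. e > 0 \<Longrightarrow> \<exists>d>0. \<forall>a b t. 0 \<le> a \<and> a \<le> t \<and> t \<le> b \<and> b \<le> 1 \<and> b - a < d \<longrightarrow>
           norm (h (\<gamma> t) * (\<gamma> b - \<gamma> a) - (\<Phi> b - \<Phi> a)) \<le> e * norm (\<gamma> b - \<gamma> a)"
  shows "has_line_integral h (\<Phi> 1 - \<Phi> 0) \<gamma>"
  unfolding has_line_integral_iff
proof (intro allI impI)
  fix e :: real assume "e > 0"
  obtain B where B: "\<And>D. D division_of {0..1} \<Longrightarrow> (\<Sum>k\<in>D. dist (\<gamma> (Inf k)) (\<gamma> (Sup k))) \<le> B"
    using assms(1) unfolding rectifiable_path_def by blast
  define e' where "e' = e / (\<bar>B\<bar> + 1)"
  have e': "e' > 0" using \<open>e > 0\<close> by (simp add: e'_def)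
  obtain d where d: "d > 0" "\<And>a b t. 0 \<le> a \<Longrightarrow> a \<le> t \<Longrightarrow> t \<le> b \<Longrightarrow> b \<le> 1 \<Longrightarrow> b - a < d \<Longrightarrow>
           norm (h (\<gamma> t) * (\<gamma> b - \<gamma> a) - (\<Phi> b - \<Phi> a)) \<le> e' * norm (\<gamma> b - \<gamma> a)"
    using assms(2)[OF e'] by blast
  let ?S = "stieltjes_sum h \<gamma>"
  show "\<exists>d>0. \<forall>D. mesh_division d D \<longrightarrow>
      norm (?S D - (\<Phi> 1 - \<Phi> 0)) < e"
  proof (intro exI[of _ d] conjI allI impI)
    fix D assume D: "mesh_division d D"
    then have Dt: "D tagged_division_of {0..1}" unfolding mesh_division_def by blast
    have ne: "k \<noteq> {}" if "k \<in> snd ` D" for k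
      using that tagged_division_ofD(2)[OF Dt] by fastforce
    have "?S D - (\<Phi> 1 - \<Phi> 0) =
        ?S D - (\<Sum>(t, k)\<in>D. \<Phi> (Sup k) - \<Phi> (Inf k))"
      using additive_tagged_division_1[OF _ Dt, of \<Phi>] by simp
    also have "\<dots> = (\<Sum>(t, k)\<in>D. h (\<gamma> t) * (\<gamma> (Sup k) - \<gamma> (Inf k)) - (\<Phi> (Sup k) - \<Phi> (Inf k)))"
      by (simp only: stieltjes_sum_def sum_subtractf case_prod_unfold)
    also have "norm \<dots> \<le> (\<Sum>(t, k)\<in>D. e' * dist (\<gamma> (Inf k)) (\<gamma> (Sup k)))"
    proof (rule sum_norm_le, clarify)
      fix t k assume tk: "(t, k) \<in> D"
      obtain a b where "k = cbox a b" using tagged_division_ofD(4)[OF Dt tk] by blast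
      then have k: "k = cbox a b" "t \<in> k" "k \<subseteq> {0..1}"
        using tagged_division_ofD(2,3)[OF Dt tk] by auto
      then have ab: "a \<le> t" "t \<le> b" "0 \<le> a" "b \<le> 1" "Sup k = b" "Inf k = a" by auto
      moreover have "b - a < d"
        using D tk k(1) ab unfolding mesh_division_def by fastforce
      ultimately show "norm (h (\<gamma> t) * (\<gamma> (Sup k) - \<gamma> (Inf k)) - (\<Phi> (Sup k) - \<Phi> (Inf k)))
          \<le> e' * dist (\<gamma> (Inf k)) (\<gamma> (Sup k))"
        using d(2)[of a t b] by (simp add: dist_norm norm_minus_commute)
    qed
    also have "\<dots> = e' * (\<Sum>(t, k)\<in>D. dist (\<gamma> (Inf k)) (\<gamma> (Sup k)))"
      by (simp add: sum_distrib_left case_prod_unfold)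
    also have "(\<Sum>(t, k)\<in>D. dist (\<gamma> (Inf k)) (\<gamma> (Sup k))) =
        (\<Sum>(t, k)\<in>D. if k = {} then 0 else dist (\<gamma> (Inf k)) (\<gamma> (Sup k)))"
      by (intro sum.cong refl) (use ne in force)
    also have "\<dots> = (\<Sum>k\<in>snd ` D. if k = {} then 0 else dist (\<gamma> (Inf k)) (\<gamma> (Sup k)))"
    proof (rule sum.over_tagged_division_lemma[OF Dt, where d = "\<lambda>k. if k = {} then 0 else dist (\<gamma> (Inf k)) (\<gamma> (Sup k))"])
      fix u v :: real assume "box u v = {}"
      then show "(if cbox u v = {} then 0 else dist (\<gamma> (Inf (cbox u v))) (\<gamma> (Sup (cbox u v)))) = 0"
        by (cases "u = v") (auto simp: not_less)
    qed
    also have "\<dots> = (\<Sum>k\<in>snd ` D. dist (\<gamma> (Inf k)) (\<gamma> (Sup k)))"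
      by (intro sum.cong refl) (use ne in simp)
    also have "e' * \<dots> \<le> e' * B"
      using B[OF division_of_tagged_division[OF Dt]] e' by (simp add: mult_left_mono)
    also have "\<dots> < e"
    proof -
      have "e' * B < e' * (\<bar>B\<bar> + 1)" using e' by (intro mult_strict_left_mono) auto
      then show ?thesis by (simp add: e'_def)
    qed
    finally show "norm (?S D - (\<Phi> 1 - \<Phi> 0)) < e" .
  qed (rule d(1))
qed

text \<open>A polynomial path \<open>p\<close> close to \<open>\<gamma>\<close> does the job.  With \<open>\<Phi> s\<close> the integral of \<open>h\<close> along \<open>p\<close> up
  to \<open>p s\<close> and then along the segment from \<open>p s\<close> to \<open>\<gamma> s\<close>, the increments of \<open>\<Phi>\<close> over short intervals
  are those of a local primitive of \<open>h\<close> along \<open>\<gamma>\<close>.\<close>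

proposition rectifiable_loop_approximation:
  assumes rect: "rectifiable_path \<gamma>" and loop: "pathfinish \<gamma> = pathstart \<gamma>"
    and W: "open W" "path_image \<gamma> \<subseteq> W"
  obtains p where "valid_path p" "pathfinish p = pathstart p" "path_image p \<subseteq> W"
    "\<And>w. w \<notin> W \<Longrightarrow> winding_number p w = winding_number \<gamma> w"
    "\<And>h. h holomorphic_on W \<Longrightarrow> has_line_integral h (contour_integral p h) \<gamma>"
proof -
  have pg: "path \<gamma>" using rect by (simp add: rectifiable_path_def)
  obtain r where r: "r > 0" "(\<Union>x\<in>path_image \<gamma>. ball x r) \<subseteq> W"
    using compact_subset_open_imp_ball_epsilon_subset[OF compact_path_image[OF pg] W] by blast
  have inI: "\<gamma> t \<in> path_image \<gamma>" if "t \<in> {0..1}" for t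
    using that by (simp add: path_image_def)
  have inW: "ball (\<gamma> t) r \<subseteq> W" if "t \<in> {0..1}" for t using r(2) inI[OF that] by blast
  obtain p where p: "polynomial_function p" "pathstart p = pathstart \<gamma>" "pathfinish p = pathfinish \<gamma>"
      and near: "\<And>t. t \<in> {0..1} \<Longrightarrow> norm (p t - \<gamma> t) < r / 4"
    using path_approx_polynomial_function[OF pg, of "r / 4"] r(1) by auto
  have vp: "valid_path p" using p(1) by (rule valid_path_polynomial_function)
  have pW: "path_image p \<subseteq> W"
  proof
    fix z assume "z \<in> path_image p"
    then obtain t where t: "t \<in> {0..1}" "z = p t" by (auto simp: path_image_def)
    then have "z \<in> ball (\<gamma> t) r" using near[OF t(1)] r(1) by (simp add: dist_norm norm_minus_commute)
    then show "z \<in> W" using inW[OF t(1)] by blast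
  qed
  have wn: "winding_number p w = winding_number \<gamma> w" if "w \<notin> W" for w
  proof (rule winding_number_nearby_paths_eq)
    fix t :: real assume t: "t \<in> {0..1}"
    have "w \<notin> ball (\<gamma> t) r" using inW[OF t] that by blast
    then show "norm (p t - \<gamma> t) < norm (\<gamma> t - w)"
      using near[OF t] r(1) by (simp add: dist_norm)
  qed (use vp pg p valid_path_imp_path in auto)
  have li: "has_line_integral h (contour_integral p h) \<gamma>" if h: "h holomorphic_on W" for h
  proof -
    define \<Phi> where "\<Phi> s = contour_integral (subpath 0 s p) h +
        contour_integral (linepath (p s) (\<gamma> s)) h" for s
    have hp: "h contour_integrable_on p"
      using contour_integrable_holomorphic_simple[OF h W(1) vp pW] .
    have "has_line_integral h (\<Phi> 1 - \<Phi> 0) \<gamma>"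
    proof (rule has_line_integral_increments[OF rect])
      fix e :: real assume e: "e > 0"
      define K where "K = {x + y | x y. x \<in> path_image \<gamma> \<and> y \<in> cball 0 (r/2)}"
      have "compact K" unfolding K_def by (intro compact_sums compact_path_image pg compact_cball)
      have inK: "z \<in> K" if "t \<in> {0..1}" "dist (\<gamma> t) z < r/2" for t z
        unfolding K_def using that inI
        by (intro CollectI exI[of _ "\<gamma> t"] exI[of _ "z - \<gamma> t"]) (auto simp: dist_norm norm_minus_commute)
      have "K \<subseteq> W"
      proof
        fix z assume "z \<in> K"
        then obtain x y where "z = x + y" "x \<in> path_image \<gamma>" "norm y \<le> r / 2"
          unfolding K_def by auto
        then have "z \<in> ball x r" using r(1) by (simp add: dist_norm)
        then show "z \<in> W" using r(2) \<open>x \<in> path_image \<gamma>\<close> by blast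
      qed
      then have "uniformly_continuous_on K h"
        using \<open>compact K\<close> h holomorphic_on_imp_continuous_on holomorphic_on_subset
          compact_uniformly_continuous by metis
      then obtain \<rho> where \<rho>: "\<rho> > 0" "\<And>x y. x \<in> K \<Longrightarrow> y \<in> K \<Longrightarrow> dist y x < \<rho> \<Longrightarrow> dist (h y) (h x) < e"
        using e unfolding uniformly_continuous_on_def by metis
      define \<rho>' where "\<rho>' = min \<rho> (r/4)"
      have \<rho>': "\<rho>' > 0" using \<rho>(1) r(1) by (simp add: \<rho>'_def)
      have "uniformly_continuous_on {0..1} \<gamma>"
        using pg by (intro compact_uniformly_continuous) (auto simp: path_def)
      then obtain d where d: "d > 0"
          "\<And>x y. x \<in> {0..1} \<Longrightarrow> y \<in> {0..1} \<Longrightarrow> dist y x < d \<Longrightarrow> dist (\<gamma> y) (\<gamma> x) < \<rho>'"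
        using \<rho>' unfolding uniformly_continuous_on_def by metis
      show "\<exists>d>0. \<forall>a b t. 0 \<le> a \<and> a \<le> t \<and> t \<le> b \<and> b \<le> 1 \<and> b - a < d \<longrightarrow>
           norm (h (\<gamma> t) * (\<gamma> b - \<gamma> a) - (\<Phi> b - \<Phi> a)) \<le> e * norm (\<gamma> b - \<gamma> a)"
      proof (intro exI[of _ d] conjI allI impI d(1))
        fix a b t assume "0 \<le> a \<and> a \<le> t \<and> t \<le> b \<and> b \<le> 1 \<and> b - a < d"
        then have ab: "0 \<le> a" "a \<le> t" "t \<le> b" "b \<le> 1" "b - a < d" by auto
        then have t: "t \<in> {0..1}" and a: "a \<in> {0..1}" and b: "b \<in> {0..1}" by auto
        define B where "B = ball (\<gamma> t) (r/2)"
        have BW: "B \<subseteq> W" using inW[OF t] r(1) subset_ball[of "r/2" r "\<gamma> t"] by (simp add: B_def)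
        obtain G where G: "\<And>z. z \<in> B \<Longrightarrow> (G has_field_derivative h z) (at z within B)"
          using holomorphic_convex_primitive'[of B h] h BW holomorphic_on_subset
          unfolding B_def by (metis convex_ball open_ball)
        have close: "dist (\<gamma> s) (\<gamma> t) < \<rho>'" if "a \<le> s" "s \<le> b" for s
          using that ab t by (intro d(2)) (auto simp: dist_real_def)
        then have gB: "\<gamma> s \<in> B" if "a \<le> s" "s \<le> b" for s
          using that r(1) unfolding B_def \<rho>'_def by (force simp: dist_commute)
        have pB: "p s \<in> B" if "a \<le> s" "s \<le> b" for s
        proof -
          have "norm (p s - \<gamma> s) < r / 4" using near that ab by auto
          moreover have "norm (\<gamma> s - \<gamma> t) < r / 4"
            using close[OF that] by (simp add: dist_norm \<rho>'_def)
          ultimately have "norm ((p s - \<gamma> s) + (\<gamma> s - \<gamma> t)) < r / 2"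
            by (intro norm_triangle_lt) linarith
          then show ?thesis by (simp add: B_def dist_norm norm_minus_commute)
        qed
        have seg: "contour_integral (linepath u v) h = G v - G u" if "u \<in> B" "v \<in> B" for u v
        proof (rule contour_integral_unique)
          have "path_image (linepath u v) \<subseteq> B"
            using that convex_ball[of "\<gamma> t" "r/2"] by (simp add: B_def closed_segment_subset)
          from contour_integral_primitive[OF G _ this] show "(h has_contour_integral G v - G u) (linepath u v)"
            by simp
        qed
        have "contour_integral (subpath a b p) h = G (p b) - G (p a)"
        proof (rule contour_integral_unique)
          have im: "path_image (subpath a b p) \<subseteq> B"
            using pB ab by (auto simp: path_image_subpath)
          have "valid_path (subpath a b p)" using vp a b by (rule valid_path_subpath)
          from contour_integral_primitive[OF G this im]
          show "(h has_contour_integral G (p b) - G (p a)) (subpath a b p)" by simp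
        qed
        moreover have "contour_integral (subpath 0 a p) h + contour_integral (subpath a b p) h =
            contour_integral (subpath 0 b p) h"
          using contour_integral_subpath_combine[OF hp vp _ a b, of 0] by simp
        ultimately have sub: "contour_integral (subpath 0 b p) h =
            contour_integral (subpath 0 a p) h + (G (p b) - G (p a))"
          by simp
        have inc: "\<Phi> b - \<Phi> a = G (\<gamma> b) - G (\<gamma> a)"
          using gB[of a] gB[of b] pB[of a] pB[of b] ab by (simp add: \<Phi>_def sub seg)
        \<comment> \<open>the mean value inequality for \<open>z \<mapsto> h (\<gamma> t) z - G z\<close>, whose derivative is small near \<open>\<gamma> t\<close>\<close>
        define B' where "B' = ball (\<gamma> t) \<rho>'"
        have B'B: "B' \<subseteq> B" using r(1) by (auto simp: B'_def B_def \<rho>'_def)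
        have "norm ((h (\<gamma> t) * \<gamma> b - G (\<gamma> b)) - (h (\<gamma> t) * \<gamma> a - G (\<gamma> a))) \<le> e * norm (\<gamma> b - \<gamma> a)"
        proof (rule field_differentiable_bound[of B' "\<lambda>z. h (\<gamma> t) * z - G z" "\<lambda>z. h (\<gamma> t) - h z"])
          show "convex B'" by (simp add: B'_def)
          show "\<gamma> b \<in> B'" "\<gamma> a \<in> B'"
            using close[of a] close[of b] ab by (auto simp: B'_def dist_commute)
          fix z assume z: "z \<in> B'"
          have "(G has_field_derivative h z) (at z within B')"
            using G B'B z DERIV_subset by blast
          then show "((\<lambda>z. h (\<gamma> t) * z - G z) has_field_derivative h (\<gamma> t) - h z) (at z within B')"
            by (auto intro!: derivative_eq_intros)
          have "\<gamma> t \<in> K" using inK[OF t, of "\<gamma> t"] r(1) by simp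
          moreover have "z \<in> K" using inK[OF t, of z] z B'B by (auto simp: B_def)
          moreover have "dist (\<gamma> t) z < \<rho>" using z by (simp add: B'_def \<rho>'_def)
          ultimately show "norm (h (\<gamma> t) - h z) \<le> e"
            using \<rho>(2)[of z "\<gamma> t"] by (simp add: dist_norm)
        qed
        then show "norm (h (\<gamma> t) * (\<gamma> b - \<gamma> a) - (\<Phi> b - \<Phi> a)) \<le> e * norm (\<gamma> b - \<gamma> a)"
          unfolding inc by (simp add: algebra_simps)
      qed
    qed
    moreover have "\<Phi> 1 = contour_integral p h" "\<Phi> 0 = 0"
      using p(2,3) by (auto simp: \<Phi>_def pathstart_def pathfinish_def)
    ultimately show ?thesis by simp
  qed
  show ?thesis using that[OF vp _ pW wn li] p loop by simp
qed

text \<open>A combination of loops with coefficients \<open>-1\<close>, \<open>0\<close> and \<open>1\<close> in a connected open set is, for the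
  integration of holomorphic functions, a single loop: run through the loops (or their reversals) one
  after the other, connecting them by paths that are traversed once in each direction.\<close>

lemma join_loops:
  fixes s :: "'a \<Rightarrow> real"
  assumes C: "open C" "connected C" "C \<noteq> {}" and "finite A"
    and "\<And>i. i \<in> A \<Longrightarrow> valid_path (p i) \<and> pathfinish (p i) = pathstart (p i) \<and> path_image (p i) \<subseteq> C"
    and "\<And>i. i \<in> A \<Longrightarrow> s i \<in> {-1, 0, 1}"
  shows "\<exists>L. valid_path L \<and> pathfinish L = pathstart L \<and> path_image L \<subseteq> C \<and>
    (\<forall>g. g holomorphic_on C \<longrightarrow>
       contour_integral L g = (\<Sum>i\<in>A. of_real (s i) * contour_integral (p i) g))"
  using assms(4-6)
proof (induction A rule: finite_induct)
  case empty
  obtain a where "a \<in> C" using C by blast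
  then have "path_image (linepath a a) \<subseteq> C" by auto
  moreover have "pathfinish (linepath a a) = pathstart (linepath a a)"
    by (simp only: pathfinish_linepath pathstart_linepath)
  moreover have "contour_integral (linepath a a) g = (\<Sum>i\<in>{}. of_real (s i) * contour_integral (p i) g)" for g
    by (simp only: contour_integral_trivial sum.empty)
  ultimately show ?case using valid_path_linepath by blast
next
  case (insert i A)
  then obtain L where L: "valid_path L" "pathfinish L = pathstart L" "path_image L \<subseteq> C"
      "\<And>g. g holomorphic_on C \<Longrightarrow>
         contour_integral L g = (\<Sum>i\<in>A. of_real (s i) * contour_integral (p i) g)"
    by auto
  have p: "valid_path (p i)" "pathfinish (p i) = pathstart (p i)" "path_image (p i) \<subseteq> C"
    using insert.prems by auto
  obtain q where q: "valid_path q" "pathfinish q = pathstart q" "path_image q \<subseteq> C"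
      "\<And>g. contour_integral q g = of_real (s i) * contour_integral (p i) g"
  proof -
    consider "s i = 1" | "s i = -1" | "s i = 0" using insert.prems by auto
    then show ?thesis
    proof cases
      case 1 then show ?thesis using that[of "p i"] p by simp
    next
      case 2 then show ?thesis
        using that[of "reversepath (p i)"] p by (simp add: contour_integral_reversepath)
    next
      case 3
      obtain a where "a \<in> C" using C by blast
      then show ?thesis using 3 that[of "linepath a a"] by simp
    qed
  qed
  have "pathstart L \<in> C" "pathstart q \<in> C"
    using L(3) q(3) pathstart_in_path_image by blast+
  then obtain \<alpha> where \<alpha>: "polynomial_function \<alpha>" "path_image \<alpha> \<subseteq> C"
      "pathstart \<alpha> = pathstart L" "pathfinish \<alpha> = pathstart q"
    using connected_open_polynomial_connected[OF C(1,2)] by metis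
  have v\<alpha>: "valid_path \<alpha>" using \<alpha>(1) by (rule valid_path_polynomial_function)
  define M where "M = L +++ (\<alpha> +++ (q +++ reversepath \<alpha>))"
  have "valid_path M" "pathfinish M = pathstart M" "path_image M \<subseteq> C"
    using L q \<alpha> v\<alpha> by (auto simp: M_def path_image_join)
  moreover have "contour_integral M g = (\<Sum>i\<in>insert i A. of_real (s i) * contour_integral (p i) g)"
    if g: "g holomorphic_on C" for g
  proof -
    have int: "g contour_integrable_on r" if "valid_path r" "path_image r \<subseteq> C" for r
      using contour_integrable_holomorphic_simple[OF g C(1) that] .
    have "contour_integral M g = contour_integral L g + contour_integral q g"
      unfolding M_def using L q \<alpha> v\<alpha> int
      by (simp add: path_image_join contour_integral_reversepath contour_integrable_reversepath)
    then show ?thesis using L(4)[OF g] q(4) insert.hyps by simp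
  qed
  ultimately show ?case by blast
qed

section \<open>Winding numbers of a Jordan boundary\<close>

lemma inside_iff_on_connected_set:
  fixes \<gamma> :: "real \<Rightarrow> complex"
  assumes "simple_path \<gamma>" "pathfinish \<gamma> = pathstart \<gamma>"
    and "connected S" "S \<inter> path_image \<gamma> = {}" "a \<in> S" "b \<in> S"
  shows "a \<in> inside (path_image \<gamma>) \<longleftrightarrow> b \<in> inside (path_image \<gamma>)"
proof -
  have "frontier (inside (path_image \<gamma>)) = path_image \<gamma>"
    using Jordan_inside_outside[OF assms(1,2)] by blast
  then show ?thesis
    using connected_Int_frontier[OF assms(3), of "inside (path_image \<gamma>)"] assms(4-6) by auto
qed

text \<open>The components of the complement of disjoint Jordan curves are determined by which curves their
  points lie inside of: by Janiszewski's theorem, disjoint compact sets neither of which separates two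
  points do not separate them together.\<close>

lemma same_component_if_same_inside:
  fixes \<Gamma> :: "(real \<Rightarrow> complex) set"
  assumes "finite \<Gamma>"
    and "\<And>\<gamma>. \<gamma> \<in> \<Gamma> \<Longrightarrow> simple_path \<gamma> \<and> pathfinish \<gamma> = pathstart \<gamma>"
    and "pairwise (\<lambda>\<gamma> \<delta>. disjnt (path_image \<gamma>) (path_image \<delta>)) \<Gamma>"
    and "a \<notin> (\<Union>\<gamma>\<in>\<Gamma>. path_image \<gamma>)" "b \<notin> (\<Union>\<gamma>\<in>\<Gamma>. path_image \<gamma>)"
    and "\<And>\<gamma>. \<gamma> \<in> \<Gamma> \<Longrightarrow> a \<in> inside (path_image \<gamma>) \<longleftrightarrow> b \<in> inside (path_image \<gamma>)"
  shows "connected_component (- (\<Union>\<gamma>\<in>\<Gamma>. path_image \<gamma>)) a b"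
  using assms
proof (induction \<Gamma> rule: finite_induct)
  case empty
  show ?case unfolding connected_component_def by (rule exI[of _ UNIV]) (simp add: connected_UNIV)
next
  case (insert \<gamma> \<Gamma>)
  let ?T = "\<Union>\<gamma>\<in>\<Gamma>. path_image \<gamma>"
  have \<gamma>: "simple_path \<gamma>" "pathfinish \<gamma> = pathstart \<gamma>" using insert.prems by auto
  note J = Jordan_inside_outside[OF \<gamma>]
  have "connected_component (- ?T) a b"
    using insert.prems by (intro insert.IH) (auto simp: pairwise_insert)
  moreover have "connected_component (- path_image \<gamma>) a b"
  proof (cases "a \<in> inside (path_image \<gamma>)")
    case True
    then have "b \<in> inside (path_image \<gamma>)" using insert.prems by auto
    then show ?thesis unfolding connected_component_def
      using True J inside_no_overlap[of "path_image \<gamma>"] by blast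
  next
    case False
    then have "b \<notin> inside (path_image \<gamma>)" using insert.prems by auto
    then have "a \<in> outside (path_image \<gamma>)" "b \<in> outside (path_image \<gamma>)"
      using False insert.prems(3,4) inside_Un_outside[of "path_image \<gamma>"] by blast+
    then show ?thesis unfolding connected_component_def
      using J outside_no_overlap[of "path_image \<gamma>"] by blast
  qed
  moreover have "path_image \<gamma> \<inter> ?T = {}"
  proof -
    have "path_image \<gamma> \<inter> path_image \<delta> = {}" if "\<delta> \<in> \<Gamma>" for \<delta>
      using insert.prems(2) insert.hyps(2) that unfolding pairwise_insert disjnt_def by metis
    then show ?thesis by blast
  qed
  moreover have "closed ?T"
    using insert.hyps insert.prems(1)
    by (intro closed_UN) (auto intro!: closed_simple_path_image)
  ultimately have "connected_component (- (path_image \<gamma> \<union> ?T)) a b"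
    using \<gamma> by (intro Janiszewski) (auto intro!: compact_simple_path_image)
  then show ?case by simp
qed

text \<open>The bounded open set \<open>E\<close> has as its boundary the disjoint rectifiable Jordan curves in \<open>\<Gamma>\<close>, each
  of which is parametrised counterclockwise.  (The orientation as boundary of \<open>E\<close> is accounted for by
  \<^const>\<open>boundary_sign\<close>.)\<close>

definition jordan_frontier :: "complex set \<Rightarrow> (real \<Rightarrow> complex) set \<Rightarrow> bool" where
  "jordan_frontier E \<Gamma> \<longleftrightarrow> open E \<and> bounded E \<and> finite \<Gamma> \<and>
     (\<forall>\<gamma>\<in>\<Gamma>. simple_path \<gamma> \<and> pathfinish \<gamma> = pathstart \<gamma> \<and> rectifiable_path \<gamma> \<and> counterclockwise \<gamma>) \<and>
     pairwise (\<lambda>\<gamma> \<delta>. disjnt (path_image \<gamma>) (path_image \<delta>)) \<Gamma> \<and>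
     frontier E = (\<Union>\<gamma>\<in>\<Gamma>. path_image \<gamma>)"

context
  fixes E :: "complex set" and \<Gamma> :: "(real \<Rightarrow> complex) set"
  assumes jf: "jordan_frontier E \<Gamma>"
begin

lemma jordan_frontierD: "open E" "bounded E" "finite \<Gamma>"
    "\<And>\<gamma>. \<gamma> \<in> \<Gamma> \<Longrightarrow> simple_path \<gamma>" "\<And>\<gamma>. \<gamma> \<in> \<Gamma> \<Longrightarrow> pathfinish \<gamma> = pathstart \<gamma>"
    "\<And>\<gamma>. \<gamma> \<in> \<Gamma> \<Longrightarrow> rectifiable_path \<gamma>" "\<And>\<gamma>. \<gamma> \<in> \<Gamma> \<Longrightarrow> counterclockwise \<gamma>"
    "pairwise (\<lambda>\<gamma> \<delta>. disjnt (path_image \<gamma>) (path_image \<delta>)) \<Gamma>"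
    "frontier E = (\<Union>\<gamma>\<in>\<Gamma>. path_image \<gamma>)"
  using jf unfolding jordan_frontier_def by auto

lemma same_side_if_same_inside:
  assumes "a \<notin> frontier E" "b \<notin> frontier E"
    and "\<And>\<gamma>. \<gamma> \<in> \<Gamma> \<Longrightarrow> a \<in> inside (path_image \<gamma>) \<longleftrightarrow> b \<in> inside (path_image \<gamma>)"
  shows "a \<in> E \<longleftrightarrow> b \<in> E"
proof -
  have "connected_component (- frontier E) a b"
    unfolding jordan_frontierD(9) using assms jordan_frontierD
    by (intro same_component_if_same_inside) auto
  then obtain S where "connected S" "S \<subseteq> - frontier E" "a \<in> S" "b \<in> S"
    unfolding connected_component_def by blast
  then show ?thesis using connected_Int_frontier[of S E] by blast
qed

text \<open>Near a point of the boundary curve \<open>\<gamma>\<close>, being inside another curve \<open>\<delta>\<close> is the same as \<open>\<gamma>\<close> being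
  inside \<open>\<delta>\<close>.\<close>

lemma near_boundary_curve:
  assumes "\<gamma> \<in> \<Gamma>" "p \<in> path_image \<gamma>"
  obtains r where "r > 0" "\<And>w \<delta>. w \<in> ball p r \<Longrightarrow> \<delta> \<in> \<Gamma> - {\<gamma>} \<Longrightarrow> w \<notin> path_image \<delta> \<and>
      (w \<in> inside (path_image \<delta>) \<longleftrightarrow> path_image \<gamma> \<subseteq> inside (path_image \<delta>))"
proof -
  let ?T = "\<Union>\<delta>\<in>\<Gamma> - {\<gamma>}. path_image \<delta>"
  have disj: "path_image \<gamma> \<inter> path_image \<delta> = {}" if "\<delta> \<in> \<Gamma> - {\<gamma>}" for \<delta>
    using jordan_frontierD(8) assms(1) that by (auto simp: pairwise_def disjnt_def)
  have "closed ?T" using jordan_frontierD by (intro closed_UN) (auto intro!: closed_simple_path_image)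
  moreover have "p \<in> - ?T" using disj assms(2) by blast
  ultimately obtain r where r: "r > 0" "ball p r \<subseteq> - ?T"
    by (meson open_Compl openE)
  show ?thesis
  proof (rule that[OF r(1)])
    fix w \<delta> assume w: "w \<in> ball p r" and \<delta>: "\<delta> \<in> \<Gamma> - {\<gamma>}"
    define S where "S = ball p r \<union> path_image \<gamma>"
    have "connected S" unfolding S_def
      using centre_in_ball[of p r] r(1) assms jordan_frontierD(4)
      by (intro connected_Un) (blast intro!: connected_simple_path_image connected_ball)+
    moreover have "S \<inter> path_image \<delta> = {}" using r(2) disj[OF \<delta>] \<delta> by (auto simp: S_def)
    ultimately have "a \<in> inside (path_image \<delta>) \<longleftrightarrow> b \<in> inside (path_image \<delta>)"
      if "a \<in> S" "b \<in> S" for a b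
      using inside_iff_on_connected_set[of \<delta> S a b] jordan_frontierD(4,5) \<delta> that by blast
    then show "w \<notin> path_image \<delta> \<and>
        (w \<in> inside (path_image \<delta>) \<longleftrightarrow> path_image \<gamma> \<subseteq> inside (path_image \<delta>))"
      using w r(2) \<delta> assms(2) unfolding S_def by blast
  qed
qed

text \<open>On each side \<open>A\<close> of \<open>\<gamma>\<close>, the set \<open>E\<close> contains either all or none of the points close to \<open>\<gamma>\<close>, and
  \<^const>\<open>boundary_sign\<close> tests which of the two it is.\<close>

lemma near_boundary_mem_iff:
  assumes \<gamma>: "\<gamma> \<in> \<Gamma>" and p: "p \<in> path_image \<gamma>"
    and r: "r > 0" "\<And>w \<delta>. w \<in> ball p r \<Longrightarrow> \<delta> \<in> \<Gamma> - {\<gamma>} \<Longrightarrow> w \<notin> path_image \<delta> \<and>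
      (w \<in> inside (path_image \<delta>) \<longleftrightarrow> path_image \<gamma> \<subseteq> inside (path_image \<delta>))"
    and A: "A = inside (path_image \<gamma>) \<or> A = outside (path_image \<gamma>)"
    and w: "w \<in> ball p r" "w \<in> A"
  shows "w \<in> E \<longleftrightarrow> path_image \<gamma> \<inter> closure (E \<inter> A) \<noteq> {}"
proof -
  note J = Jordan_inside_outside[OF jordan_frontierD(4,5)[OF \<gamma>]]
  have frA: "frontier A = path_image \<gamma>" and disjA: "A \<inter> path_image \<gamma> = {}"
    using A J inside_no_overlap[of "path_image \<gamma>"] outside_no_overlap[of "path_image \<gamma>"] by blast+
  have same: "x \<in> E \<longleftrightarrow> y \<in> E"
    if x: "x \<in> A" "\<And>\<delta>. \<delta> \<in> \<Gamma> - {\<gamma>} \<Longrightarrow> x \<notin> path_image \<delta> \<and>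
      (x \<in> inside (path_image \<delta>) \<longleftrightarrow> path_image \<gamma> \<subseteq> inside (path_image \<delta>))"
    and y: "y \<in> A" "\<And>\<delta>. \<delta> \<in> \<Gamma> - {\<gamma>} \<Longrightarrow> y \<notin> path_image \<delta> \<and>
      (y \<in> inside (path_image \<delta>) \<longleftrightarrow> path_image \<gamma> \<subseteq> inside (path_image \<delta>))" for x y
  proof (rule same_side_if_same_inside)
    show "x \<notin> frontier E" "y \<notin> frontier E"
      using x y disjA unfolding jordan_frontierD(9) by blast+
    show "x \<in> inside (path_image \<delta>) \<longleftrightarrow> y \<in> inside (path_image \<delta>)" if "\<delta> \<in> \<Gamma>" for \<delta>
    proof (cases "\<delta> = \<gamma>")
      case True
      then show ?thesis using x(1) y(1) A inside_Int_outside[of "path_image \<gamma>"] by blast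
    next
      case False
      then show ?thesis using x(2)[of \<delta>] y(2)[of \<delta>] that by blast
    qed
  qed
  show ?thesis
  proof
    assume "w \<in> E"
    then have "ball p r \<inter> A \<subseteq> E \<inter> A" using same r(2) w by blast
    then have "closure (ball p r \<inter> A) \<subseteq> closure (E \<inter> A)" by (rule closure_mono)
    moreover have "p \<in> closure A" using p frA by (auto simp: frontier_def)
    then have "p \<in> closure (ball p r \<inter> A)"
      using open_Int_closure_subset[of "ball p r" A] r(1) by auto
    ultimately show "path_image \<gamma> \<inter> closure (E \<inter> A) \<noteq> {}" using p by blast
  next
    assume "path_image \<gamma> \<inter> closure (E \<inter> A) \<noteq> {}"
    then obtain p' where p': "p' \<in> path_image \<gamma>" "p' \<in> closure (E \<inter> A)" by blast
    obtain r' where r': "r' > 0" "\<And>w \<delta>. w \<in> ball p' r' \<Longrightarrow> \<delta> \<in> \<Gamma> - {\<gamma>} \<Longrightarrow> w \<notin> path_image \<delta> \<and>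
      (w \<in> inside (path_image \<delta>) \<longleftrightarrow> path_image \<gamma> \<subseteq> inside (path_image \<delta>))"
      using near_boundary_curve[OF \<gamma> p'(1)] by blast
    obtain w' where "w' \<in> E" "w' \<in> A" "w' \<in> ball p' r'"
      using p'(2) r'(1) unfolding closure_approachable by (auto simp: dist_commute)
    then show "w \<in> E" using same[of w w'] r(2) r'(2) w by blast
  qed
qed

text \<open>The difference \<open>u\<close> of the two sides is constant, off the boundary, on a small ball around every
  point of the plane.  The boundary has no interior, so \<open>u\<close> is constant off the boundary; and \<open>u\<close>
  vanishes far away.\<close>

lemma boundary_sign_inside_sum:
  assumes "z \<notin> frontier E"
  shows "(\<Sum>\<gamma>\<in>\<Gamma>. boundary_sign E \<gamma> * of_bool (z \<in> inside (path_image \<gamma>))) = of_bool (z \<in> E)"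
proof -
  let ?X = "frontier E"
  define u where "u z = of_bool (z \<in> E) -
      (\<Sum>\<gamma>\<in>\<Gamma>. boundary_sign E \<gamma> * of_bool (z \<in> inside (path_image \<gamma>)))" for z
  have "\<exists>r c. r > 0 \<and> (\<forall>w\<in>ball p r - ?X. u w = c)" for p
  proof (cases "p \<in> ?X")
    case False
    obtain r where r: "r > 0" "ball p r \<subseteq> - ?X"
      using False by (meson ComplI frontier_closed open_Compl openE)
    have "u w = u p" if w: "w \<in> ball p r" for w
    proof -
      have *: "w \<in> inside (path_image \<gamma>) \<longleftrightarrow> p \<in> inside (path_image \<gamma>)" if "\<gamma> \<in> \<Gamma>" for \<gamma>
        using r w jordan_frontierD(4,5,9) that
        by (intro inside_iff_on_connected_set[of \<gamma> "ball p r"]) auto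
      moreover have "w \<in> E \<longleftrightarrow> p \<in> E"
        using same_side_if_same_inside[of w p] * r w False by blast
      ultimately show ?thesis unfolding u_def by (simp cong: sum.cong)
    qed
    then show ?thesis using r(1) by blast
  next
    case True
    then obtain \<gamma> where \<gamma>: "\<gamma> \<in> \<Gamma>" "p \<in> path_image \<gamma>" unfolding jordan_frontierD(9) by blast
    obtain r where r: "r > 0" "\<And>w \<delta>. w \<in> ball p r \<Longrightarrow> \<delta> \<in> \<Gamma> - {\<gamma>} \<Longrightarrow> w \<notin> path_image \<delta> \<and>
      (w \<in> inside (path_image \<delta>) \<longleftrightarrow> path_image \<gamma> \<subseteq> inside (path_image \<delta>))"
      using near_boundary_curve[OF \<gamma>] by blast
    note J = Jordan_inside_outside[OF jordan_frontierD(4,5)[OF \<gamma>(1)]]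
    let ?i = "path_image \<gamma> \<inter> closure (E \<inter> inside (path_image \<gamma>)) \<noteq> {}"
    let ?o = "path_image \<gamma> \<inter> closure (E \<inter> outside (path_image \<gamma>)) \<noteq> {}"
    let ?m = "\<Sum>\<delta>\<in>\<Gamma> - {\<gamma>}. boundary_sign E \<delta> * of_bool (path_image \<gamma> \<subseteq> inside (path_image \<delta>))"
    have sgn: "boundary_sign E \<gamma> = of_bool ?i - of_bool ?o"
      by (simp only: boundary_sign_def of_bool_def)
    have "u w = of_bool ?o - ?m" if w: "w \<in> ball p r - ?X" for w
    proof -
      have "(\<Sum>\<delta>\<in>\<Gamma>. boundary_sign E \<delta> * of_bool (w \<in> inside (path_image \<delta>))) =
          boundary_sign E \<gamma> * of_bool (w \<in> inside (path_image \<gamma>)) +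
          (\<Sum>\<delta>\<in>\<Gamma> - {\<gamma>}. boundary_sign E \<delta> * of_bool (w \<in> inside (path_image \<delta>)))"
        using jordan_frontierD(3) \<gamma>(1) by (rule sum.remove)
      also have "(\<Sum>\<delta>\<in>\<Gamma> - {\<gamma>}. boundary_sign E \<delta> * of_bool (w \<in> inside (path_image \<delta>))) = ?m"
        using r(2) w by (intro sum.cong) auto
      finally have u: "u w = of_bool (w \<in> E) -
          (boundary_sign E \<gamma> * of_bool (w \<in> inside (path_image \<gamma>)) + ?m)"
        unfolding u_def by simp
      have "w \<notin> path_image \<gamma>" using w \<gamma>(1) unfolding jordan_frontierD(9) by blast
      then consider "w \<in> inside (path_image \<gamma>)"
        | "w \<in> outside (path_image \<gamma>)" "w \<notin> inside (path_image \<gamma>)"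
        using J by blast
      then show ?thesis
      proof cases
        case 1
        then have "w \<in> E \<longleftrightarrow> ?i" using near_boundary_mem_iff[OF \<gamma> r, of "inside (path_image \<gamma>)" w] w by blast
        then show ?thesis using u sgn 1 by simp
      next
        case 2
        then have "w \<in> E \<longleftrightarrow> ?o" using near_boundary_mem_iff[OF \<gamma> r, of "outside (path_image \<gamma>)" w] w by blast
        then show ?thesis using u 2 by simp
      qed
    qed
    then show ?thesis using r(1) by blast
  qed
  then obtain r c where rc: "\<And>p. r p > 0" "\<And>p w. w \<in> ball p (r p) - ?X \<Longrightarrow> u w = c p"
    by metis
  have dense: "\<exists>w. w \<in> A - ?X" if "open A" "A \<noteq> {}" for A
  proof -
    have "A \<inter> closure E = {} \<or> A \<inter> E \<noteq> {}"
      using open_Int_closure_eq_empty[OF \<open>open A\<close>] by blast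
    then show ?thesis
      using that(2) jordan_frontierD(1) by (auto simp: frontier_def interior_open)
  qed
  have const: "c a = c b" for a b
  proof (rule connected_local_const[of UNIV a b c])
    show "\<forall>a\<in>UNIV. \<forall>\<^sub>F b in at a within UNIV. c a = c b"
    proof
      fix a
      have "c a = c b" if b: "b \<in> ball a (r a)" for b
      proof -
        have "b \<in> ball a (r a) \<inter> ball b (r b)" using b rc(1) by simp
        then obtain w where "w \<in> ball a (r a) \<inter> ball b (r b) - ?X"
          using dense[of "ball a (r a) \<inter> ball b (r b)"] by blast
        then show ?thesis using rc(2)[of w a] rc(2)[of w b] by simp
      qed
      then show "\<forall>\<^sub>F b in at a within UNIV. c a = c b"
        using rc(1)[of a] unfolding eventually_at_topological
        by (intro exI[of _ "ball a (r a)"]) simp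
    qed
  qed (rule connected_UNIV UNIV_I)+
  let ?Y = "closure E \<union> (\<Union>\<gamma>\<in>\<Gamma>. inside (path_image \<gamma>))"
  have "bounded (inside (path_image \<gamma>))" if "\<gamma> \<in> \<Gamma>" for \<gamma>
    using Jordan_inside_outside[OF jordan_frontierD(4,5)[OF that]] by blast
  then have "bounded ?Y"
    using jordan_frontierD(2,3) by (intro bounded_Un[THEN iffD2] conjI bounded_closure bounded_UN ballI)
  then have "?Y \<noteq> UNIV" using not_bounded_UNIV by metis
  then obtain z0 where z0: "z0 \<notin> ?Y" by blast
  then have "u z0 = 0" using closure_subset[of E] by (auto simp: u_def)
  moreover have "z0 \<notin> ?X" using z0 by (simp add: frontier_def)
  ultimately have "c z0 = 0" using rc(2)[of z0 z0] rc(1)[of z0] by auto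
  then have "u z = 0" using rc(2)[of z z] rc(1)[of z] assms const[of z z0] by simp
  then show ?thesis unfolding u_def by linarith
qed

proposition boundary_sign_winding_sum:
  assumes "z \<notin> frontier E"
  shows "(\<Sum>\<gamma>\<in>\<Gamma>. of_real (boundary_sign E \<gamma>) * winding_number \<gamma> z) = of_bool (z \<in> E)"
proof -
  have "winding_number \<gamma> z = of_real (of_bool (z \<in> inside (path_image \<gamma>)))" if \<gamma>: "\<gamma> \<in> \<Gamma>" for \<gamma>
  proof (cases "z \<in> inside (path_image \<gamma>)")
    case True
    then have "winding_number \<gamma> z = 1"
      using jordan_frontierD(7)[OF \<gamma>] unfolding counterclockwise_def by blast
    then show ?thesis using True by (simp only: of_bool_eq of_real_1)
  next
    case False
    have "z \<notin> path_image \<gamma>" using assms \<gamma> by (simp add: jordan_frontierD(9))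
    then have "z \<in> inside (path_image \<gamma>) \<union> outside (path_image \<gamma>)"
      by (simp only: inside_Un_outside Compl_iff not_False_eq_True)
    then have out: "z \<in> outside (path_image \<gamma>)" using False by blast
    have "winding_number \<gamma> z = 0"
      using winding_number_zero_in_outside[OF simple_path_imp_path[OF jordan_frontierD(4)[OF \<gamma>]] jordan_frontierD(5)[OF \<gamma>] out] .
    then show ?thesis using False by (simp only: of_bool_eq of_real_0)
  qed
  then have "(\<Sum>\<gamma>\<in>\<Gamma>. of_real (boundary_sign E \<gamma>) * winding_number \<gamma> z) =
      complex_of_real (\<Sum>\<gamma>\<in>\<Gamma>. boundary_sign E \<gamma> * of_bool (z \<in> inside (path_image \<gamma>)))"
    unfolding of_real_sum of_real_mult by (intro sum.cong refl) (simp only:)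
  then show ?thesis by (simp add: boundary_sign_inside_sum[OF assms])
qed

end

section \<open>The Cauchy formula for a Jordan boundary\<close>

lemma boundary_sign_cases: "boundary_sign E \<gamma> \<in> {-1, 0, 1}"
  by (simp add: boundary_sign_def)

lemma closure_Int_component:
  fixes E W C :: "complex set"
  assumes "open C" "closure C \<inter> W \<subseteq> C" "closure E \<subseteq> W"
  shows "closure (E \<inter> C) = closure E \<inter> C"
proof
  have "closure (E \<inter> C) \<subseteq> closure E \<inter> closure C"
    by (simp add: closure_mono)
  then show "closure (E \<inter> C) \<subseteq> closure E \<inter> C" using assms(2,3) by blast
  show "closure E \<inter> C \<subseteq> closure (E \<inter> C)"
    using open_Int_closure_subset[OF assms(1), of E] by (simp add: Int_commute)
qed

text \<open>Here \<open>C\<close> is meant to be a component of \<open>W\<close>; such a set is relatively closed in \<open>W\<close>.\<close>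

lemma jordan_frontier_component:
  assumes jf: "jordan_frontier E \<Gamma>" and C: "open C" "closure C \<inter> W \<subseteq> C"
    and "closure E \<subseteq> W"
    and split: "\<And>\<gamma>. \<gamma> \<in> \<Gamma> \<Longrightarrow> path_image \<gamma> \<subseteq> C \<or> path_image \<gamma> \<inter> C = {}"
  shows "jordan_frontier (E \<inter> C) {\<gamma>\<in>\<Gamma>. path_image \<gamma> \<subseteq> C}"
    and "\<And>\<gamma>. path_image \<gamma> \<subseteq> C \<Longrightarrow> boundary_sign (E \<inter> C) \<gamma> = boundary_sign E \<gamma>"
proof -
  note J = jordan_frontierD[OF jf]
  have "frontier (E \<inter> C) = closure E \<inter> C - E \<inter> C"
    unfolding frontier_def using closure_Int_component[OF C assms(4)] J(1) C(1)
    by (simp add: interior_open open_Int)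
  also have "\<dots> = frontier E \<inter> C"
    unfolding frontier_def using J(1) by (auto simp: interior_open)
  also have "\<dots> = (\<Union>\<gamma>\<in>{\<gamma>\<in>\<Gamma>. path_image \<gamma> \<subseteq> C}. path_image \<gamma>)"
    unfolding J(9) using split by blast
  finally have fr: "frontier (E \<inter> C) = (\<Union>\<gamma>\<in>{\<gamma>\<in>\<Gamma>. path_image \<gamma> \<subseteq> C}. path_image \<gamma>)" .
  show "jordan_frontier (E \<inter> C) {\<gamma>\<in>\<Gamma>. path_image \<gamma> \<subseteq> C}"
    unfolding jordan_frontier_def
  proof (intro conjI fr)
    show "pairwise (\<lambda>\<gamma> \<delta>. disjnt (path_image \<gamma>) (path_image \<delta>)) {\<gamma>\<in>\<Gamma>. path_image \<gamma> \<subseteq> C}"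
      using J(8) by (rule pairwise_subset) blast
  qed (use J C in \<open>auto intro: bounded_subset\<close>)
  show "boundary_sign (E \<inter> C) \<gamma> = boundary_sign E \<gamma>" if \<gamma>: "path_image \<gamma> \<subseteq> C" for \<gamma>
  proof -
    have "path_image \<gamma> \<inter> closure (E \<inter> C \<inter> A) = path_image \<gamma> \<inter> closure (E \<inter> A)" for A
    proof -
      have "closure (E \<inter> A) \<subseteq> W" using assms(4) closure_mono[of "E \<inter> A" E] by blast
      then have "closure (E \<inter> A \<inter> C) = closure (E \<inter> A) \<inter> C"
        by (rule closure_Int_component[OF C])
      then show ?thesis using \<gamma> by (auto simp: Int_assoc Int_commute Int_left_commute)
    qed
    then show ?thesis by (simp only: boundary_sign_def)
  qed
qed

lemma closure_connected_component_Int: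
  fixes W :: "complex set"
  assumes "open W"
  shows "closure (connected_component_set W x) \<inter> W \<subseteq> connected_component_set W x"
proof
  fix y assume y: "y \<in> closure (connected_component_set W x) \<inter> W"
  let ?D = "connected_component_set W y"
  have "open ?D" "y \<in> ?D" using y assms open_connected_component by auto
  then have "?D \<inter> connected_component_set W x \<noteq> {}"
    using y open_Int_closure_eq_empty[of ?D] by blast
  then have "?D = connected_component_set W x" by (simp only: connected_component_overlap)
  then show "y \<in> connected_component_set W x" using \<open>y \<in> ?D\<close> by blast
qed

proposition Cauchy_formula_jordan_frontier:
  assumes jf: "jordan_frontier E \<Gamma>" and W: "open W" "closure E \<subseteq> W"
    and F: "F holomorphic_on W" and \<zeta>: "\<zeta> \<in> E"
  obtains v where "\<And>\<gamma>. \<gamma> \<in> \<Gamma> \<Longrightarrow> has_line_integral (\<lambda>z. F z / (z - \<zeta>)) (v \<gamma>) \<gamma>"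
    "(\<Sum>\<gamma>\<in>\<Gamma>. of_real (boundary_sign E \<gamma>) * v \<gamma>) = 2 * pi * \<i> * F \<zeta>"
proof -
  note J = jordan_frontierD[OF jf]
  let ?s = "\<lambda>\<gamma>. complex_of_real (boundary_sign E \<gamma>)"
  define C where "C \<gamma> = connected_component_set W (pathstart \<gamma>)" for \<gamma>
  have imW: "path_image \<gamma> \<subseteq> W" if "\<gamma> \<in> \<Gamma>" for \<gamma>
    using that J(9) W(2) unfolding frontier_def by blast
  have imC: "path_image \<gamma> \<subseteq> C \<gamma>" if "\<gamma> \<in> \<Gamma>" for \<gamma>
    unfolding C_def
    by (intro connected_component_maximal connected_simple_path_image J(4) imW that
      pathstart_in_path_image)
  have opC: "open (C \<gamma>)" for \<gamma> unfolding C_def using W(1) by (rule open_connected_component)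
  have CW: "C \<gamma> \<subseteq> W" for \<gamma> unfolding C_def by (rule connected_component_subset)
  have \<zeta>fr: "\<zeta> \<notin> frontier E" using \<zeta> J(1) by (simp add: frontier_def interior_open)
  have "\<forall>\<gamma>\<in>\<Gamma>. \<exists>p. valid_path p \<and> pathfinish p = pathstart p \<and> path_image p \<subseteq> C \<gamma> - {\<zeta>} \<and>
      (\<forall>w. w \<notin> C \<gamma> - {\<zeta>} \<longrightarrow> winding_number p w = winding_number \<gamma> w) \<and>
      (\<forall>h. h holomorphic_on C \<gamma> - {\<zeta>} \<longrightarrow> has_line_integral h (contour_integral p h) \<gamma>)"
  proof
    fix \<gamma> assume \<gamma>: "\<gamma> \<in> \<Gamma>"
    have "path_image \<gamma> \<subseteq> C \<gamma> - {\<zeta>}" using imC[OF \<gamma>] \<gamma> \<zeta>fr J(9) by blast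
    moreover have "open (C \<gamma> - {\<zeta>})" using opC by (rule open_delete)
    ultimately obtain p where "valid_path p" "pathfinish p = pathstart p" "path_image p \<subseteq> C \<gamma> - {\<zeta>}"
      "\<And>w. w \<notin> C \<gamma> - {\<zeta>} \<Longrightarrow> winding_number p w = winding_number \<gamma> w"
      "\<And>h. h holomorphic_on C \<gamma> - {\<zeta>} \<Longrightarrow> has_line_integral h (contour_integral p h) \<gamma>"
      using rectifiable_loop_approximation[OF J(6)[OF \<gamma>] J(5)[OF \<gamma>], of "C \<gamma> - {\<zeta>}"] by metis
    then show "\<exists>p. valid_path p \<and> pathfinish p = pathstart p \<and> path_image p \<subseteq> C \<gamma> - {\<zeta>} \<and>
      (\<forall>w. w \<notin> C \<gamma> - {\<zeta>} \<longrightarrow> winding_number p w = winding_number \<gamma> w) \<and>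
      (\<forall>h. h holomorphic_on C \<gamma> - {\<zeta>} \<longrightarrow> has_line_integral h (contour_integral p h) \<gamma>)"
      by (intro exI[of _ p] conjI allI impI)
  qed
  from bchoice[OF this] obtain p where "\<forall>\<gamma>\<in>\<Gamma>. valid_path (p \<gamma>) \<and> pathfinish (p \<gamma>) = pathstart (p \<gamma>) \<and>
      path_image (p \<gamma>) \<subseteq> C \<gamma> - {\<zeta>} \<and>
      (\<forall>w. w \<notin> C \<gamma> - {\<zeta>} \<longrightarrow> winding_number (p \<gamma>) w = winding_number \<gamma> w) \<and>
      (\<forall>h. h holomorphic_on C \<gamma> - {\<zeta>} \<longrightarrow> has_line_integral h (contour_integral (p \<gamma>) h) \<gamma>)"
    by (elim exE)
  note p_all = bspec[OF this]
  note p = p_all[THEN conjunct1] p_all[THEN conjunct2, THEN conjunct1]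
    p_all[THEN conjunct2, THEN conjunct2, THEN conjunct1]
    p_all[THEN conjunct2, THEN conjunct2, THEN conjunct2, THEN conjunct1, THEN spec, THEN mp]
    p_all[THEN conjunct2, THEN conjunct2, THEN conjunct2, THEN conjunct2, THEN spec, THEN mp]
  \<comment> \<open>\<open>F z / (z - \<zeta>)\<close> is the holomorphic function \<open>g\<close> plus a multiple of \<open>1 / (z - \<zeta>)\<close>\<close>
  define g where "g z = (if z = \<zeta> then deriv F \<zeta> else (F z - F \<zeta>) / (z - \<zeta>))" for z
  have g: "g holomorphic_on W" unfolding g_def using F W(1) by (rule pole_lemma_open)
  \<comment> \<open>Cauchy's theorem for the part of the boundary lying in one component \<open>K\<close> of \<open>W\<close>: the
    boundary curves in \<open>K\<close> bound \<open>E \<inter> K\<close>, so their signed winding numbers cancel outside \<open>K\<close>\<close>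
  have zero: "(\<Sum>\<gamma>\<in>{\<gamma>\<in>\<Gamma>. C \<gamma> = K}. ?s \<gamma> * contour_integral (p \<gamma>) g) = 0" if K: "K \<in> C ` \<Gamma>" for K
  proof -
    obtain \<gamma>0 where \<gamma>0: "\<gamma>0 \<in> \<Gamma>" "K = C \<gamma>0" using K by blast
    have K1: "open K" "connected K" "K \<subseteq> W" "closure K \<inter> W \<subseteq> K"
      using \<gamma>0 opC CW closure_connected_component_Int[OF W(1)] by (auto simp: C_def)
    have "K \<noteq> {}" using imC[OF \<gamma>0(1)] \<gamma>0(2) path_image_nonempty by blast
    have split: "path_image \<gamma> \<subseteq> K \<or> path_image \<gamma> \<inter> K = {}" if "\<gamma> \<in> \<Gamma>" for \<gamma>
    proof (cases "C \<gamma> \<inter> K = {}")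
      case True
      then show ?thesis using imC[OF that] by blast
    next
      case False
      then have "C \<gamma> = K" unfolding \<gamma>0(2) C_def by (simp only: connected_component_overlap)
      then show ?thesis using imC[OF that] by simp
    qed
    have ix: "{\<gamma>\<in>\<Gamma>. C \<gamma> = K} = {\<gamma>\<in>\<Gamma>. path_image \<gamma> \<subseteq> K}"
    proof (intro Collect_cong conj_cong refl iffI)
      fix \<gamma> assume \<gamma>: "\<gamma> \<in> \<Gamma>"
      show "path_image \<gamma> \<subseteq> K" if "C \<gamma> = K" using imC[OF \<gamma>] that by simp
      show "C \<gamma> = K" if "path_image \<gamma> \<subseteq> K"
        using that pathstart_in_path_image[of \<gamma>] connected_component_eq[of "pathstart \<gamma>" W "pathstart \<gamma>0"]
        unfolding \<gamma>0(2) C_def by blast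
    qed
    note comp = jordan_frontier_component[OF jf K1(1,4) W(2) split]
    let ?A = "{\<gamma>\<in>\<Gamma>. C \<gamma> = K}"
    obtain L where L: "valid_path L" "pathfinish L = pathstart L" "path_image L \<subseteq> K"
      "\<And>h. h holomorphic_on K \<Longrightarrow> contour_integral L h = (\<Sum>\<gamma>\<in>?A. ?s \<gamma> * contour_integral (p \<gamma>) h)"
    proof -
      have "\<exists>L. valid_path L \<and> pathfinish L = pathstart L \<and> path_image L \<subseteq> K \<and>
        (\<forall>g. g holomorphic_on K \<longrightarrow> contour_integral L g = (\<Sum>\<gamma>\<in>?A. ?s \<gamma> * contour_integral (p \<gamma>) g))"
      proof (rule join_loops[OF K1(1,2) \<open>K \<noteq> {}\<close>])
        show "valid_path (p \<gamma>) \<and> pathfinish (p \<gamma>) = pathstart (p \<gamma>) \<and> path_image (p \<gamma>) \<subseteq> K"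
          if "\<gamma> \<in> ?A" for \<gamma>
          using that p(1-3)[of \<gamma>] by blast
      qed (use J(3) boundary_sign_cases in auto)
      then show ?thesis using that by blast
    qed
    have wL: "winding_number L w = 0" if w: "w \<notin> K" for w
    proof -
      have wfr: "w \<notin> frontier (E \<inter> K)"
        using w closure_Int_component[OF K1(1,4) W(2)] by (auto simp: frontier_def)
      have "2 * pi * \<i> * winding_number L w = contour_integral L (\<lambda>z. 1 / (z - w))"
      proof -
        have "w \<notin> path_image L" using L(3) w by blast
        from winding_number_valid_path[OF L(1) this] show ?thesis by simp
      qed
      also have "\<dots> = (\<Sum>\<gamma>\<in>?A. ?s \<gamma> * contour_integral (p \<gamma>) (\<lambda>z. 1 / (z - w)))"
        using w by (intro L(4) holomorphic_intros) auto
      also have "\<dots> = (\<Sum>\<gamma>\<in>?A. 2 * pi * \<i> * (?s \<gamma> * winding_number \<gamma> w))"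
      proof (intro sum.cong refl)
        fix \<gamma> assume \<gamma>: "\<gamma> \<in> ?A"
        then have "w \<notin> path_image (p \<gamma>)" using p(3)[of \<gamma>] w by auto
        then have "contour_integral (p \<gamma>) (\<lambda>z. 1 / (z - w)) = 2 * pi * \<i> * winding_number (p \<gamma>) w"
          using winding_number_valid_path[OF p(1), of \<gamma> w] \<gamma> by auto
        moreover have "winding_number (p \<gamma>) w = winding_number \<gamma> w"
          using \<gamma> w by (intro p(4)) auto
        ultimately show "?s \<gamma> * contour_integral (p \<gamma>) (\<lambda>z. 1 / (z - w)) =
            2 * pi * \<i> * (?s \<gamma> * winding_number \<gamma> w)"
          by simp
      qed
      also have "\<dots> = 2 * pi * \<i> * (\<Sum>\<gamma>\<in>{\<gamma>\<in>\<Gamma>. path_image \<gamma> \<subseteq> K}.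
          of_real (boundary_sign (E \<inter> K) \<gamma>) * winding_number \<gamma> w)"
        unfolding sum_distrib_left ix by (intro sum.cong refl) (simp add: comp(2))
      also have "\<dots> = 0"
        using boundary_sign_winding_sum[OF comp(1) wfr] w by simp
      finally show ?thesis by simp
    qed
    have gK: "g holomorphic_on K" using g K1(3) holomorphic_on_subset by blast
    have "(g has_contour_integral 0) L"
      using Cauchy_theorem_global[OF K1(1) gK L(1-3) wL] .
    then have "contour_integral L g = 0" by (rule contour_integral_unique)
    then show ?thesis by (simp only: L(4)[OF gK])
  qed
  have "(\<Sum>\<gamma>\<in>\<Gamma>. ?s \<gamma> * contour_integral (p \<gamma>) g) =
      (\<Sum>K\<in>C ` \<Gamma>. \<Sum>\<gamma>\<in>{\<gamma>\<in>\<Gamma>. C \<gamma> = K}. ?s \<gamma> * contour_integral (p \<gamma>) g)"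
    using J(3) by (rule sum.image_gen)
  then have g0: "(\<Sum>\<gamma>\<in>\<Gamma>. ?s \<gamma> * contour_integral (p \<gamma>) g) = 0" using zero by simp
  have dec: "contour_integral (p \<gamma>) (\<lambda>z. F z / (z - \<zeta>)) =
      contour_integral (p \<gamma>) g + 2 * pi * \<i> * F \<zeta> * winding_number \<gamma> \<zeta>" if \<gamma>: "\<gamma> \<in> \<Gamma>" for \<gamma>
  proof (rule contour_integral_unique)
    have "path_image (p \<gamma>) \<subseteq> W" "\<zeta> \<notin> path_image (p \<gamma>)" using p(3)[OF \<gamma>] CW by blast+
    have 1: "(g has_contour_integral contour_integral (p \<gamma>) g) (p \<gamma>)"
      by (intro has_contour_integral_integral contour_integrable_holomorphic_simple[OF g W(1) p(1)[OF \<gamma>]])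
         fact
    have 2: "((\<lambda>z. 1 / (z - \<zeta>)) has_contour_integral (2 * pi * \<i> * winding_number \<gamma> \<zeta>)) (p \<gamma>)"
      using has_contour_integral_winding_number[OF p(1)[OF \<gamma>] \<open>\<zeta> \<notin> path_image (p \<gamma>)\<close>] p(4)[OF \<gamma>, of \<zeta>]
      by simp
    have "((\<lambda>z. g z + F \<zeta> * (1 / (z - \<zeta>))) has_contour_integral
        (contour_integral (p \<gamma>) g + F \<zeta> * (2 * pi * \<i> * winding_number \<gamma> \<zeta>))) (p \<gamma>)"
      by (intro has_contour_integral_add has_contour_integral_lmul 1 2)
    then have "((\<lambda>z. F z / (z - \<zeta>)) has_contour_integral
        (contour_integral (p \<gamma>) g + F \<zeta> * (2 * pi * \<i> * winding_number \<gamma> \<zeta>))) (p \<gamma>)"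
    proof (rule has_contour_integral_eq)
      fix z assume "z \<in> path_image (p \<gamma>)"
      then have "z \<noteq> \<zeta>" using \<open>\<zeta> \<notin> path_image (p \<gamma>)\<close> by blast
      then show "g z + F \<zeta> * (1 / (z - \<zeta>)) = F z / (z - \<zeta>)"
        by (simp add: g_def diff_divide_distrib)
    qed
    then show "((\<lambda>z. F z / (z - \<zeta>)) has_contour_integral
        (contour_integral (p \<gamma>) g + 2 * pi * \<i> * F \<zeta> * winding_number \<gamma> \<zeta>)) (p \<gamma>)"
      by (simp add: mult_ac)
  qed
  show ?thesis
  proof (rule that[of "\<lambda>\<gamma>. contour_integral (p \<gamma>) (\<lambda>z. F z / (z - \<zeta>))"])
    fix \<gamma> assume \<gamma>: "\<gamma> \<in> \<Gamma>"
    show "has_line_integral (\<lambda>z. F z / (z - \<zeta>)) (contour_integral (p \<gamma>) (\<lambda>z. F z / (z - \<zeta>))) \<gamma>"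
      using F CW[of \<gamma>] by (intro p(5)[OF \<gamma>] holomorphic_intros) (auto intro: holomorphic_on_subset)
  next
    have "(\<Sum>\<gamma>\<in>\<Gamma>. ?s \<gamma> * contour_integral (p \<gamma>) (\<lambda>z. F z / (z - \<zeta>))) =
        (\<Sum>\<gamma>\<in>\<Gamma>. ?s \<gamma> * contour_integral (p \<gamma>) g + 2 * pi * \<i> * F \<zeta> * (?s \<gamma> * winding_number \<gamma> \<zeta>))"
      by (intro sum.cong refl) (simp add: dec algebra_simps)
    also have "\<dots> = 2 * pi * \<i> * F \<zeta> * (\<Sum>\<gamma>\<in>\<Gamma>. ?s \<gamma> * winding_number \<gamma> \<zeta>)"
      by (simp add: sum.distrib g0 sum_distrib_left)
    also have "\<dots> = 2 * pi * \<i> * F \<zeta>"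
      using boundary_sign_winding_sum[OF jf \<zeta>fr] \<zeta> by simp
    finally show "(\<Sum>\<gamma>\<in>\<Gamma>. ?s \<gamma> * contour_integral (p \<gamma>) (\<lambda>z. F z / (z - \<zeta>))) = 2 * pi * \<i> * F \<zeta>" .
  qed
qed

section \<open>Quaternions split along a slice\<close>

lemma slice_emb_scaleR: "slice_emb I z = Re z *\<^sub>R 1 + Im z *\<^sub>R I"
  by (simp add: slice_emb_def scaleR_conv_of_real)

lemma imag_units_iff: "J \<in> imag_units \<longleftrightarrow> qre J = 0 \<and> (qi J)\<^sup>2 + (qj J)\<^sup>2 + (qk J)\<^sup>2 = 1"
proof
  assume "J \<in> imag_units"
  then have eq: "J * J = -1" by (simp add: imag_units_def power2_eq_square)
  then have c: "qre J * qre J - qi J * qi J - qj J * qj J - qk J * qk J = -1"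
    "qre J * qi J = 0" "qre J * qj J = 0" "qre J * qk J = 0"
    using eq by (auto simp: quat_eq_iff)
  have "qre J = 0"
  proof (rule ccontr)
    assume "qre J \<noteq> 0"
    then have "qre J * qre J = -1" using c by simp
    then show False by (smt (verit) zero_le_square)
  qed
  then show "qre J = 0 \<and> (qi J)\<^sup>2 + (qj J)\<^sup>2 + (qk J)\<^sup>2 = 1"
    using c by (simp add: power2_eq_square)
next
  assume "qre J = 0 \<and> (qi J)\<^sup>2 + (qj J)\<^sup>2 + (qk J)\<^sup>2 = 1"
  then show "J \<in> imag_units"
    by (simp add: imag_units_def power2_eq_square quat_eq_iff)
qed

lemma imag_units_square: "J \<in> imag_units \<Longrightarrow> J * J = - 1"
  by (simp add: imag_units_def power2_eq_square)

lemma imag_units_norm: "J \<in> imag_units \<Longrightarrow> norm J = 1"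
  by (simp add: imag_units_iff norm_quat_def)

lemma imag_units_uminus: "J \<in> imag_units \<Longrightarrow> - J \<in> imag_units"
  by (simp add: imag_units_iff)

lemma slice_emb_simps:
  "slice_emb I 0 = 0" "slice_emb I 1 = 1" "slice_emb I (of_real r) = of_real r"
  "slice_emb I (z + w) = slice_emb I z + slice_emb I w"
  "slice_emb I (z - w) = slice_emb I z - slice_emb I w"
  "slice_emb I (- z) = - slice_emb I z"
  "slice_emb I (r *\<^sub>R z) = r *\<^sub>R slice_emb I z"
  by (simp_all add: slice_emb_def algebra_simps scaleR_conv_of_real)

lemma slice_emb_mult:
  assumes "I \<in> imag_units"
  shows "slice_emb I (z * w) = slice_emb I z * slice_emb I w"
  using imag_units_square[OF assms]
  by (simp add: slice_emb_scaleR algebra_simps)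

lemma slice_emb_cnj: "slice_emb I (cnj z) = slice_emb (- I) z"
  by (simp add: slice_emb_def)

lemma qre_slice_emb: "I \<in> imag_units \<Longrightarrow> qre (slice_emb I z) = Re z"
  by (simp add: slice_emb_scaleR imag_units_iff)

lemma qcnj_slice_emb: "I \<in> imag_units \<Longrightarrow> qcnj (slice_emb I z) = slice_emb I (cnj z)"
  by (simp add: slice_emb_scaleR imag_units_iff quat_eq_iff)

lemma norm_slice_emb:
  assumes "I \<in> imag_units"
  shows "norm (slice_emb I z) = norm z"
proof -
  have "(Im z * qi I)\<^sup>2 + (Im z * qj I)\<^sup>2 + (Im z * qk I)\<^sup>2 = (Im z)\<^sup>2"
    using assms unfolding imag_units_iff by (simp add: power_mult_distrib flip: distrib_left)
  then show ?thesis
    using assms by (simp add: slice_emb_scaleR norm_quat_def cmod_def imag_units_iff add.assoc)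
qed

lemma slice_emb_eq_iff:
  assumes "I \<in> imag_units"
  shows "slice_emb I z = slice_emb I w \<longleftrightarrow> z = w"
  using norm_slice_emb[OF assms, of "z - w"] by (metis eq_iff_diff_eq_0 norm_eq_zero slice_emb_simps(5))

lemma slice_emb_inverse:
  assumes "I \<in> imag_units"
  shows "slice_emb I (inverse z) = inverse (slice_emb I z)"
proof (cases "z = 0")
  case False
  then have "slice_emb I z * slice_emb I (inverse z) = 1"
    by (simp add: slice_emb_simps flip: slice_emb_mult[OF assms])
  then show ?thesis by (metis inverse_unique)
qed (simp add: slice_emb_simps)

lemma bounded_linear_slice_emb: "bounded_linear (slice_emb I)"
  unfolding slice_emb_scaleR[abs_def]
  by (intro bounded_linear_add bounded_linear_scaleR_const bounded_linear_Re bounded_linear_Im)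

lemma exists_orthogonal_imag_unit:
  assumes "I \<in> imag_units"
  obtains J where "J \<in> imag_units" "orthogonal I J"
proof (cases "qi I = 0 \<and> qj I = 0")
  case True
  then have "Quat 0 1 0 0 \<in> imag_units" "orthogonal I (Quat 0 1 0 0)"
    using assms by (auto simp: imag_units_iff orthogonal_def inner_quat_def)
  then show ?thesis by (rule that)
next
  case False
  define n where "n = sqrt ((qi I)\<^sup>2 + (qj I)\<^sup>2)"
  have n2: "n\<^sup>2 = (qi I)\<^sup>2 + (qj I)\<^sup>2" by (simp add: n_def)
  have "n\<^sup>2 \<noteq> 0" unfolding n2 using False by (simp add: sum_power2_eq_zero_iff)
  then have "Quat 0 (- qj I / n) (qi I / n) 0 \<in> imag_units"
    by (simp add: imag_units_iff power_divide n2 add.commute flip: add_divide_distrib)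
  moreover have "orthogonal I (Quat 0 (- qj I / n) (qi I / n) 0)"
    by (simp add: orthogonal_def inner_quat_def)
  ultimately show ?thesis by (rule that)
qed

lemma orthogonal_anticommute:
  assumes "I \<in> imag_units" "J \<in> imag_units" "orthogonal I J"
  shows "J * I = - (I * J)"
  using assms by (simp add: imag_units_iff orthogonal_def inner_quat_def quat_eq_iff algebra_simps)

lemma slice_emb_orthogonal:
  assumes "I \<in> imag_units" "J \<in> imag_units" "orthogonal I J"
  shows "slice_emb I z * J = J * slice_emb I (cnj z)"
  using orthogonal_anticommute[OF assms] by (simp add: slice_emb_scaleR algebra_simps)

text \<open>The coordinates of a quaternion with respect to the splitting of the quaternions as
  \<open>L\<^sub>I + L\<^sub>I J\<close>, where \<open>I\<close> and \<open>J\<close> are orthogonal imaginary units.\<close>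

definition coord1 :: "quat \<Rightarrow> quat \<Rightarrow> complex" where
  "coord1 I q = Complex (qre q) (inner I q)"

definition coord2 :: "quat \<Rightarrow> quat \<Rightarrow> quat \<Rightarrow> complex" where
  "coord2 I J q = coord1 I (- (q * J))"

text \<open>The vector part of a quaternion commuting with \<open>I\<close> is parallel to \<open>I\<close>.\<close>

lemma commuting_in_slice:
  assumes I: "I \<in> imag_units" and "A * I = I * A"
  shows "slice_emb I (coord1 I A) = A"
proof -
  have c: "qj A * qk I = qk A * qj I" "qk A * qi I = qi A * qk I" "qi A * qj I = qj A * qi I"
    using assms(2) by (auto simp: quat_eq_iff mult.commute)
  have n: "qi I * qi I + qj I * qj I + qk I * qk I = 1" "qre I = 0"
    using I by (auto simp: imag_units_iff power2_eq_square)
  let ?t = "qi I * qi A + qj I * qj A + qk I * qk A"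
  have "?t * qi I = qi A" "?t * qj I = qj A" "?t * qk I = qk A"
    using c n by algebra+
  then show ?thesis
    using n(2) by (simp add: coord1_def slice_emb_scaleR quat_eq_iff inner_quat_def)
qed

lemma quat_splitting:
  assumes I: "I \<in> imag_units" and J: "J \<in> imag_units" and IJ: "orthogonal I J"
  shows "slice_emb I (coord1 I q) + slice_emb I (coord2 I J q) * J = q"
    and coord1_unique: "coord1 I (slice_emb I a + slice_emb I b * J) = a"
    and coord2_unique: "coord2 I J (slice_emb I a + slice_emb I b * J) = b"
proof -
  have II: "I * I = -1" and JJ: "J * J = -1" using I J imag_units_square by auto
  have ac: "J * I = - (I * J)" by (rule orthogonal_anticommute[OF I J IJ])
  have c1: "coord1 I (slice_emb I a + slice_emb I b * J) = a" for a b
  proof -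
    have n: "qi I * qi I + qj I * qj I + qk I * qk I = 1" "qre I = 0" "qre J = 0"
      "qi I * qi J + qj I * qj J + qk I * qk J = 0"
      using I J IJ by (auto simp: imag_units_iff power2_eq_square orthogonal_def inner_quat_def)
    show ?thesis
      unfolding coord1_def complex_eq_iff slice_emb_scaleR inner_quat_def
      using n by (simp, algebra)
  qed
  then show "coord1 I (slice_emb I a + slice_emb I b * J) = a" .
  have c2: "coord2 I J (slice_emb I a + slice_emb I b * J) = b" for a b
  proof -
    have "- ((slice_emb I a + slice_emb I b * J) * J) = slice_emb I b + slice_emb I (- a) * J"
      by (simp add: algebra_simps slice_emb_simps JJ)
    then show ?thesis unfolding coord2_def by (simp only: c1)
  qed
  then show "coord2 I J (slice_emb I a + slice_emb I b * J) = b" .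
  \<comment> \<open>\<open>(q - IqI)/2\<close> commutes with \<open>I\<close> and \<open>(q + IqI)/2\<close> anticommutes with it\<close>
  define A B where "A = (1/2) *\<^sub>R (q - I * q * I)" and "B = - ((1/2) *\<^sub>R (q + I * q * I) * J)"
  have IIx: "I * (I * x) = - x" for x by (simp add: II flip: mult.assoc)
  have JJx: "x * J * J = - x" for x by (simp add: JJ mult.assoc)
  have A: "A * I = I * A" unfolding A_def by (simp add: algebra_simps II IIx)
  have "B * I = I * B" unfolding B_def
    by (simp add: algebra_simps II IIx ac) 
  then have "slice_emb I (coord1 I B) = B" by (rule commuting_in_slice[OF I])
  moreover have "slice_emb I (coord1 I A) = A" by (rule commuting_in_slice[OF I A])
  moreover have "A + B * J = q"
  proof -
    have "B * J = (1/2) *\<^sub>R (q + I * q * I)"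
      unfolding B_def by (simp only: minus_mult_left[symmetric] JJx minus_minus)
    then show ?thesis
      by (simp add: A_def scaleR_add_right scaleR_diff_right flip: scaleR_add_left)
  qed
  ultimately have q: "slice_emb I (coord1 I A) + slice_emb I (coord1 I B) * J = q" by simp
  have "coord1 I q = coord1 I A" "coord2 I J q = coord1 I B"
    using c1[of "coord1 I A" "coord1 I B"] c2[of "coord1 I A" "coord1 I B"] unfolding q by simp_all
  then show "slice_emb I (coord1 I q) + slice_emb I (coord2 I J q) * J = q" using q by simp
qed

lemma coord_mult_left:
  assumes "I \<in> imag_units" "J \<in> imag_units" "orthogonal I J"
  shows "coord1 I (slice_emb I z * q) = z * coord1 I q"
    and "coord2 I J (slice_emb I z * q) = z * coord2 I J q"
proof -
  have "slice_emb I z * q =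
      slice_emb I (z * coord1 I q) + slice_emb I (z * coord2 I J q) * J"
    by (subst (1) quat_splitting(1)[OF assms, of q, symmetric])
      (simp add: slice_emb_mult[OF assms(1)] distrib_left mult.assoc)
  then show "coord1 I (slice_emb I z * q) = z * coord1 I q"
    and "coord2 I J (slice_emb I z * q) = z * coord2 I J q"
    by (simp_all only: quat_splitting(2,3)[OF assms])
qed

lemma bounded_linear_coord1: "bounded_linear (coord1 I)"
proof -
  have "coord1 I = (\<lambda>q. of_real (inner 1 q) + \<i> * of_real (inner I q))"
    by (auto simp: coord1_def complex_eq_iff inner_quat_def)
  moreover have "bounded_linear (\<lambda>q. of_real (inner 1 q) + \<i> * of_real (inner I q) :: complex)"
    by (intro bounded_linear_add bounded_linear_const_mult
          bounded_linear_compose[OF bounded_linear_of_real] bounded_linear_inner_right)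
  ultimately show ?thesis by simp
qed

lemma bounded_linear_coord2: "bounded_linear (coord2 I J)"
  unfolding coord2_def[abs_def]
  by (intro bounded_linear_compose[OF bounded_linear_coord1] bounded_linear_minus
        bounded_linear_mult_left)

lemma coord1_slice_emb:
  assumes I: "I \<in> imag_units"
  shows "coord1 I (slice_emb I z) = z"
proof -
  obtain J where J: "J \<in> imag_units" "orthogonal I J"
    using exists_orthogonal_imag_unit[OF I] by blast
  show ?thesis using coord1_unique[OF I J, of z 0] by (simp add: slice_emb_simps)
qed

lemma quat_splitting_left:
  assumes "I \<in> imag_units" "J \<in> imag_units" "orthogonal I J"
  shows "slice_emb I (coord1 I q) + J * slice_emb I (cnj (coord2 I J q)) = q"
  using quat_splitting(1)[OF assms, of q] by (simp add: slice_emb_orthogonal[OF assms])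

section \<open>The Cauchy formula on a slice\<close>

text \<open>For \<open>q = x + yM\<close>, where \<open>M\<close> is an imaginary unit, the factors \<open>(1 - MI)/2\<close> and \<open>(1 + MI)/2\<close>
  express the value at \<open>q\<close> of a slice function by its values at \<open>x + yI\<close> and \<open>x - yI\<close>.  The kernel
  is such a function of \<open>q\<close>, and at points of \<open>L\<^sub>I\<close> it is the ordinary Cauchy kernel.\<close>

definition plus_factor :: "quat \<Rightarrow> quat \<Rightarrow> quat" where
  "plus_factor M I = (1/2) *\<^sub>R (1 - M * I)"

definition minus_factor :: "quat \<Rightarrow> quat \<Rightarrow> quat" where
  "minus_factor M I = (1/2) *\<^sub>R (1 + M * I)"

lemma factor_sum: "plus_factor M I + minus_factor M I = 1"
  by (simp add: plus_factor_def minus_factor_def scaleR_add_right scaleR_diff_right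
      flip: scaleR_add_left)

lemma factor_representation:
  assumes "I \<in> imag_units"
  shows "plus_factor M I * (b + I * c) + minus_factor M I * (b - I * c) = b + M * c"
proof -
  have "M * (I * (I * c)) = - (M * c)"
    by (simp add: imag_units_square[OF assms] flip: mult.assoc[of I I])
  then have "plus_factor M I * (b + I * c) = (1/2) *\<^sub>R (b + I * c - M * I * b + M * c)"
    "minus_factor M I * (b - I * c) = (1/2) *\<^sub>R (b - I * c + M * I * b + M * c)"
    by (simp_all add: plus_factor_def minus_factor_def algebra_simps)
  moreover have "(1/2) *\<^sub>R b + (1/2) *\<^sub>R b = b" "(1/2) *\<^sub>R (M * c) + (1/2) *\<^sub>R (M * c) = M * c"
    by (simp_all flip: scaleR_add_left)
  moreover have "(1/2) *\<^sub>R (b + I * c - M * I * b + M * c) + (1/2) *\<^sub>R (b - I * c + M * I * b + M * c) =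
      ((1/2) *\<^sub>R b + (1/2) *\<^sub>R b) + ((1/2) *\<^sub>R (M * c) + (1/2) *\<^sub>R (M * c))"
    by (simp only: scaleR_add_right scaleR_diff_right) (simp add: algebra_simps)
  ultimately show ?thesis by (simp only:)
qed

lemma mult_factor:
  assumes "M \<in> imag_units" "I \<in> imag_units"
  shows "slice_emb M \<zeta> * plus_factor M I = plus_factor M I * slice_emb I \<zeta>"
    and "slice_emb M \<zeta> * minus_factor M I = minus_factor M I * slice_emb I (cnj \<zeta>)"
proof -
  have MM: "M * (M * x) = - x" for x
    by (simp add: imag_units_square[OF assms(1)] flip: mult.assoc)
  have II: "x * I * I = - x" for x
    by (simp add: mult.assoc imag_units_square[OF assms(2)])
  show "slice_emb M \<zeta> * plus_factor M I = plus_factor M I * slice_emb I \<zeta>"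
    "slice_emb M \<zeta> * minus_factor M I = minus_factor M I * slice_emb I (cnj \<zeta>)"
    using imag_units_square[OF assms(2)]
    by (simp_all add: plus_factor_def minus_factor_def slice_emb_scaleR algebra_simps MM II)
qed

lemma cauchy_kernel_slice:
  assumes M: "M \<in> imag_units" and I: "I \<in> imag_units" and z: "z \<noteq> \<zeta>" "z \<noteq> cnj \<zeta>"
  shows "cauchy_kernel (slice_emb I z) (slice_emb M \<zeta>) =
    plus_factor M I * slice_emb I (1 / (z - \<zeta>)) + minus_factor M I * slice_emb I (1 / (z - cnj \<zeta>))"
proof -
  let ?e = "slice_emb I" and ?p = "plus_factor M I" and ?m = "minus_factor M I"
  define q where "q = slice_emb M \<zeta>"
  define A where "A = of_real ((norm (?e z))\<^sup>2) - 2 * q * of_real (qre (?e z)) + q\<^sup>2"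
  have A: "A = of_real ((norm z)\<^sup>2) - of_real (2 * Re z) * q + q * q"
  proof -
    have "2 * q * of_real (Re z) = of_real (2 * Re z) * q"
      by (simp only: of_real_def mult_2 mult_scaleR_right mult_scaleR_left mult_1_right mult_1_left
          scaleR_add_left scaleR_add_right distrib_right)
    then show ?thesis
      by (simp only: A_def norm_slice_emb[OF I] qre_slice_emb[OF I] power2_eq_square[of q])
  qed
  \<comment> \<open>\<open>A\<close> is a real polynomial in \<open>q\<close>, and \<open>q\<close> acts on the two factors as \<open>\<zeta>\<close> and \<open>cnj \<zeta>\<close> from the right\<close>
  have Ax: "A * x = x * ?e ((w - z) * (w - cnj z))" if "q * x = x * ?e w" for x w
  proof -
    have "A * x = x * ?e (of_real ((norm z)\<^sup>2) - of_real (2 * Re z) * w + w * w)"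
    proof -
      have "q * (q * x) = (q * x) * ?e w" by (subst that) (simp only: mult.assoc)
      then have 1: "q * q * x = x * (?e w * ?e w)" by (simp only: that mult.assoc)
      have 2: "of_real r * x = x * of_real r" for r
        by (simp add: of_real_def)
      have 3: "of_real r * q * x = x * (of_real r * ?e w)" for r
        using that by (simp add: of_real_def)
      show ?thesis
        by (simp only: A slice_emb_simps(3-5) slice_emb_mult[OF I] distrib_left distrib_right
            left_diff_distrib right_diff_distrib 1 2 3)
    qed
    moreover have "of_real ((norm z)\<^sup>2) - of_real (2 * Re z) * w + w * w = (w - z) * (w - cnj z)"
    proof -
      have "complex_of_real ((norm z)\<^sup>2) = z * cnj z" "complex_of_real (2 * Re z) = z + cnj z"
        by (rule complex_norm_square) (simp add: complex_add_cnj)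
      then show ?thesis by (simp only:) (simp add: algebra_simps)
    qed
    ultimately show ?thesis by (simp only:)
  qed
  have Ap: "A * ?p = ?p * ?e ((\<zeta> - z) * (\<zeta> - cnj z))"
    by (rule Ax) (simp only: q_def mult_factor[OF M I])
  have Am: "A * ?m = ?m * ?e ((cnj \<zeta> - z) * (cnj \<zeta> - cnj z))"
    by (rule Ax) (simp only: q_def mult_factor[OF M I])
  have z': "cnj z \<noteq> \<zeta>" using z(2) by auto
  have "A \<noteq> 0"
  proof
    assume "A = 0"
    moreover have "?e ((\<zeta> - z) * (\<zeta> - cnj z)) \<noteq> 0" "?e ((cnj \<zeta> - z) * (cnj \<zeta> - cnj z)) \<noteq> 0"
      using z z' slice_emb_eq_iff[OF I, of _ 0] by (auto simp: slice_emb_simps(1))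
    ultimately have "?p = 0" "?m = 0" using Ap Am by auto
    then show False using factor_sum[of M I] by simp
  qed
  have "A * (?p * ?e (1 / (z - \<zeta>)) + ?m * ?e (1 / (z - cnj \<zeta>))) =
      ?p * ?e ((\<zeta> - z) * (\<zeta> - cnj z) * (1 / (z - \<zeta>))) +
      ?m * ?e ((cnj \<zeta> - z) * (cnj \<zeta> - cnj z) * (1 / (z - cnj \<zeta>)))"
    by (simp only: distrib_left mult.assoc[symmetric] Ap Am slice_emb_mult[OF I])
  also have "(\<zeta> - z) * (\<zeta> - cnj z) * (1 / (z - \<zeta>)) = cnj z - \<zeta>"
    using z by (simp add: divide_simps) (simp add: algebra_simps)
  also have "(cnj \<zeta> - z) * (cnj \<zeta> - cnj z) * (1 / (z - cnj \<zeta>)) = cnj z - cnj \<zeta>"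
    using z by (simp add: divide_simps) (simp add: algebra_simps)
  also have "?p * ?e (cnj z - \<zeta>) + ?m * ?e (cnj z - cnj \<zeta>) =
      (?p + ?m) * ?e (cnj z) - (?p * ?e \<zeta> + ?m * ?e (cnj \<zeta>))"
    by (simp add: slice_emb_simps algebra_simps)
  also have "?p * ?e \<zeta> + ?m * ?e (cnj \<zeta>) = q * (?p + ?m)"
    by (simp add: q_def distrib_left mult_factor[OF M I])
  finally have eq: "A * (?p * ?e (1 / (z - \<zeta>)) + ?m * ?e (1 / (z - cnj \<zeta>))) = qcnj (?e z) - q"
    by (simp add: factor_sum qcnj_slice_emb[OF I])
  have "inverse A * (A * x) = x" for x
    by (simp only: mult.assoc[symmetric] left_inverse[OF \<open>A \<noteq> 0\<close>] mult_1)
  from this[of "?p * ?e (1 / (z - \<zeta>)) + ?m * ?e (1 / (z - cnj \<zeta>))"]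
  have "inverse A * (qcnj (?e z) - q) =
      ?p * ?e (1 / (z - \<zeta>)) + ?m * ?e (1 / (z - cnj \<zeta>))"
    by (simp only: eq)
  then show ?thesis by (simp only: cauchy_kernel_def A_def q_def)
qed

text \<open>The right-hand side is the combination of the values at \<open>\<zeta>\<close> and \<open>cnj \<zeta>\<close> of the function with
  components \<open>F\<close> and \<open>G\<close>; for a slice function it is the value at \<open>x + yM\<close>, where \<open>\<zeta> = x + iy\<close>, by
  \<open>factor_representation\<close>.\<close>

proposition Cauchy_formula_slice:
  assumes M: "M \<in> imag_units" and I: "I \<in> imag_units" and J: "J \<in> imag_units" "orthogonal I J"
    and jf: "jordan_frontier E \<Gamma>" and W: "open W" "closure E \<subseteq> W"
    and F: "F holomorphic_on W" and G: "G holomorphic_on W"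
    and \<zeta>: "\<zeta> \<in> E" "cnj \<zeta> \<in> E"
    and h: "\<And>z. z \<in> frontier E \<Longrightarrow> h (slice_emb I z) = slice_emb I (F z) + slice_emb I (G z) * J"
  obtains w where
    "\<And>\<gamma>. \<gamma> \<in> \<Gamma> \<Longrightarrow> has_slice_integral I \<gamma>
       (\<lambda>s. cauchy_kernel s (slice_emb M \<zeta>) * inverse (of_real (2 * pi) * I)) h (w \<gamma>)"
    "(\<Sum>\<gamma>\<in>\<Gamma>. boundary_sign E \<gamma> *\<^sub>R w \<gamma>) =
       plus_factor M I * (slice_emb I (F \<zeta>) + slice_emb I (G \<zeta>) * J) +
       minus_factor M I * (slice_emb I (F (cnj \<zeta>)) + slice_emb I (G (cnj \<zeta>)) * J)"
proof -
  let ?e = "slice_emb I" and ?\<zeta>' = "cnj \<zeta>"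
  let ?s = "\<lambda>\<gamma>. complex_of_real (boundary_sign E \<gamma>)"
  define k where "k = inverse (of_real (2 * pi) * \<i>)"
  have k: "k * (of_real (2 * pi) * \<i>) = 1"
    unfolding k_def by (rule left_inverse) simp
  have "?e \<i> = I" by (simp add: slice_emb_def)
  then have ek: "?e k = inverse (of_real (2 * pi) * I)"
    by (simp only: k_def slice_emb_inverse[OF I] slice_emb_mult[OF I] slice_emb_simps(3))
  define a1 b1 where "a1 = coord1 I (plus_factor M I)" and "b1 = cnj (coord2 I J (plus_factor M I))"
  define a2 b2 where "a2 = coord1 I (minus_factor M I)" and "b2 = cnj (coord2 I J (minus_factor M I))"
  have p: "plus_factor M I = ?e a1 + J * ?e b1" and m: "minus_factor M I = ?e a2 + J * ?e b2"
    by (simp_all only: a1_def b1_def a2_def b2_def quat_splitting_left[OF I J])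
  obtain f1 where f1: "\<And>\<gamma>. \<gamma> \<in> \<Gamma> \<Longrightarrow> has_line_integral (\<lambda>z. F z / (z - \<zeta>)) (f1 \<gamma>) \<gamma>"
    "(\<Sum>\<gamma>\<in>\<Gamma>. ?s \<gamma> * f1 \<gamma>) = 2 * pi * \<i> * F \<zeta>"
    by (rule Cauchy_formula_jordan_frontier[OF jf W F \<zeta>(1)], rule that)
  obtain f2 where f2: "\<And>\<gamma>. \<gamma> \<in> \<Gamma> \<Longrightarrow> has_line_integral (\<lambda>z. F z / (z - ?\<zeta>')) (f2 \<gamma>) \<gamma>"
    "(\<Sum>\<gamma>\<in>\<Gamma>. ?s \<gamma> * f2 \<gamma>) = 2 * pi * \<i> * F ?\<zeta>'"
    by (rule Cauchy_formula_jordan_frontier[OF jf W F \<zeta>(2)], rule that)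
  obtain g1 where g1: "\<And>\<gamma>. \<gamma> \<in> \<Gamma> \<Longrightarrow> has_line_integral (\<lambda>z. G z / (z - \<zeta>)) (g1 \<gamma>) \<gamma>"
    "(\<Sum>\<gamma>\<in>\<Gamma>. ?s \<gamma> * g1 \<gamma>) = 2 * pi * \<i> * G \<zeta>"
    by (rule Cauchy_formula_jordan_frontier[OF jf W G \<zeta>(1)], rule that)
  obtain g2 where g2: "\<And>\<gamma>. \<gamma> \<in> \<Gamma> \<Longrightarrow> has_line_integral (\<lambda>z. G z / (z - ?\<zeta>')) (g2 \<gamma>) \<gamma>"
    "(\<Sum>\<gamma>\<in>\<Gamma>. ?s \<gamma> * g2 \<gamma>) = 2 * pi * \<i> * G ?\<zeta>'"
    by (rule Cauchy_formula_jordan_frontier[OF jf W G \<zeta>(2)], rule that)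
  define comb where "comb a b x y = k * a * x + k * b * y" for a b x y :: complex
  have li: "has_line_integral (\<lambda>z. comb a b (1 / (z - \<zeta>)) (1 / (z - ?\<zeta>')) * X z) (comb a b u v) \<gamma>"
    if "has_line_integral (\<lambda>z. X z / (z - \<zeta>)) u \<gamma>" "has_line_integral (\<lambda>z. X z / (z - ?\<zeta>')) v \<gamma>"
    for a b X u v \<gamma>
  proof -
    have "has_line_integral (\<lambda>z. k * a * (X z / (z - \<zeta>)) + k * b * (X z / (z - ?\<zeta>')))
        (k * a * u + k * b * v) \<gamma>"
      by (intro has_line_integral_add has_line_integral_cmult that)
    then show ?thesis
      unfolding comb_def by (rule has_line_integral_cong) (simp add: algebra_simps)
  qed
  have total: "(\<Sum>\<gamma>\<in>\<Gamma>. ?s \<gamma> * comb a b (u \<gamma>) (v \<gamma>)) = a * x + b * y"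
    if "(\<Sum>\<gamma>\<in>\<Gamma>. ?s \<gamma> * u \<gamma>) = 2 * pi * \<i> * x" "(\<Sum>\<gamma>\<in>\<Gamma>. ?s \<gamma> * v \<gamma>) = 2 * pi * \<i> * y"
    for a b u v x y
  proof -
    have "(\<Sum>\<gamma>\<in>\<Gamma>. ?s \<gamma> * comb a b (u \<gamma>) (v \<gamma>)) =
        k * a * (\<Sum>\<gamma>\<in>\<Gamma>. ?s \<gamma> * u \<gamma>) + k * b * (\<Sum>\<gamma>\<in>\<Gamma>. ?s \<gamma> * v \<gamma>)"
      unfolding sum_distrib_left sum.distrib[symmetric]
      by (intro sum.cong refl) (simp add: comb_def algebra_simps)
    also have "\<dots> = (k * (of_real (2 * pi) * \<i>)) * (a * x + b * y)"
      unfolding that by (simp add: algebra_simps)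
    finally show ?thesis by (simp only: k mult_1)
  qed
  define w where "w \<gamma> = ?e (comb a1 a2 (f1 \<gamma>) (f2 \<gamma>)) + ?e (comb a1 a2 (g1 \<gamma>) (g2 \<gamma>)) * J +
      J * ?e (comb b1 b2 (f1 \<gamma>) (f2 \<gamma>)) + J * ?e (comb b1 b2 (g1 \<gamma>) (g2 \<gamma>)) * J" for \<gamma>
  show ?thesis
  proof (rule that[of w])
    fix \<gamma> assume \<gamma>: "\<gamma> \<in> \<Gamma>"
    define H K where "H z = comb a1 a2 (1 / (z - \<zeta>)) (1 / (z - ?\<zeta>'))"
      and "K z = comb b1 b2 (1 / (z - \<zeta>)) (1 / (z - ?\<zeta>'))" for z
    have fr: "path_image \<gamma> \<subseteq> frontier E" using \<gamma> jordan_frontierD(9)[OF jf] by blast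
    have kernel: "cauchy_kernel (?e z) (slice_emb M \<zeta>) * inverse (of_real (2 * pi) * I) =
        ?e (H z) + J * ?e (K z)" if z: "z \<in> path_image \<gamma>" for z
    proof -
      have "z \<notin> E" using z fr jordan_frontierD(1)[OF jf] by (auto simp: frontier_def interior_open)
      then have "z \<noteq> \<zeta>" "z \<noteq> ?\<zeta>'" using \<zeta> by auto
      then show ?thesis
        unfolding cauchy_kernel_slice[OF M I \<open>z \<noteq> \<zeta>\<close> \<open>z \<noteq> ?\<zeta>'\<close>] ek[symmetric] p m H_def K_def comb_def
        by (simp add: slice_emb_simps(4) algebra_simps flip: slice_emb_mult[OF I])
    qed
    show "has_slice_integral I \<gamma>
       (\<lambda>s. cauchy_kernel s (slice_emb M \<zeta>) * inverse (of_real (2 * pi) * I)) h (w \<gamma>)"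
      unfolding has_slice_integral_def
    proof (intro bexI[OF _ J(1)] conjI J(2) exI)
      show "\<forall>z\<in>path_image \<gamma>. h (?e z) = ?e (F z) + ?e (G z) * J \<and>
          cauchy_kernel (?e z) (slice_emb M \<zeta>) * inverse (of_real (2 * pi) * I) = ?e (H z) + J * ?e (K z)"
        using h kernel fr by blast
      show "has_line_integral (\<lambda>z. H z * F z) (comb a1 a2 (f1 \<gamma>) (f2 \<gamma>)) \<gamma>"
        "has_line_integral (\<lambda>z. H z * G z) (comb a1 a2 (g1 \<gamma>) (g2 \<gamma>)) \<gamma>"
        "has_line_integral (\<lambda>z. K z * F z) (comb b1 b2 (f1 \<gamma>) (f2 \<gamma>)) \<gamma>"
        "has_line_integral (\<lambda>z. K z * G z) (comb b1 b2 (g1 \<gamma>) (g2 \<gamma>)) \<gamma>"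
        unfolding H_def K_def using f1(1) f2(1) g1(1) g2(1) \<gamma> by (auto intro!: li)
    qed (rule w_def)
  next
    let ?v = "\<lambda>a b u v. \<Sum>\<gamma>\<in>\<Gamma>. ?s \<gamma> * comb a b (u \<gamma>) (v \<gamma>)"
    have esum: "?e (\<Sum>\<gamma>\<in>\<Gamma>. ?s \<gamma> * c \<gamma>) = (\<Sum>\<gamma>\<in>\<Gamma>. boundary_sign E \<gamma> *\<^sub>R ?e (c \<gamma>))" for c
      by (simp only: scaleR_conv_of_real[symmetric] slice_emb_simps(7)
          linear_sum[OF bounded_linear.linear[OF bounded_linear_slice_emb]])
    have "(\<Sum>\<gamma>\<in>\<Gamma>. boundary_sign E \<gamma> *\<^sub>R w \<gamma>) =
        ?e (?v a1 a2 f1 f2) + ?e (?v a1 a2 g1 g2) * J + J * ?e (?v b1 b2 f1 f2) + J * ?e (?v b1 b2 g1 g2) * J"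
      unfolding esum sum_distrib_left sum_distrib_right sum.distrib[symmetric]
      by (intro sum.cong refl) (simp add: w_def scaleR_add_right)
    also have "\<dots> = ?e (a1 * F \<zeta> + a2 * F ?\<zeta>') + ?e (a1 * G \<zeta> + a2 * G ?\<zeta>') * J +
        J * ?e (b1 * F \<zeta> + b2 * F ?\<zeta>') + J * ?e (b1 * G \<zeta> + b2 * G ?\<zeta>') * J"
      by (simp only: total[OF f1(2) f2(2)] total[OF g1(2) g2(2)])
    also have "\<dots> = plus_factor M I * (?e (F \<zeta>) + ?e (G \<zeta>) * J) +
       minus_factor M I * (?e (F ?\<zeta>') + ?e (G ?\<zeta>') * J)"
      unfolding p m by (simp add: slice_emb_simps(4) slice_emb_mult[OF I] algebra_simps)
    finally show "(\<Sum>\<gamma>\<in>\<Gamma>. boundary_sign E \<gamma> *\<^sub>R w \<gamma>) =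
       plus_factor M I * (?e (F \<zeta>) + ?e (G \<zeta>) * J) +
       minus_factor M I * (?e (F ?\<zeta>') + ?e (G ?\<zeta>') * J)" .
  qed
qed

section \<open>Holomorphy on a slice\<close>

text \<open>A quaternion-valued function on a plane domain is holomorphic for the complex structure given
  by left multiplication with \<open>I\<close>.\<close>

definition left_holomorphic :: "quat \<Rightarrow> (complex \<Rightarrow> quat) \<Rightarrow> complex set \<Rightarrow> bool" where
  "left_holomorphic I g S \<longleftrightarrow>
     (\<forall>z\<in>S. \<exists>D. (g has_derivative (\<lambda>h. slice_emb I h * D)) (at z))"

lemma left_holomorphic_diff:
  assumes "left_holomorphic I f S" "left_holomorphic I g S"
  shows "left_holomorphic I (\<lambda>z. f z - g z) S"
  unfolding left_holomorphic_def
proof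
  fix z assume "z \<in> S"
  then obtain D D' where "(f has_derivative (\<lambda>h. slice_emb I h * D)) (at z)"
      "(g has_derivative (\<lambda>h. slice_emb I h * D')) (at z)"
    using assms unfolding left_holomorphic_def by meson
  then have "((\<lambda>z. f z - g z) has_derivative (\<lambda>h. slice_emb I h * D - slice_emb I h * D')) (at z)"
    by (rule has_derivative_diff)
  then show "\<exists>D. ((\<lambda>z. f z - g z) has_derivative (\<lambda>h. slice_emb I h * D)) (at z)"
    by (auto simp: right_diff_distrib[symmetric])
qed

lemma left_holomorphic_subset: "left_holomorphic I f S \<Longrightarrow> T \<subseteq> S \<Longrightarrow> left_holomorphic I f T"
  unfolding left_holomorphic_def by blast

lemma coord_holomorphic:
  assumes "left_holomorphic I g S" "I \<in> imag_units" "J \<in> imag_units" "orthogonal I J"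
  shows "(\<lambda>z. coord1 I (g z)) holomorphic_on S"
    and "(\<lambda>z. coord2 I J (g z)) holomorphic_on S"
proof -
  have D: "\<exists>D. (g has_derivative (\<lambda>h. slice_emb I h * D)) (at z)" if "z \<in> S" for z
    using assms(1) that unfolding left_holomorphic_def by blast
  show "(\<lambda>z. coord1 I (g z)) holomorphic_on S"
    unfolding holomorphic_on_def field_differentiable_def
  proof
    fix z assume "z \<in> S"
    then obtain D where "(g has_derivative (\<lambda>h. slice_emb I h * D)) (at z)" using D by blast
    then have "((\<lambda>z. coord1 I (g z)) has_derivative (\<lambda>h. coord1 I (slice_emb I h * D))) (at z)"
      by (rule bounded_linear.has_derivative[OF bounded_linear_coord1])
    then have "((\<lambda>z. coord1 I (g z)) has_field_derivative coord1 I D) (at z)"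
      by (simp only: has_field_derivative_def coord_mult_left[OF assms(2-4)] mult.commute[of _ "coord1 I D"])
    then show "\<exists>f'. ((\<lambda>z. coord1 I (g z)) has_field_derivative f') (at z within S)"
      by (blast intro: has_field_derivative_at_within)
  qed
  show "(\<lambda>z. coord2 I J (g z)) holomorphic_on S"
    unfolding holomorphic_on_def field_differentiable_def
  proof
    fix z assume "z \<in> S"
    then obtain D where "(g has_derivative (\<lambda>h. slice_emb I h * D)) (at z)" using D by blast
    then have "((\<lambda>z. coord2 I J (g z)) has_derivative (\<lambda>h. coord2 I J (slice_emb I h * D))) (at z)"
      by (rule bounded_linear.has_derivative[OF bounded_linear_coord2])
    then have "((\<lambda>z. coord2 I J (g z)) has_field_derivative coord2 I J D) (at z)"
      by (simp only: has_field_derivative_def coord_mult_left[OF assms(2-4)] mult.commute[of _ "coord2 I J D"])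
    then show "\<exists>f'. ((\<lambda>z. coord2 I J (g z)) has_field_derivative f') (at z within S)"
      by (blast intro: has_field_derivative_at_within)
  qed
qed

lemma real_islimpt:
  fixes S :: "complex set"
  assumes "open S" "of_real x \<in> S"
  shows "(of_real x :: complex) islimpt (S \<inter> \<real>)"
  unfolding islimpt_approachable
proof (intro allI impI)
  fix e :: real assume "e > 0"
  obtain r where r: "r > 0" "ball (of_real x) r \<subseteq> S" using assms by (meson openE)
  define d where "d = min e r / 2"
  have d: "d > 0" "d < e" "d < r" using \<open>e > 0\<close> r(1) by (auto simp: d_def min_def)
  have "dist (complex_of_real (x + d)) (of_real x) = d"
    using d(1) by (simp add: dist_norm)
  moreover from this have "complex_of_real (x + d) \<in> S"
    using r(2) d(3) by (auto simp: dist_commute)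
  moreover have "complex_of_real (x + d) \<in> \<real>" by (rule Reals_of_real)
  moreover have "complex_of_real (x + d) \<noteq> of_real x" using d(1) unfolding of_real_eq_iff by simp
  ultimately show "\<exists>x'\<in>S \<inter> \<real>. x' \<noteq> complex_of_real x \<and> dist x' (of_real x) < e"
    using d(2) by (intro bexI[of _ "complex_of_real (x + d)"]) auto
qed

lemma left_holomorphic_eq_0:
  assumes g: "left_holomorphic I g S" and I: "I \<in> imag_units"
    and S: "open S" "connected S" "of_real x \<in> S"
    and zero: "\<And>t. of_real t \<in> S \<Longrightarrow> g (of_real t) = 0"
    and z: "z \<in> S"
  shows "g z = 0"
proof -
  obtain J where J: "J \<in> imag_units" "orthogonal I J"
    using exists_orthogonal_imag_unit[OF I] by blast
  have c0: "coord1 I 0 = 0" "coord2 I J 0 = 0"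
    by (simp_all add: coord1_def coord2_def complex_eq_iff)
  have g0: "g w = 0" if "w \<in> S \<inter> \<real>" for w
  proof -
    have "w \<in> \<real>" using that by blast
    then obtain t where "w = of_real t" by (rule Reals_cases)
    then show ?thesis using that zero[of t] by simp
  qed
  note lim = S(1,2) Int_lower1 S(3) real_islimpt[OF S(1,3)] _ z
  have "coord1 I (g z) = 0"
    by (rule analytic_continuation[OF coord_holomorphic(1)[OF g I J] lim]) (simp only: g0 c0)
  moreover have "coord2 I J (g z) = 0"
    by (rule analytic_continuation[OF coord_holomorphic(2)[OF g I J] lim]) (simp only: g0 c0)
  ultimately show ?thesis
    using quat_splitting(1)[OF I J, of "g z"] by (simp add: slice_emb_simps)
qed

text \<open>Continuity of the partial derivatives makes the restriction of \<open>f\<close> to the slice differentiable,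
  and the equation \<open>f\<^sub>x + I f\<^sub>y = 0\<close> says that the derivative is \<open>h \<mapsto> h f\<^sub>x\<close>.\<close>

lemma slice_regular_left_holomorphic:
  assumes "slice_regular \<Omega> f" "open \<Omega>" and I: "I \<in> imag_units"
  shows "left_holomorphic I (\<lambda>z. f (slice_emb I z)) (slice_emb I -` \<Omega>)"
  unfolding left_holomorphic_def
proof
  fix z0 assume z0: "z0 \<in> slice_emb I -` \<Omega>"
  let ?S = "{(x, y). of_real x + of_real y * I \<in> \<Omega>}"
  obtain fx fy :: "real \<times> real \<Rightarrow> quat" where
    cont: "continuous_on ?S fy"
    and dx: "\<And>x y. (x, y) \<in> ?S \<Longrightarrow>
      ((\<lambda>t. f (of_real t + of_real y * I)) has_vector_derivative fx (x, y)) (at x)"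
    and dy: "\<And>x y. (x, y) \<in> ?S \<Longrightarrow>
      ((\<lambda>t. f (of_real x + of_real t * I)) has_vector_derivative fy (x, y)) (at y)"
    and cr: "\<And>x y. (x, y) \<in> ?S \<Longrightarrow> (1 / 2) *\<^sub>R (fx (x, y) + I * fy (x, y)) = 0"
  proof -
    obtain fx fy :: "real \<times> real \<Rightarrow> quat" where
      "continuous_on ?S fx \<and> continuous_on ?S fy \<and>
        (\<forall>x y. of_real x + of_real y * I \<in> \<Omega> \<longrightarrow>
           ((\<lambda>t. f (of_real t + of_real y * I)) has_vector_derivative fx (x, y)) (at x) \<and>
           ((\<lambda>t. f (of_real x + of_real t * I)) has_vector_derivative fy (x, y)) (at y) \<and>
           (1 / 2) *\<^sub>R (fx (x, y) + I * fy (x, y)) = 0)"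
      using assms(1) I unfolding slice_regular_def by blast
    then show ?thesis by (intro that[of fy fx]) auto
  qed
  define x0 y0 where "x0 = Re z0" and "y0 = Im z0"
  have z0S: "(x0, y0) \<in> ?S" using z0 by (simp add: slice_emb_def x0_def y0_def)
  have "open ?S"
  proof -
    have "?S = (\<lambda>p. of_real (fst p) + of_real (snd p) * I) -` \<Omega>" by auto
    moreover have "open ((\<lambda>p. of_real (fst p) + of_real (snd p) * I) -` \<Omega>)"
      using assms(2) by (intro open_vimage continuous_intros)
    ultimately show ?thesis by simp
  qed
  then obtain X0 Y0 where XY0: "open X0" "open Y0" "x0 \<in> X0" "y0 \<in> Y0" "X0 \<times> Y0 \<subseteq> ?S"
    using z0S by (rule open_prod_elim) (auto simp: mem_Times_iff)
  obtain r where r: "r > 0" "ball y0 r \<subseteq> Y0" using XY0 by (meson openE)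
  define X Y where "X = X0" and "Y = ball y0 r"
  have XY: "open X" "open Y" "convex Y" "x0 \<in> X" "y0 \<in> Y" "X \<times> Y \<subseteq> ?S"
    using XY0 r by (auto simp: X_def Y_def)
  let ?g = "\<lambda>x y. f (of_real x + of_real y * I)"
  have "((\<lambda>(x, y). ?g x y) has_derivative
      (\<lambda>(h, k). h *\<^sub>R fx (x0, y0) + blinfun_scaleR_left (fy (x0, y0)) k)) (at (x0, y0) within X \<times> Y)"
  proof (rule has_derivative_partialsI[where fy = "\<lambda>x y. blinfun_scaleR_left (fy (x, y))"])
    show "((\<lambda>x. ?g x y0) has_derivative (\<lambda>h. h *\<^sub>R fx (x0, y0))) (at x0 within X)"
      using dx[OF z0S] unfolding has_vector_derivative_def by (rule has_derivative_at_withinI)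
    show "((\<lambda>y. ?g x y) has_derivative blinfun_scaleR_left (fy (x, y))) (at y within Y)"
      if "x \<in> X" "y \<in> Y" for x y
    proof -
      have "(x, y) \<in> ?S" using that XY(6) by blast
      from dy[OF this] show ?thesis
        unfolding has_vector_derivative_def by (simp add: has_derivative_at_withinI)
    qed
    have "continuous_on (X \<times> Y) fy" using cont XY(6) by (rule continuous_on_subset)
    then have "continuous_on (X \<times> Y) (\<lambda>p. blinfun_scaleR_left (fy p))"
      by (rule bounded_linear.continuous_on[OF bounded_linear_blinfun_scaleR_left])
    then show "continuous (at (x0, y0) within X \<times> Y) (\<lambda>(x, y). blinfun_scaleR_left (fy (x, y)))"
      using XY(4,5) by (simp add: continuous_on_eq_continuous_within case_prod_unfold)
  qed (use XY in auto)
  then have der: "((\<lambda>(x, y). ?g x y) has_derivative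
      (\<lambda>(h, k). h *\<^sub>R fx (x0, y0) + k *\<^sub>R fy (x0, y0))) (at (Re z0, Im z0))"
    using XY by (simp add: at_within_open[OF _ open_Times] x0_def y0_def)
  have "((\<lambda>z. (Re z, Im z)) has_derivative (\<lambda>h. (Re h, Im h))) (at z0)"
    by (intro has_derivative_Pair bounded_linear.has_derivative[OF bounded_linear_Re]
        bounded_linear.has_derivative[OF bounded_linear_Im] has_derivative_ident)
  from has_derivative_compose[OF this der]
  have "((\<lambda>z. f (slice_emb I z)) has_derivative
      (\<lambda>h. Re h *\<^sub>R fx (x0, y0) + Im h *\<^sub>R fy (x0, y0))) (at z0)"
    by (simp add: slice_emb_def)
  moreover have "fy (x0, y0) = I * fx (x0, y0)"
  proof -
    have "fx (x0, y0) + I * fy (x0, y0) = 0"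
    proof -
      have "(1 / 2 :: real) \<noteq> 0" by simp
      then show ?thesis using cr[OF z0S] unfolding scaleR_eq_0_iff by blast
    qed
    then have eq: "fx (x0, y0) = - (I * fy (x0, y0))"
      by (rule eq_neg_iff_add_eq_0[THEN iffD2])
    have "I * (I * fy (x0, y0)) = - fy (x0, y0)"
      by (simp only: mult.assoc[symmetric] imag_units_square[OF I] mult_minus_left mult_1_left)
    then show ?thesis by (simp only: eq mult_minus_right minus_minus)
  qed
  moreover have "Re h *\<^sub>R fx (x0, y0) + Im h *\<^sub>R (I * fx (x0, y0)) = slice_emb I h * fx (x0, y0)" for h
    by (simp add: slice_emb_scaleR distrib_right)
  ultimately have "((\<lambda>z. f (slice_emb I z)) has_derivative
      (\<lambda>h. slice_emb I h * fx (x0, y0))) (at z0)"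
    by (simp only:)
  then show "\<exists>D. ((\<lambda>z. f (slice_emb I z)) has_derivative (\<lambda>h. slice_emb I h * D)) (at z0)"
    by blast
qed

section \<open>Stem functions and the local representation formula\<close>

text \<open>The pair \<open>(B, C)\<close> is a holomorphic stem function: \<open>B\<close> and \<open>C\<close> satisfy the Cauchy--Riemann
  equations \<open>B\<^sub>x = C\<^sub>y\<close> and \<open>B\<^sub>y = - C\<^sub>x\<close>.\<close>

definition stem_on :: "(complex \<Rightarrow> quat) \<Rightarrow> (complex \<Rightarrow> quat) \<Rightarrow> complex set \<Rightarrow> bool" where
  "stem_on B C S \<longleftrightarrow> (\<forall>z\<in>S. \<exists>b c.
     (B has_derivative (\<lambda>h. Re h *\<^sub>R b - Im h *\<^sub>R c)) (at z) \<and>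
     (C has_derivative (\<lambda>h. Re h *\<^sub>R c + Im h *\<^sub>R b)) (at z))"

lemma stem_on_subset: "stem_on B C S \<Longrightarrow> T \<subseteq> S \<Longrightarrow> stem_on B C T"
  unfolding stem_on_def by blast

lemma stem_left_holomorphic:
  assumes "stem_on B C S" and I: "I \<in> imag_units"
  shows "left_holomorphic I (\<lambda>z. B z + I * C z) S"
  unfolding left_holomorphic_def
proof
  fix z assume "z \<in> S"
  then obtain b c where B: "(B has_derivative (\<lambda>h. Re h *\<^sub>R b - Im h *\<^sub>R c)) (at z)"
      and C: "(C has_derivative (\<lambda>h. Re h *\<^sub>R c + Im h *\<^sub>R b)) (at z)"
    using assms(1) unfolding stem_on_def by blast
  have "((\<lambda>z. B z + I * C z) has_derivative
      (\<lambda>h. (Re h *\<^sub>R b - Im h *\<^sub>R c) + I * (Re h *\<^sub>R c + Im h *\<^sub>R b))) (at z)"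
    by (intro has_derivative_add B has_derivative_mult_right C)
  moreover have "(Re h *\<^sub>R b - Im h *\<^sub>R c) + I * (Re h *\<^sub>R c + Im h *\<^sub>R b) =
      slice_emb I h * (b + I * c)" for h
  proof -
    have "I * (I * c) = - c" by (simp add: imag_units_square[OF I] flip: mult.assoc)
    then show ?thesis by (simp add: slice_emb_scaleR algebra_simps)
  qed
  ultimately show "\<exists>D. ((\<lambda>z. B z + I * C z) has_derivative (\<lambda>h. slice_emb I h * D)) (at z)"
    by (simp only:) blast
qed

text \<open>The values of a slice function \<open>B + J C\<close> for two imaginary units \<open>J\<close> determine \<open>B\<close> and \<open>C\<close>; and
  holomorphy on these two slices forces the Cauchy--Riemann equations, because \<open>J\<^sub>0 - J\<^sub>1\<close> is
  invertible.\<close>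

lemma stem_of_two_slices:
  assumes J: "J0 \<in> imag_units" "J1 \<in> imag_units" "J0 \<noteq> J1"
    and f0: "left_holomorphic J0 f0 S" and f1: "left_holomorphic J1 f1 S"
    and C: "\<And>z. C z = inverse (J0 - J1) * (f0 z - f1 z)" and B: "\<And>z. B z = f0 z - J0 * C z"
  shows "stem_on B C S"
proof -
  let ?d = "J0 - J1"
  have d: "inverse ?d * (?d * x) = x" "?d * (inverse ?d * x) = x" for x
    using J(3) by (simp_all flip: mult.assoc)
  show "stem_on B C S"
    unfolding stem_on_def
  proof
    fix z assume "z \<in> S"
    then obtain D0 D1 where D0: "(f0 has_derivative (\<lambda>h. slice_emb J0 h * D0)) (at z)"
        and D1: "(f1 has_derivative (\<lambda>h. slice_emb J1 h * D1)) (at z)"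
      using f0 f1 unfolding left_holomorphic_def by meson
    define c b where "c = inverse ?d * (D0 - D1)" and "b = D0 - J0 * c"
    have dc: "?d * c = D0 - D1" by (simp only: c_def d)
    have D0b: "D0 = b + J0 * c" by (simp add: b_def)
    have D1b: "D1 = b + J1 * c" using dc by (simp add: b_def algebra_simps)
    have JJ: "J0 * (J0 * c) = - c" "J1 * (J1 * c) = - c"
      using imag_units_square[OF J(1)] imag_units_square[OF J(2)] by (simp_all flip: mult.assoc)
    have Cfun: "C = (\<lambda>z. inverse ?d * (f0 z - f1 z))" and Bfun: "B = (\<lambda>z. f0 z - J0 * C z)"
      using B C by auto
    have e0: "slice_emb J0 h * D0 = (Re h *\<^sub>R b - Im h *\<^sub>R c) + J0 * (Re h *\<^sub>R c + Im h *\<^sub>R b)" for h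
      using JJ by (simp add: D0b slice_emb_scaleR algebra_simps)
    have e1: "slice_emb J1 h * D1 = (Re h *\<^sub>R b - Im h *\<^sub>R c) + J1 * (Re h *\<^sub>R c + Im h *\<^sub>R b)" for h
      using JJ by (simp add: D1b slice_emb_scaleR algebra_simps)
    have "slice_emb J0 h * D0 - slice_emb J1 h * D1 = ?d * (Re h *\<^sub>R c + Im h *\<^sub>R b)" for h
      unfolding e0 e1 by (simp add: left_diff_distrib)
    then have "inverse ?d * (slice_emb J0 h * D0 - slice_emb J1 h * D1) = Re h *\<^sub>R c + Im h *\<^sub>R b" for h
      by (simp only: d)
    moreover have "(C has_derivative
        (\<lambda>h. inverse ?d * (slice_emb J0 h * D0 - slice_emb J1 h * D1))) (at z)"
      unfolding Cfun by (intro has_derivative_mult_right has_derivative_diff D0 D1)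
    ultimately have C': "(C has_derivative (\<lambda>h. Re h *\<^sub>R c + Im h *\<^sub>R b)) (at z)"
      by (simp only:)
    have "(B has_derivative (\<lambda>h. slice_emb J0 h * D0 - J0 * (Re h *\<^sub>R c + Im h *\<^sub>R b))) (at z)"
      unfolding Bfun by (intro has_derivative_mult_right has_derivative_diff D0 C')
    moreover have "slice_emb J0 h * D0 - J0 * (Re h *\<^sub>R c + Im h *\<^sub>R b) = Re h *\<^sub>R b - Im h *\<^sub>R c" for h
      unfolding e0 by simp
    ultimately have "(B has_derivative (\<lambda>h. Re h *\<^sub>R b - Im h *\<^sub>R c)) (at z)"
      by (simp only:)
    with C' show "\<exists>b c. (B has_derivative (\<lambda>h. Re h *\<^sub>R b - Im h *\<^sub>R c)) (at z) \<and>
        (C has_derivative (\<lambda>h. Re h *\<^sub>R c + Im h *\<^sub>R b)) (at z)" by blast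
  qed
qed

lemma stem_on_reflect:
  assumes "stem_on B C S"
  shows "stem_on (\<lambda>z. B (cnj z)) (\<lambda>z. - C (cnj z)) (cnj -` S)"
  unfolding stem_on_def
proof
  fix z assume "z \<in> cnj -` S"
  then obtain b c where B: "(B has_derivative (\<lambda>h. Re h *\<^sub>R b - Im h *\<^sub>R c)) (at (cnj z))"
      and C: "(C has_derivative (\<lambda>h. Re h *\<^sub>R c + Im h *\<^sub>R b)) (at (cnj z))"
    using assms unfolding stem_on_def by blast
  have cnj: "(cnj has_derivative cnj) (at z)"
    by (rule bounded_linear.has_derivative[OF bounded_linear_cnj has_derivative_ident])
  have "((\<lambda>z. B (cnj z)) has_derivative (\<lambda>h. Re h *\<^sub>R b - Im h *\<^sub>R (- c))) (at z)"
    using has_derivative_compose[OF cnj B] by simp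
  moreover have "((\<lambda>z. - C (cnj z)) has_derivative (\<lambda>h. Re h *\<^sub>R (- c) + Im h *\<^sub>R b)) (at z)"
    using has_derivative_minus[OF has_derivative_compose[OF cnj C]] by simp
  ultimately show "\<exists>b c. ((\<lambda>z. B (cnj z)) has_derivative (\<lambda>h. Re h *\<^sub>R b - Im h *\<^sub>R c)) (at z) \<and>
      ((\<lambda>z. - C (cnj z)) has_derivative (\<lambda>h. Re h *\<^sub>R c + Im h *\<^sub>R b)) (at z)" by blast
qed

lemma stem_on_transform:
  assumes "stem_on B C S" "open S" "\<And>z. z \<in> S \<Longrightarrow> B' z = B z" "\<And>z. z \<in> S \<Longrightarrow> C' z = C z"
  shows "stem_on B' C' S"
  unfolding stem_on_def
proof
  fix z assume z: "z \<in> S"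
  then obtain b c where B: "(B has_derivative (\<lambda>h. Re h *\<^sub>R b - Im h *\<^sub>R c)) (at z)"
      and C: "(C has_derivative (\<lambda>h. Re h *\<^sub>R c + Im h *\<^sub>R b)) (at z)"
    using assms(1) unfolding stem_on_def by blast
  have "(B' has_derivative (\<lambda>h. Re h *\<^sub>R b - Im h *\<^sub>R c)) (at z)"
    by (rule has_derivative_transform_within_open[OF B assms(2) z]) (simp only: assms(3))
  moreover have "(C' has_derivative (\<lambda>h. Re h *\<^sub>R c + Im h *\<^sub>R b)) (at z)"
    by (rule has_derivative_transform_within_open[OF C assms(2) z]) (simp only: assms(4))
  ultimately show "\<exists>b c. (B' has_derivative (\<lambda>h. Re h *\<^sub>R b - Im h *\<^sub>R c)) (at z) \<and>
      (C' has_derivative (\<lambda>h. Re h *\<^sub>R c + Im h *\<^sub>R b)) (at z)" by blast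
qed

text \<open>Rotate \<open>J\<^sub>0\<close> slightly towards an orthogonal unit.\<close>

lemma exists_close_imag_unit:
  assumes J0: "J0 \<in> imag_units" and "\<epsilon> > 0"
  obtains J1 where "J1 \<in> imag_units" "J1 \<noteq> J0" "norm (J1 - J0) < \<epsilon>"
proof -
  obtain J where J: "J \<in> imag_units" "orthogonal J0 J"
    using exists_orthogonal_imag_unit[OF J0] by blast
  define g where "g t = cos t *\<^sub>R J0 + sin t *\<^sub>R J" for t :: real
  have "continuous_on UNIV g" unfolding g_def by (intro continuous_intros)
  then have "isCont g 0" by (simp add: continuous_on_eq_continuous_at)
  then obtain d where d: "d > 0" "\<And>t. dist t 0 < d \<Longrightarrow> dist (g t) (g 0) < \<epsilon>"
    using \<open>\<epsilon> > 0\<close> unfolding continuous_at_eps_delta by metis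
  define t where "t = min d 1 / 2"
  have t: "t > 0" "t < d" "t < 1" using d(1) by (auto simp: t_def min_def)
  have "sin t > 0" using t pi_gt3 by (intro sin_gt_zero) auto
  have "g t \<in> imag_units"
  proof -
    have n0: "qi J0 * qi J0 + qj J0 * qj J0 + qk J0 * qk J0 = 1"
      and n1: "qi J * qi J + qj J * qj J + qk J * qk J = 1"
      and o: "qi J0 * qi J + qj J0 * qj J + qk J0 * qk J = 0"
      using J J0 by (auto simp: imag_units_iff orthogonal_def inner_quat_def power2_eq_square)
    have cs: "cos t * cos t + sin t * sin t = 1"
      using sin_cos_squared_add2[of t] by (simp add: power2_eq_square)
    have "(qi (g t))\<^sup>2 + (qj (g t))\<^sup>2 + (qk (g t))\<^sup>2 =
        (cos t * cos t) * (qi J0 * qi J0 + qj J0 * qj J0 + qk J0 * qk J0) +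
        (sin t * sin t) * (qi J * qi J + qj J * qj J + qk J * qk J) +
        2 * cos t * sin t * (qi J0 * qi J + qj J0 * qj J + qk J0 * qk J)"
      by (simp add: g_def power2_eq_square algebra_simps)
    also have "\<dots> = 1" unfolding n0 n1 o using cs by simp
    finally show ?thesis using J J0 by (simp add: imag_units_iff g_def)
  qed
  moreover have "g t \<noteq> J0"
  proof
    assume "g t = J0"
    then have "inner (g t) J = 0" using J(2) by (simp add: orthogonal_def)
    moreover have "inner (g t) J = sin t * inner J J"
      using J(2) by (simp add: g_def inner_add_left orthogonal_def)
    moreover have "inner J J = 1"
      using imag_units_norm[OF J(1)] by (simp add: norm_eq_sqrt_inner)
    ultimately show False using \<open>sin t > 0\<close> by simp
  qed
  moreover have "norm (g t - J0) < \<epsilon>"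
    using d(2)[of t] t by (simp add: dist_norm g_def)
  ultimately show ?thesis by (rule that)
qed

lemma spherical_value_deriv:
  assumes J0: "J0 \<in> imag_units" and y: "Im \<zeta> > 0" and \<epsilon>: "\<epsilon> > 0"
    and rep: "\<And>J. J \<in> imag_units \<Longrightarrow> norm (J - J0) < \<epsilon> \<Longrightarrow>
      slice_emb J \<zeta> \<in> \<Omega> \<and> f (slice_emb J \<zeta>) = b + J * c"
  shows "spherical_value f \<Omega> (slice_emb J0 \<zeta>) = b"
    and "spherical_deriv f \<Omega> (slice_emb J0 \<zeta>) = c /\<^sub>R Im \<zeta>"
proof -
  define p where "p = slice_emb J0 \<zeta>"
  have qre: "qre p = Re \<zeta>" unfolding p_def by (rule qre_slice_emb[OF J0])
  have "p - of_real (Re \<zeta>) = Im \<zeta> *\<^sub>R J0" by (simp add: p_def slice_emb_def scaleR_conv_of_real)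
  then have qim: "qim_norm p = Im \<zeta>"
    using y imag_units_norm[OF J0] by (simp add: qim_norm_def qre)
  have pt: "of_real (qre p) + of_real (qim_norm p) * J = slice_emb J \<zeta>" for J
    by (simp add: qre qim slice_emb_def)
  have dist: "dist p (slice_emb J \<zeta>) = Im \<zeta> * norm (J - J0)" for J
  proof -
    have "slice_emb J \<zeta> - p = Im \<zeta> *\<^sub>R (J - J0)"
      by (simp add: p_def slice_emb_scaleR algebra_simps)
    then show ?thesis using y by (simp add: dist_norm norm_minus_commute[of p])
  qed
  let ?S = "{slice_emb J \<zeta> | J. J \<in> imag_units}"
  have sp: "spherical_pair f \<Omega> p b' c' \<longleftrightarrow> (\<exists>V. openin (top_of_set ?S) V \<and> p \<in> V \<and> V \<subseteq> \<Omega> \<and>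
      (\<forall>J\<in>imag_units. slice_emb J \<zeta> \<in> V \<longrightarrow> f (slice_emb J \<zeta>) = b' + J * c'))" for b' c'
    unfolding spherical_pair_def pt ..
  have close: "norm (J - J0) < \<epsilon>" if "slice_emb J \<zeta> \<in> ball p (Im \<zeta> * \<epsilon>)" for J
    using that y by (simp add: dist)
  have pS: "p \<in> ?S" using J0 by (auto simp: p_def)
  have pair: "spherical_pair f \<Omega> p b c"
    unfolding sp
  proof (intro exI[of _ "?S \<inter> ball p (Im \<zeta> * \<epsilon>)"] conjI)
    show "openin (top_of_set ?S) (?S \<inter> ball p (Im \<zeta> * \<epsilon>))" by (simp add: openin_open_Int)
    show "p \<in> ?S \<inter> ball p (Im \<zeta> * \<epsilon>)" using pS y \<epsilon> by simp
    show "?S \<inter> ball p (Im \<zeta> * \<epsilon>) \<subseteq> \<Omega>" using rep close by blast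
    show "\<forall>J\<in>imag_units. slice_emb J \<zeta> \<in> ?S \<inter> ball p (Im \<zeta> * \<epsilon>) \<longrightarrow>
        f (slice_emb J \<zeta>) = b + J * c" using rep close by blast
  qed
  have unique: "b' = b \<and> c' = c" if pair': "spherical_pair f \<Omega> p b' c'" for b' c'
  proof -
    obtain V where V: "openin (top_of_set ?S) V" "p \<in> V"
      "\<And>J. J \<in> imag_units \<Longrightarrow> slice_emb J \<zeta> \<in> V \<Longrightarrow> f (slice_emb J \<zeta>) = b' + J * c'"
      using pair' unfolding sp by blast
    obtain T where T: "open T" "V = ?S \<inter> T" using V(1) unfolding openin_open by blast
    obtain \<eta> where \<eta>: "\<eta> > 0" "ball p \<eta> \<subseteq> T" using T V(2) by (meson IntD2 openE)
    have inV: "slice_emb J \<zeta> \<in> V" if "J \<in> imag_units" "Im \<zeta> * norm (J - J0) < \<eta>" for J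
    proof -
      have "slice_emb J \<zeta> \<in> ball p \<eta>" using that(2) by (simp add: dist)
      then show ?thesis using \<eta>(2) that(1) unfolding T(2) by blast
    qed
    have "min \<epsilon> (\<eta> / Im \<zeta>) > 0" using \<epsilon> \<eta> y by simp
    then obtain J1 where J1: "J1 \<in> imag_units" "J1 \<noteq> J0" "norm (J1 - J0) < min \<epsilon> (\<eta> / Im \<zeta>)"
      by (rule exists_close_imag_unit[OF J0])
    have "norm (J1 - J0) < \<eta> / Im \<zeta>" using J1(3) by simp
    then have "Im \<zeta> * norm (J1 - J0) < \<eta>" using y by (simp add: pos_less_divide_eq mult.commute)
    then have e1: "b' + J1 * c' = b + J1 * c"
      using V(3)[OF J1(1)] inV[OF J1(1)] rep[OF J1(1)] J1(3) by simp
    have e0: "b' + J0 * c' = b + J0 * c"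
      using V(3)[OF J0] inV[OF J0] rep[OF J0] \<epsilon> \<eta>(1) by simp
    have "(J1 - J0) * (c' - c) = (b' + J1 * c') - (b' + J0 * c') - ((b + J1 * c) - (b + J0 * c))"
      by (simp add: algebra_simps)
    also have "\<dots> = 0" unfolding e1 e0 by simp
    finally have "c' = c" using J1(2) by simp
    then show ?thesis using e0 by simp
  qed
  have "p \<notin> \<real>"
  proof
    assume "p \<in> \<real>"
    then obtain r where "p = of_real r" by (rule Reals_cases)
    then have "slice_emb J0 \<zeta> = slice_emb J0 (of_real r)" by (simp add: p_def slice_emb_simps)
    then show False using y by (simp add: slice_emb_eq_iff[OF J0])
  qed
  moreover have "(THE b. \<exists>c. spherical_pair f \<Omega> p b c) = b"
    using pair unique by (intro the_equality) blast+
  moreover have "(THE c. \<exists>b. spherical_pair f \<Omega> p b c) = c"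
    using pair unique by (intro the_equality) blast+
  ultimately show "spherical_value f \<Omega> (slice_emb J0 \<zeta>) = b"
    and "spherical_deriv f \<Omega> (slice_emb J0 \<zeta>) = c /\<^sub>R Im \<zeta>"
    unfolding spherical_value_def spherical_deriv_def p_def[symmetric] by (simp_all add: qim)
qed

lemma slice_neighbourhood:
  assumes P: "compact P" and \<Omega>: "open \<Omega>" and J0: "J0 \<in> imag_units" and sub: "slice_emb J0 ` P \<subseteq> \<Omega>"
  obtains r \<epsilon> where "r > 0" "\<epsilon> > 0"
    "\<And>z w J. z \<in> P \<Longrightarrow> w \<in> ball z r \<Longrightarrow> J \<in> imag_units \<Longrightarrow> norm (J - J0) < \<epsilon> \<Longrightarrow> slice_emb J w \<in> \<Omega>"
proof -
  have "compact (slice_emb J0 ` P)"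
    using P by (intro compact_continuous_image linear_continuous_on bounded_linear_slice_emb)
  then obtain d where d: "d > 0" "(\<Union>x\<in>slice_emb J0 ` P. ball x d) \<subseteq> \<Omega>"
    using compact_subset_open_imp_ball_epsilon_subset[OF _ \<Omega> sub] by blast
  obtain M where M: "\<And>z. z \<in> P \<Longrightarrow> norm z \<le> M" "M > 0"
    using compact_imp_bounded[OF P] unfolding bounded_pos by blast
  show ?thesis
  proof (rule that[of "d / 2" "d / (2 * M)"])
    show "d / 2 > 0" "d / (2 * M) > 0" using d(1) M(2) by simp_all
    fix z w J
    assume z: "z \<in> P" and w: "w \<in> ball z (d / 2)" and J: "J \<in> imag_units" "norm (J - J0) < d / (2 * M)"
    have eq: "slice_emb J w - slice_emb J0 z = slice_emb J (w - z) + Im z *\<^sub>R (J - J0)"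
      by (simp add: slice_emb_scaleR algebra_simps)
    have "norm (slice_emb J (w - z)) < d / 2"
      using w by (simp add: norm_slice_emb[OF J(1)] dist_norm norm_minus_commute)
    moreover have "norm (Im z *\<^sub>R (J - J0)) \<le> d / 2"
    proof -
      have "norm (Im z *\<^sub>R (J - J0)) = \<bar>Im z\<bar> * norm (J - J0)" by simp
      also have "\<dots> \<le> M * (d / (2 * M))"
        using M(1)[OF z] M(2) abs_Im_le_cmod[of z] J(2) by (intro mult_mono) auto
      finally show ?thesis using M(2) by simp
    qed
    ultimately have "norm (slice_emb J w - slice_emb J0 z) < d"
      unfolding eq by (intro norm_triangle_lt) linarith
    then have "slice_emb J w \<in> ball (slice_emb J0 z) d" by (simp add: dist_norm norm_minus_commute)
    then show "slice_emb J w \<in> \<Omega>" using d(2) z by blast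
  qed
qed

lemma connected_slice:
  assumes "slice_domain \<Omega>" and I: "I \<in> imag_units"
  shows "connected (slice_emb I -` \<Omega>)"
proof -
  note c = coord1_slice_emb[OF I]
  have "slice_emb I -` \<Omega> = coord1 I ` (\<Omega> \<inter> slice_plane I)"
  proof (intro set_eqI iffI)
    fix z assume "z \<in> slice_emb I -` \<Omega>"
    then have "slice_emb I z \<in> \<Omega> \<inter> slice_plane I" by (auto simp: slice_plane_def slice_emb_def)
    then show "z \<in> coord1 I ` (\<Omega> \<inter> slice_plane I)" by (rule image_eqI[rotated]) (simp only: c)
  next
    fix z assume "z \<in> coord1 I ` (\<Omega> \<inter> slice_plane I)"
    then obtain x y where xy: "z = coord1 I (of_real x + of_real y * I)" "of_real x + of_real y * I \<in> \<Omega>"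
      by (auto simp: slice_plane_def)
    have "of_real x + of_real y * I = slice_emb I (Complex x y)" by (simp add: slice_emb_def)
    then show "z \<in> slice_emb I -` \<Omega>" using xy by (simp only: c vimage_eq)
  qed
  moreover have "connected (coord1 I ` (\<Omega> \<inter> slice_plane I))"
    using assms unfolding slice_domain_def
    by (intro connected_continuous_image linear_continuous_on bounded_linear_coord1) blast
  ultimately show ?thesis by simp
qed

text \<open>The representation holds with the same \<open>B\<close>, \<open>C\<close> and \<open>\<epsilon>\<close> on a whole neighbourhood of a compact
  connected set in the slice of \<open>J\<^sub>0\<close>, whether or not this set meets the real axis.\<close>

proposition local_representation:
  assumes \<Omega>: "slice_domain \<Omega>" and f: "slice_regular \<Omega> f" and J0: "J0 \<in> imag_units"
    and K: "compact K" "connected K" "K \<noteq> {}" "slice_emb J0 ` K \<subseteq> \<Omega>"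
  obtains \<epsilon> N B C where "\<epsilon> > 0" "open N" "K \<subseteq> N" "stem_on B C N"
    "\<And>J z. J \<in> imag_units \<Longrightarrow> norm (J - J0) < \<epsilon> \<Longrightarrow> z \<in> N \<Longrightarrow>
       slice_emb J z \<in> \<Omega> \<and> f (slice_emb J z) = B z + J * C z"
proof -
  have op\<Omega>: "open \<Omega>" using \<Omega> by (simp add: slice_domain_def)
  let ?D = "slice_emb J0 -` \<Omega>"
  have "open ?D" by (intro open_vimage op\<Omega> linear_continuous_on bounded_linear_slice_emb)
  then have "path_connected ?D"
    using connected_slice[OF \<Omega> J0] by (rule connected_open_path_connected)
  obtain z0 where z0: "z0 \<in> K" using K(3) by blast
  obtain p where "p \<in> \<Omega>" "p \<in> \<real>" using \<Omega> unfolding slice_domain_def by blast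
  then obtain x0 where x0: "of_real x0 \<in> \<Omega>" by (metis Reals_cases)
  have "z0 \<in> ?D" using z0 K(4) by blast
  moreover have "of_real x0 \<in> ?D" using x0 by (simp add: slice_emb_simps)
  ultimately obtain g where g: "path g" "path_image g \<subseteq> ?D" "pathstart g = z0" "pathfinish g = of_real x0"
    using \<open>path_connected ?D\<close> unfolding path_connected_def by blast
  \<comment> \<open>the compact set is joined to the real axis, where all the slices agree\<close>
  define P where "P = K \<union> path_image g"
  have P: "compact P" "slice_emb J0 ` P \<subseteq> \<Omega>" "of_real x0 \<in> P" "K \<subseteq> P"
    using K g pathfinish_in_path_image[of g] compact_path_image[of g] by (auto simp: P_def)
  have "connected P" unfolding P_def
    using K(2) z0 g pathstart_in_path_image[of g] connected_path_image[of g]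
    by (intro connected_Un) auto
  obtain r \<epsilon> where r: "r > 0" "\<epsilon> > 0" and near:
    "\<And>z w J. z \<in> P \<Longrightarrow> w \<in> ball z r \<Longrightarrow> J \<in> imag_units \<Longrightarrow> norm (J - J0) < \<epsilon> \<Longrightarrow> slice_emb J w \<in> \<Omega>"
    by (rule slice_neighbourhood[OF P(1) op\<Omega> J0 P(2)], rule that)
  define N where "N = (\<Union>z\<in>P. ball z r)"
  have "open N" unfolding N_def by (intro open_UN ballI open_ball)
  have PN: "P \<subseteq> N" using r(1) by (auto simp: N_def)
  have "connected N"
  proof -
    have "N = (\<lambda>q. fst q + snd q) ` (P \<times> ball 0 r)"
    proof (intro set_eqI iffI)
      fix w assume "w \<in> N"
      then obtain z where "z \<in> P" "dist z w < r" unfolding N_def by auto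
      then have "(z, w - z) \<in> P \<times> ball 0 r" by (simp add: dist_norm norm_minus_commute)
      then show "w \<in> (\<lambda>q. fst q + snd q) ` (P \<times> ball 0 r)" by (rule image_eqI[rotated]) simp
    next
      fix w assume "w \<in> (\<lambda>q. fst q + snd q) ` (P \<times> ball 0 r)"
      then obtain z y where "w = z + y" "z \<in> P" "norm y < r" by auto
      then have "z \<in> P" "w \<in> ball z r" by (simp_all add: dist_norm)
      then show "w \<in> N" unfolding N_def by blast
    qed
    moreover have "connected ((\<lambda>q. fst q + snd q) ` (P \<times> ball 0 r))"
      using \<open>connected P\<close>
      by (intro connected_continuous_image connected_Times connected_ball continuous_intros)
    ultimately show ?thesis by simp
  qed
  have in\<Omega>: "slice_emb J z \<in> \<Omega>" if "J \<in> imag_units" "norm (J - J0) < \<epsilon>" "z \<in> N" for J z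
    using near that unfolding N_def by blast
  obtain J1 where J1: "J1 \<in> imag_units" "J1 \<noteq> J0" "norm (J1 - J0) < \<epsilon>"
    by (rule exists_close_imag_unit[OF J0 r(2)])
  have hol: "left_holomorphic J (\<lambda>z. f (slice_emb J z)) N"
    if "J \<in> imag_units" "norm (J - J0) < \<epsilon>" for J
    by (rule left_holomorphic_subset[OF slice_regular_left_holomorphic[OF f op\<Omega> that(1)]])
      (use in\<Omega>[OF that] in auto)
  have hol0: "left_holomorphic J0 (\<lambda>z. f (slice_emb J0 z)) N" using hol[OF J0] r(2) by simp
  define C where "C z = inverse (J0 - J1) * (f (slice_emb J0 z) - f (slice_emb J1 z))" for z
  define B where "B z = f (slice_emb J0 z) - J0 * C z" for z
  note stem = stem_of_two_slices[OF J0 J1(1) J1(2)[symmetric] hol0 hol[OF J1(1,3)] C_def B_def]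
  have "f (slice_emb J z) = B z + J * C z" if J: "J \<in> imag_units" "norm (J - J0) < \<epsilon>" and z: "z \<in> N" for J z
  proof -
    have "left_holomorphic J (\<lambda>z. f (slice_emb J z) - (B z + J * C z)) N"
      by (intro left_holomorphic_diff hol J stem_left_holomorphic stem)
    moreover have "f (slice_emb J (of_real t)) - (B (of_real t) + J * C (of_real t)) = 0" for t
      by (simp add: B_def C_def slice_emb_simps)
    moreover have "of_real x0 \<in> N" using P(3) PN by blast
    ultimately have "f (slice_emb J z) - (B z + J * C z) = 0"
      using left_holomorphic_eq_0[OF _ J(1) \<open>open N\<close> \<open>connected N\<close> _ _ z] by blast
    then show ?thesis by simp
  qed
  then show ?thesis
    using that[OF r(2) \<open>open N\<close> _ stem] PN P(4) in\<Omega> by blast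
qed

lemma stem_on_Un: "stem_on B C S \<Longrightarrow> stem_on B C T \<Longrightarrow> stem_on B C (S \<union> T)"
  unfolding stem_on_def by blast

lemma open_half_planes: "open {z. Im z > 0}" "open {z. Im z < 0}"
  by (simp_all add: open_Collect_less continuous_on_Im)

text \<open>The stem function on the upper half of a conjugation-invariant compact set is extended by
  reflection.  Only near the real points of \<open>K\<close> does this need an argument: there the stem function
  found by \<open>local_representation\<close> is already invariant under the reflection.\<close>

proposition symmetric_stem:
  assumes \<Omega>: "slice_domain \<Omega>" and f: "slice_regular \<Omega> f" and J0: "J0 \<in> imag_units"
    and K: "compact K" "K \<noteq> {}" "\<And>z. z \<in> K \<Longrightarrow> cnj z \<in> K" "connected {z\<in>K. Im z \<ge> 0}"
    and sub: "slice_emb J0 ` {z\<in>K. Im z \<ge> 0} \<subseteq> \<Omega>"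
  obtains \<epsilon> W B C where "\<epsilon> > 0" "open W" "K \<subseteq> W" "stem_on B C W"
    "\<And>z. z \<in> K \<Longrightarrow> B (cnj z) = B z" "\<And>z. z \<in> K \<Longrightarrow> C (cnj z) = - C z"
    "\<And>J z. J \<in> imag_units \<Longrightarrow> norm (J - J0) < \<epsilon> \<Longrightarrow> z \<in> K \<Longrightarrow> Im z \<ge> 0 \<Longrightarrow>
       slice_emb J z \<in> \<Omega> \<and> f (slice_emb J z) = B z + J * C z"
proof -
  have op\<Omega>: "open \<Omega>" using \<Omega> by (simp add: slice_domain_def)
  let ?K = "{z\<in>K. Im z \<ge> 0}"
  have "compact (K \<inter> {z. Im z \<ge> 0})"
    using K(1) by (intro compact_Int_closed closed_halfspace_Im_ge)
  then have cK: "compact ?K" by (simp add: Collect_conj_eq)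
  have nK: "?K \<noteq> {}"
  proof -
    obtain z where "z \<in> K" using K(2) by blast
    then have "z \<in> ?K \<or> cnj z \<in> ?K" using K(3)[of z] by auto
    then show ?thesis by blast
  qed
  obtain \<epsilon> N B C where \<epsilon>: "\<epsilon> > 0" and N: "open N" "?K \<subseteq> N" and stem: "stem_on B C N"
    and rep: "\<And>J z. J \<in> imag_units \<Longrightarrow> norm (J - J0) < \<epsilon> \<Longrightarrow> z \<in> N \<Longrightarrow>
       slice_emb J z \<in> \<Omega> \<and> f (slice_emb J z) = B z + J * C z"
    by (rule local_representation[OF \<Omega> f J0 cK K(4) nK sub], rule that)
  obtain J1 where J1: "J1 \<in> imag_units" "J1 \<noteq> J0" "norm (J1 - J0) < \<epsilon>"
    by (rule exists_close_imag_unit[OF J0 \<epsilon>])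
  have two: "t = 0 \<and> s = 0" if "s + J0 * t = 0" "s + J1 * t = 0" for s t
  proof -
    have "(J1 - J0) * t = (s + J1 * t) - (s + J0 * t)" by (simp add: algebra_simps)
    also have "\<dots> = 0" unfolding that by simp
    finally have "t = 0" using J1(2) by simp
    then show ?thesis using that(1) by simp
  qed
  have real: "C (of_real t) = 0 \<and> f (of_real t) = B (of_real t)" if t: "of_real t \<in> N" for t
  proof -
    have 0: "f (of_real t) = B (of_real t) + J0 * C (of_real t)"
      using rep[OF J0 _ t] \<epsilon> by (simp add: slice_emb_simps)
    have 1: "f (of_real t) = B (of_real t) + J1 * C (of_real t)"
      using rep[OF J1(1,3) t] by (simp add: slice_emb_simps)
    have "C (of_real t) = 0"
      using two[of "B (of_real t) - f (of_real t)" "C (of_real t)"] 0 1 by simp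
    then show ?thesis using 0 by simp
  qed
  \<comment> \<open>near the real points of \<open>K\<close> all slices are available, and conjugation of \<open>z\<close> corresponds to
    replacing \<open>J\<close> by \<open>-J\<close>\<close>
  have "\<exists>r>0. ball (of_real x) r \<subseteq> N \<and> (\<forall>z\<in>ball (of_real x) r. B (cnj z) = B z \<and> C (cnj z) = - C z)"
    if x: "of_real x \<in> K" for x
  proof -
    have xN: "of_real x \<in> N" using N(2) x by auto
    then obtain r1 where r1: "r1 > 0" "ball (of_real x) r1 \<subseteq> N" using N(1) by (meson openE)
    have "slice_emb J0 (of_real x) \<in> \<Omega>" using rep[OF J0 _ xN] \<epsilon> by simp
    then have "of_real x \<in> \<Omega>" by (simp add: slice_emb_simps)
    then obtain r2 where r2: "r2 > 0" "ball (of_real x) r2 \<subseteq> \<Omega>" using op\<Omega> by (meson openE)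
    define r where "r = min r1 r2"
    let ?D = "ball (complex_of_real x) r"
    have DN: "?D \<subseteq> N" using r1(2) by (auto simp: r_def)
    have all: "f (slice_emb J z) = B z + J * C z" if J: "J \<in> imag_units" and z: "z \<in> ?D" for J z
    proof -
      have D\<Omega>: "?D \<subseteq> slice_emb J -` \<Omega>"
      proof
        fix w assume w: "w \<in> ?D"
        have "slice_emb J (of_real x - w) = of_real x - slice_emb J w" by (simp add: slice_emb_simps)
        then have "dist (of_real x) (slice_emb J w) = dist (of_real x) w"
          using norm_slice_emb[OF J, of "of_real x - w"] by (simp add: dist_norm)
        then have "slice_emb J w \<in> ball (of_real x) r2" using w by (simp add: r_def)
        then show "w \<in> slice_emb J -` \<Omega>" using r2(2) by blast
      qed
      have "left_holomorphic J (\<lambda>z. f (slice_emb J z) - (B z + J * C z)) ?D"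
        by (intro left_holomorphic_diff left_holomorphic_subset[OF _ D\<Omega>]
            slice_regular_left_holomorphic[OF f op\<Omega> J] stem_left_holomorphic[OF _ J]
            stem_on_subset[OF stem DN])
      moreover have "f (slice_emb J (of_real t)) - (B (of_real t) + J * C (of_real t)) = 0"
        if "of_real t \<in> ?D" for t
      proof -
        have "of_real t \<in> N" using that DN by blast
        from real[OF this] show ?thesis by (simp add: slice_emb_simps)
      qed
      moreover have "of_real x \<in> ?D" using r1(1) r2(1) by (simp add: r_def)
      ultimately have "f (slice_emb J z) - (B z + J * C z) = 0"
        using left_holomorphic_eq_0[OF _ J open_ball connected_ball _ _ z] by blast
      then show ?thesis by simp
    qed
    have "B (cnj z) = B z \<and> C (cnj z) = - C z" if z: "z \<in> ?D" for z
    proof -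
      have "cmod (of_real x - cnj z) = cmod (of_real x - z)"
        by (metis complex_cnj_complex_of_real complex_cnj_diff complex_mod_cnj)
      then have cz: "cnj z \<in> ?D" using z by (simp add: dist_norm)
      have "(B (cnj z) - B z) + J * (C (cnj z) + C z) = 0" if J: "J \<in> imag_units" for J
      proof -
        have "B (cnj z) + J * C (cnj z) = B z + (- J) * C z"
          using all[OF J cz] all[OF imag_units_uminus[OF J] z] by (simp add: slice_emb_cnj)
        then show ?thesis by (simp add: algebra_simps)
      qed
      then have "C (cnj z) + C z = 0 \<and> B (cnj z) - B z = 0"
        using two J0 J1(1) by blast
      then show ?thesis by (simp add: eq_neg_iff_add_eq_0)
    qed
    moreover have "r > 0" using r1(1) r2(1) by (simp add: r_def)
    ultimately show ?thesis using DN by blast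
  qed
  then have "\<forall>x\<in>{x. complex_of_real x \<in> K}. \<exists>r>0. ball (of_real x) r \<subseteq> N \<and>
      (\<forall>z\<in>ball (of_real x) r. B (cnj z) = B z \<and> C (cnj z) = - C z)" by blast
  from bchoice[OF this] obtain r where
    r_all: "\<forall>x\<in>{x. complex_of_real x \<in> K}. r x > 0 \<and> ball (of_real x) (r x) \<subseteq> N \<and>
      (\<forall>z\<in>ball (of_real x) (r x). B (cnj z) = B z \<and> C (cnj z) = - C z)" by (elim exE)
  define W3 where "W3 = (\<Union>x\<in>{x. complex_of_real x \<in> K}. ball (complex_of_real x) (r x))"
  have W3: "open W3" "W3 \<subseteq> N" "\<And>z. z \<in> W3 \<Longrightarrow> B (cnj z) = B z" "\<And>z. z \<in> W3 \<Longrightarrow> C (cnj z) = - C z"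
    using r_all unfolding W3_def by (auto simp del: mem_ball)
  have realW3: "z \<in> W3" if "z \<in> K" "Im z = 0" for z
  proof -
    have "z = of_real (Re z)" using that(2) by (simp add: complex_eq_iff)
    then have "complex_of_real (Re z) \<in> K" "z \<in> ball (complex_of_real (Re z)) (r (Re z))"
      using that(1) r_all by (metis mem_Collect_eq centre_in_ball)+
    then show ?thesis unfolding W3_def by blast
  qed
  define B' C' where "B' z = (if Im z \<ge> 0 then B z else B (cnj z))"
    and "C' z = (if Im z \<ge> 0 then C z else - C (cnj z))" for z
  define W1 W2 where "W1 = N \<inter> {z. Im z > 0}" and "W2 = cnj -` N \<inter> {z. Im z < 0}"
  have op: "open W1" "open W2"
    using N(1) open_half_planes by (auto simp: W1_def W2_def intro!: open_Int open_vimage continuous_on_cnj)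
  show ?thesis
  proof (rule that[of \<epsilon> "W1 \<union> W2 \<union> W3" B' C'])
    show "\<epsilon> > 0" by fact
    show "open (W1 \<union> W2 \<union> W3)" using op W3(1) by blast
    show "K \<subseteq> W1 \<union> W2 \<union> W3"
    proof
      fix z assume z: "z \<in> K"
      consider "Im z > 0" | "Im z < 0" | "Im z = 0" by linarith
      then show "z \<in> W1 \<union> W2 \<union> W3"
      proof cases
        case 1
        then have "z \<in> ?K" using z by simp
        then show ?thesis using N(2) 1 by (auto simp: W1_def)
      next
        case 2
        then have "cnj z \<in> ?K" using z K(3) by simp
        then show ?thesis using N(2) 2 by (auto simp: W2_def)
      next
        case 3
        then show ?thesis using realW3[OF z] by blast
      qed
    qed
    have "stem_on B' C' W1"
      by (rule stem_on_transform[OF stem_on_subset[OF stem] op(1)]) (auto simp: W1_def B'_def C'_def)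
    moreover have "stem_on B' C' W2"
      by (rule stem_on_transform[OF stem_on_subset[OF stem_on_reflect[OF stem]] op(2)])
        (auto simp: W2_def B'_def C'_def)
    moreover have "stem_on B' C' W3"
      by (rule stem_on_transform[OF stem_on_subset[OF stem] W3(1)])
        (use W3 in \<open>auto simp: B'_def C'_def\<close>)
    ultimately show "stem_on B' C' (W1 \<union> W2 \<union> W3)" by (intro stem_on_Un)
    show "B' (cnj z) = B' z" if "z \<in> K" for z
      using W3(3)[OF realW3[OF that]] by (cases "Im z = 0") (auto simp: B'_def)
    show "C' (cnj z) = - C' z" if "z \<in> K" for z
      using W3(4)[OF realW3[OF that]] by (cases "Im z = 0") (auto simp: C'_def)
    show "slice_emb J z \<in> \<Omega> \<and> f (slice_emb J z) = B' z + J * C' z"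
      if "J \<in> imag_units" "norm (J - J0) < \<epsilon>" "z \<in> K" "Im z \<ge> 0" for J z
    proof -
      have "z \<in> N" using that(3,4) N(2) by blast
      then show ?thesis using rep[OF that(1,2)] that(4) by (simp add: B'_def C'_def)
    qed
  qed
qed

section \<open>Slices of a symmetric set and their boundary\<close>

lemma slice_emb_mem_symmetric:
  assumes "symmetric_set U" "I \<in> imag_units" "J \<in> imag_units"
  shows "slice_emb I z \<in> U \<longleftrightarrow> slice_emb J z \<in> U"
  using assms unfolding symmetric_set_def slice_emb_def by blast

lemma frontier_of_slice:
  assumes I: "I \<in> imag_units"
  shows "top_of_set (slice_plane I) frontier_of (U \<inter> slice_plane I) =
    slice_emb I ` frontier (slice_emb I -` U)"
proof -
  have range: "slice_plane I = range (slice_emb I)"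
  proof (intro set_eqI iffI)
    fix q assume "q \<in> slice_plane I"
    then obtain x y where "q = of_real x + of_real y * I" unfolding slice_plane_def by blast
    then have "q = slice_emb I (Complex x y)" by (simp add: slice_emb_def)
    then show "q \<in> range (slice_emb I)" by blast
  qed (auto simp: slice_plane_def slice_emb_def)
  have cont: "continuous_on UNIV (slice_emb I)" "continuous_on (slice_plane I) (coord1 I)"
    by (intro linear_continuous_on bounded_linear_slice_emb bounded_linear_coord1)+
  have "homeomorphic_maps euclidean (top_of_set (slice_plane I)) (slice_emb I) (coord1 I)"
    unfolding homeomorphic_maps_def
  proof (intro conjI)
    show "continuous_map euclidean (top_of_set (slice_plane I)) (slice_emb I)"
      using cont(1) range by (auto simp: continuous_map_in_subtopology)
    show "continuous_map (top_of_set (slice_plane I)) euclidean (coord1 I)"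
      using cont(2) by simp
  qed (auto simp: range coord1_slice_emb[OF I])
  then have hom: "homeomorphic_map euclidean (top_of_set (slice_plane I)) (slice_emb I)"
    by (rule homeomorphic_maps_imp_map)
  have "U \<inter> slice_plane I = slice_emb I ` (slice_emb I -` U)" unfolding range by blast
  then show ?thesis
    using homeomorphic_map_frontier_of[OF hom, of "slice_emb I -` U"]
    by (simp add: frontier_of_def frontier_def)
qed

lemma jordan_boundary_iff:
  assumes I: "I \<in> imag_units"
  shows "jordan_boundary I U \<Gamma> \<longleftrightarrow>
     finite \<Gamma> \<and>
     (\<forall>\<gamma>\<in>\<Gamma>. simple_path \<gamma> \<and> pathfinish \<gamma> = pathstart \<gamma> \<and> rectifiable_path \<gamma>) \<and>
     pairwise (\<lambda>\<gamma> \<delta>. disjnt (path_image \<gamma>) (path_image \<delta>)) \<Gamma> \<and>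
     frontier (slice_emb I -` U) = (\<Union>\<gamma>\<in>\<Gamma>. path_image \<gamma>)"
proof -
  have "inj (slice_emb I)" by (rule injI) (simp only: slice_emb_eq_iff[OF I])
  then have "slice_emb I ` frontier (slice_emb I -` U) = (\<Union>\<gamma>\<in>\<Gamma>. slice_emb I ` path_image \<gamma>) \<longleftrightarrow>
      frontier (slice_emb I -` U) = (\<Union>\<gamma>\<in>\<Gamma>. path_image \<gamma>)"
    unfolding image_UN[symmetric] by (rule inj_image_eq_iff)
  then show ?thesis unfolding jordan_boundary_def frontier_of_slice[OF I] by (simp only:)
qed

lemma rectifiable_path_reversepath:
  assumes "rectifiable_path \<gamma>"
  shows "rectifiable_path (reversepath \<gamma>)"
proof -
  obtain B where B: "\<And>D. D division_of {0..1} \<Longrightarrow> (\<Sum>k\<in>D. dist (\<gamma> (Inf k)) (\<gamma> (Sup k))) \<le> B"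
    using assms unfolding rectifiable_path_def by blast
  have "(\<Sum>k\<in>D. dist (reversepath \<gamma> (Inf k)) (reversepath \<gamma> (Sup k))) \<le> B"
    if D: "D division_of {0..1}" for D
  proof -
    define R where "R k = (\<lambda>t. 1 - t) ` k" for k :: "real set"
    have interval: "\<exists>a b. a \<le> b \<and> k = {a..b} \<and> R k = {1 - b..1 - a}" if k: "k \<in> D" for k
    proof -
      obtain a b where ab: "k = cbox a b" using division_ofD(4)[OF D k] by blast
      then have "a \<le> b" using division_ofD(3)[OF D k] by simp
      moreover have "R k = {1 - b..1 - a}"
        unfolding R_def ab cbox_interval by (rule image_diff_atLeastAtMost)
      ultimately show ?thesis using ab by (metis cbox_interval)
    qed
    have "inj_on R D"
    proof (rule inj_onI)
      fix k l assume "R k = R l"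
      then have "(\<lambda>t. 1 - t) ` R k = (\<lambda>t. 1 - t) ` R l" by simp
      then show "k = l" by (simp add: R_def image_image)
    qed
    have "(R ` D) division_of {0..1}"
    proof (rule division_ofI)
      show "finite (R ` D)" using division_ofD(1)[OF D] by simp
      show "\<Union>(R ` D) = {0..1}"
      proof -
        have "\<Union>(R ` D) = (\<lambda>t. 1 - t) ` \<Union>D" unfolding R_def by blast
        also have "\<dots> = {0..1}" unfolding division_ofD(6)[OF D] by (simp add: image_diff_atLeastAtMost)
        finally show ?thesis .
      qed
    next
      fix K assume "K \<in> R ` D"
      then obtain k where k: "k \<in> D" "K = R k" by blast
      obtain a b where ab: "a \<le> b" "k = {a..b}" "R k = {1 - b..1 - a}"
        using interval[OF k(1)] by blast
      have "{a..b} \<subseteq> {0..1}" using division_ofD(2)[OF D k(1)] ab(2) by simp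
      then show "K \<subseteq> {0..1}" unfolding k(2) ab(3) using ab(1) by auto
      show "K \<noteq> {}" unfolding k(2) ab(3) using ab(1) by simp
      show "\<exists>a b. K = cbox a b" unfolding k(2) ab(3) by (metis cbox_interval)
    next
      fix K1 K2 assume "K1 \<in> R ` D" "K2 \<in> R ` D" and ne: "K1 \<noteq> K2"
      then obtain k1 k2 where k: "k1 \<in> D" "k2 \<in> D" "K1 = R k1" "K2 = R k2" by blast
      obtain a1 b1 where ab1: "k1 = {a1..b1}" "R k1 = {1 - b1..1 - a1}" using interval[OF k(1)] by blast
      obtain a2 b2 where ab2: "k2 = {a2..b2}" "R k2 = {1 - b2..1 - a2}" using interval[OF k(2)] by blast
      have "k1 \<noteq> k2" using ne k by blast
      then have disj: "{a1<..<b1} \<inter> {a2<..<b2} = {}"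
        using division_ofD(5)[OF D k(1,2)] unfolding ab1(1) ab2(1) by simp
      show "interior K1 \<inter> interior K2 = {}"
      proof (rule ccontr)
        assume "interior K1 \<inter> interior K2 \<noteq> {}"
        then obtain x where "x \<in> {1 - b1<..<1 - a1}" "x \<in> {1 - b2<..<1 - a2}"
          unfolding k(3,4) ab1(2) ab2(2) interior_atLeastAtMost_real by blast
        then have "1 - x \<in> {a1<..<b1} \<inter> {a2<..<b2}" by auto
        then show False using disj by blast
      qed
    qed
    then have "(\<Sum>k\<in>R ` D. dist (\<gamma> (Inf k)) (\<gamma> (Sup k))) \<le> B" by (rule B)
    moreover have "(\<Sum>k\<in>R ` D. dist (\<gamma> (Inf k)) (\<gamma> (Sup k))) =
        (\<Sum>k\<in>D. dist (reversepath \<gamma> (Inf k)) (reversepath \<gamma> (Sup k)))"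
      unfolding sum.reindex[OF \<open>inj_on R D\<close>] o_def
    proof (intro sum.cong refl)
      fix k assume "k \<in> D"
      then obtain a b where "a \<le> b" "k = {a..b}" "R k = {1 - b..1 - a}" using interval by blast
      then show "dist (\<gamma> (Inf (R k))) (\<gamma> (Sup (R k))) =
          dist (reversepath \<gamma> (Inf k)) (reversepath \<gamma> (Sup k))"
        by (simp add: reversepath_def dist_commute)
    qed
    ultimately show ?thesis by simp
  qed
  moreover have "path (reversepath \<gamma>)" using assms by (simp add: rectifiable_path_def)
  ultimately show ?thesis unfolding rectifiable_path_def by blast
qed

lemma counterclockwise_or_reversepath:
  assumes "simple_path \<gamma>" "pathfinish \<gamma> = pathstart \<gamma>"
  shows "counterclockwise \<gamma> \<or> counterclockwise (reversepath \<gamma>)"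
proof (rule simple_closed_path_winding_number_inside[OF assms(1)])
  assume "\<And>z. z \<in> inside (path_image \<gamma>) \<Longrightarrow> winding_number \<gamma> z = 1"
  then show ?thesis unfolding counterclockwise_def by blast
next
  assume neg: "\<And>z. z \<in> inside (path_image \<gamma>) \<Longrightarrow> winding_number \<gamma> z = -1"
  have "winding_number (reversepath \<gamma>) z = 1" if z: "z \<in> inside (path_image \<gamma>)" for z
  proof -
    have "z \<notin> path_image \<gamma>" using z inside_no_overlap[of "path_image \<gamma>"] by blast
    then have "winding_number (reversepath \<gamma>) z = - winding_number \<gamma> z"
      using assms(1) by (intro winding_number_reversepath simple_path_imp_path)
    then show ?thesis using neg[OF z] by simp
  qed
  then show ?thesis by (simp add: counterclockwise_def)
qed

text \<open>The curves in \<^const>\<open>jordan_boundary\<close> are not oriented; reversing some of them makes all of them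
  counterclockwise.\<close>

lemma jordan_boundary_counterclockwise:
  assumes I: "I \<in> imag_units" and "jordan_boundary I U \<Gamma>"
  obtains \<Gamma>' where "jordan_boundary I U \<Gamma>'" "\<forall>\<gamma>\<in>\<Gamma>'. counterclockwise \<gamma>"
proof -
  define ori where "ori \<gamma> = (if counterclockwise \<gamma> then \<gamma> else reversepath \<gamma>)" for \<gamma>
  have im: "path_image (ori \<gamma>) = path_image \<gamma>" for \<gamma> by (simp add: ori_def)
  note J = assms(2)[unfolded jordan_boundary_iff[OF I]]
  have "jordan_boundary I U (ori ` \<Gamma>)"
    unfolding jordan_boundary_iff[OF I]
  proof (intro conjI)
    show "finite (ori ` \<Gamma>)" using J by simp
    show "\<forall>\<gamma>\<in>ori ` \<Gamma>. simple_path \<gamma> \<and> pathfinish \<gamma> = pathstart \<gamma> \<and> rectifiable_path \<gamma>"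
      using J rectifiable_path_reversepath by (auto simp: ori_def simple_path_reversepath)
    show "pairwise (\<lambda>\<gamma> \<delta>. disjnt (path_image \<gamma>) (path_image \<delta>)) (ori ` \<Gamma>)"
      unfolding pairwise_def
    proof (intro ballI impI)
      fix \<gamma> \<delta> assume "\<gamma> \<in> ori ` \<Gamma>" "\<delta> \<in> ori ` \<Gamma>" "\<gamma> \<noteq> \<delta>"
      then obtain \<gamma>' \<delta>' where "\<gamma>' \<in> \<Gamma>" "\<delta>' \<in> \<Gamma>" "\<gamma> = ori \<gamma>'" "\<delta> = ori \<delta>'" "\<gamma>' \<noteq> \<delta>'" by blast
      moreover have "pairwise (\<lambda>\<gamma> \<delta>. disjnt (path_image \<gamma>) (path_image \<delta>)) \<Gamma>" using J by (elim conjE)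
      ultimately show "disjnt (path_image \<gamma>) (path_image \<delta>)" by (simp add: im pairwise_def)
    qed
    show "frontier (slice_emb I -` U) = (\<Union>\<gamma>\<in>ori ` \<Gamma>. path_image \<gamma>)" using J by (simp add: im)
  qed
  moreover have "\<forall>\<gamma>\<in>ori ` \<Gamma>. counterclockwise \<gamma>"
  proof
    fix \<gamma> assume "\<gamma> \<in> ori ` \<Gamma>"
    then obtain \<delta> where \<delta>: "\<delta> \<in> \<Gamma>" "\<gamma> = ori \<delta>" by blast
    then have "counterclockwise \<delta> \<or> counterclockwise (reversepath \<delta>)"
      using J by (intro counterclockwise_or_reversepath) auto
    then show "counterclockwise \<gamma>" by (cases "counterclockwise \<delta>") (simp_all add: \<delta>(2) ori_def)
  qed
  ultimately show ?thesis by (rule that)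
qed

text \<open>The point of the closed upper half plane representing the sphere through \<open>q\<close>.\<close>

definition half_plane_point :: "quat \<Rightarrow> complex" where
  "half_plane_point q = Complex (qre q) (qim_norm q)"

lemma continuous_half_plane_point: "continuous_on S half_plane_point"
proof -
  have qre: "qre = (\<lambda>q. inner 1 q)" by (auto simp: inner_quat_def)
  have "half_plane_point = (\<lambda>q. of_real (inner 1 q) + \<i> * of_real (norm (q - of_real (inner 1 q))))"
    by (auto simp: half_plane_point_def complex_eq_iff qim_norm_def qre)
  moreover have "continuous_on S (\<lambda>q. of_real (inner 1 q) + \<i> * of_real (norm (q - of_real (inner 1 q))))"
    by (intro continuous_intros)
  ultimately show ?thesis by (simp only:)
qed

lemma half_plane_point_slice_emb:
  assumes "I \<in> imag_units" "Im z \<ge> 0"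
  shows "half_plane_point (slice_emb I z) = z"
proof -
  have "slice_emb I z - of_real (Re z) = Im z *\<^sub>R I" by (simp add: slice_emb_def scaleR_conv_of_real)
  then show ?thesis
    using assms imag_units_norm[OF assms(1)]
    by (simp add: half_plane_point_def qim_norm_def qre_slice_emb complex_eq_iff)
qed

lemma quat_on_slice:
  obtains J where "J \<in> imag_units" "q = slice_emb J (half_plane_point q)"
proof (cases "qim_norm q = 0")
  case True
  have "Quat 0 1 0 0 \<in> imag_units" by (simp add: imag_units_iff)
  moreover have "q = slice_emb (Quat 0 1 0 0) (half_plane_point q)"
    using True by (simp add: half_plane_point_def slice_emb_def qim_norm_def)
  ultimately show ?thesis by (rule that)
next
  case False
  define J where "J = (1 / qim_norm q) *\<^sub>R (q - of_real (qre q))"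
  have n: "(qim_norm q)\<^sup>2 = (qi q)\<^sup>2 + (qj q)\<^sup>2 + (qk q)\<^sup>2"
    by (simp add: qim_norm_def norm_quat_def of_real_def)
  have "J \<in> imag_units"
    using False by (simp add: J_def imag_units_iff of_real_def power_divide n[symmetric]
        flip: add_divide_distrib)
  moreover have "q = slice_emb J (half_plane_point q)"
    using False by (simp add: J_def half_plane_point_def slice_emb_scaleR of_real_def)
  ultimately show ?thesis by (rule that)
qed

section \<open>The Cauchy formula for slice regular functions\<close>

theorem theorem11p5:
  fixes \<Omega> U :: "quat set" and f ftilde :: "quat \<Rightarrow> quat" and J0 :: quat
  assumes "slice_domain \<Omega>"
    and "slice_regular \<Omega> f"
    and "symmetric_set U" and "open U"
    and "compact (closure U)" and "path_connected (closure U)"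
    and "closure U \<inter> \<real> \<noteq> {} \<Longrightarrow>
           (\<exists>a b. a \<le> b \<and> closure U \<inter> \<real> = of_real ` {a..b}) \<and> closure U \<inter> \<real> \<subseteq> \<Omega>"
    and "J0 \<in> imag_units"
    and "\<exists>\<Gamma>. jordan_boundary J0 U \<Gamma>"
    and "closure U \<inter> upper_slice J0 \<subseteq> \<Omega> \<inter> upper_slice J0"
    and "\<And>x y J. y > 0 \<Longrightarrow> J \<in> imag_units \<Longrightarrow> of_real x + of_real y * J \<in> frontier U \<Longrightarrow>
           ftilde (of_real x + of_real y * J) =
             spherical_value f \<Omega> (of_real x + of_real y * J0) +
             of_real y * J * spherical_deriv f \<Omega> (of_real x + of_real y * J0)"
    and "\<And>x. of_real x \<in> frontier U \<Longrightarrow>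
           ftilde (of_real x) = spherical_value f \<Omega> (of_real x)"
  shows "\<exists>\<epsilon>>0. \<forall>I\<in>imag_units.
           \<forall>q \<in> (\<Union>J\<in>{J\<in>imag_units. norm (J - J0) < \<epsilon>}. U \<inter> upper_slice J) \<union> (U \<inter> \<real>).
             has_boundary_integral I U
               (\<lambda>s. cauchy_kernel s q * inverse (of_real (2 * pi) * I)) ftilde (f q)"
proof (cases "U = {}")
  case True
  then show ?thesis by (intro exI[of _ 1]) simp
next
  case False
  note \<Omega> = assms(1) and f = assms(2) and sym = assms(3) and opU = assms(4) and J0 = assms(8)
  define E where "E = slice_emb J0 -` U"
  let ?K = "closure E"
  have E_eq: "slice_emb I -` U = E" if "I \<in> imag_units" for I
    using slice_emb_mem_symmetric[OF sym that J0] by (auto simp: E_def)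
  have E_iff: "slice_emb I z \<in> U \<longleftrightarrow> z \<in> E" if "I \<in> imag_units" for I z
    using E_eq[OF that] by blast
  have opE: "open E"
    unfolding E_def by (intro open_vimage opU linear_continuous_on bounded_linear_slice_emb)
  have cnjE: "cnj z \<in> E" if "z \<in> E" for z
    using that E_iff[OF J0, of "cnj z"] E_iff[OF imag_units_uminus[OF J0], of z]
    by (simp add: slice_emb_cnj)
  have cl: "slice_emb I z \<in> closure U" if I: "I \<in> imag_units" and z: "z \<in> ?K" for I z
  proof -
    have "slice_emb I ` closure E \<subseteq> closure (slice_emb I ` E)"
      by (intro closure_bounded_linear_image_subset bounded_linear_slice_emb)
    moreover have "closure (slice_emb I ` E) \<subseteq> closure U"
      by (intro closure_mono image_subsetI) (simp only: E_iff[OF I])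
    ultimately show ?thesis using z by blast
  qed
  have hp: "half_plane_point q \<in> ?K" if q: "q \<in> closure U" for q
  proof -
    have "half_plane_point p \<in> E" if "p \<in> U" for p
    proof -
      obtain J where J: "J \<in> imag_units" and p: "p = slice_emb J (half_plane_point p)"
        by (rule quat_on_slice)
      have "slice_emb J (half_plane_point p) \<in> U" using that by (simp only: p[symmetric])
      then show ?thesis by (simp only: E_iff[OF J])
    qed
    then have "half_plane_point ` U \<subseteq> ?K" using closure_subset[of E] by blast
    then have "half_plane_point ` closure U \<subseteq> ?K"
      by (intro image_closure_subset continuous_half_plane_point closed_closure)
    then show ?thesis using q by blast
  qed
  have upper: "{z\<in>?K. Im z \<ge> 0} = half_plane_point ` closure U"
  proof (intro set_eqI iffI)
    fix z assume z: "z \<in> {z\<in>?K. Im z \<ge> 0}"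
    then have "z = half_plane_point (slice_emb J0 z)" by (simp add: half_plane_point_slice_emb[OF J0])
    then show "z \<in> half_plane_point ` closure U" 
    proof (rule image_eqI)
      show "slice_emb J0 z \<in> closure U" using z by (intro cl[OF J0]) simp
    qed
  next
    fix z assume "z \<in> half_plane_point ` closure U"
    then obtain q where "q \<in> closure U" "z = half_plane_point q" by blast
    then have "z \<in> ?K" "Im z \<ge> 0"
      using hp[of q] by (simp_all add: half_plane_point_def qim_norm_def)
    then show "z \<in> {z\<in>?K. Im z \<ge> 0}" by simp
  qed
  have "bounded E"
  proof -
    obtain M where M: "\<And>q. q \<in> closure U \<Longrightarrow> norm q \<le> M"
      using compact_imp_bounded[OF assms(5)] unfolding bounded_iff by blast
    have "norm z \<le> M" if "z \<in> E" for z
    proof -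
      have "slice_emb J0 z \<in> closure U" using that closure_subset[of E] by (intro cl[OF J0]) blast
      then show ?thesis using M[of "slice_emb J0 z"] by (simp add: norm_slice_emb[OF J0])
    qed
    then show ?thesis unfolding bounded_iff by blast
  qed
  then have cK: "compact ?K" by (simp add: compact_closure)
  have neK: "?K \<noteq> {}"
  proof -
    obtain q where "q \<in> U" using False by blast
    then have "q \<in> closure U" using closure_subset by blast
    then show ?thesis using hp[of q] by (metis empty_iff)
  qed
  have cnjK: "cnj z \<in> ?K" if "z \<in> ?K" for z
  proof -
    have "cnj ` closure E \<subseteq> closure (cnj ` E)"
      by (intro closure_bounded_linear_image_subset bounded_linear_cnj)
    moreover have "closure (cnj ` E) \<subseteq> ?K" by (intro closure_mono image_subsetI cnjE)
    ultimately show ?thesis using that by blast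
  qed
  have conn: "connected {z\<in>?K. Im z \<ge> 0}"
    unfolding upper
    by (intro connected_continuous_image continuous_half_plane_point path_connected_imp_connected assms(6))
  have sub: "slice_emb J0 ` {z\<in>?K. Im z \<ge> 0} \<subseteq> \<Omega>"
  proof
    fix q assume "q \<in> slice_emb J0 ` {z\<in>?K. Im z \<ge> 0}"
    then obtain z where z: "z \<in> ?K" "Im z \<ge> 0" "q = slice_emb J0 z" by blast
    have q: "q \<in> closure U" using cl[OF J0 z(1)] z(3) by simp
    show "q \<in> \<Omega>"
    proof (cases "Im z = 0")
      case True
      then have "q = of_real (Re z)" by (simp add: z(3) slice_emb_def)
      then have "q \<in> closure U \<inter> \<real>" using q by simp
      then show ?thesis using assms(7) by blast
    next
      case False
      then have "q \<in> upper_slice J0" using z(2,3) unfolding upper_slice_def slice_emb_def by force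
      then show ?thesis using q assms(10) by blast
    qed
  qed
  obtain \<epsilon> W B C where \<epsilon>: "\<epsilon> > 0" and W: "open W" "?K \<subseteq> W" and stem: "stem_on B C W"
    and BC: "\<And>z. z \<in> ?K \<Longrightarrow> B (cnj z) = B z" "\<And>z. z \<in> ?K \<Longrightarrow> C (cnj z) = - C z"
    and rep: "\<And>J z. J \<in> imag_units \<Longrightarrow> norm (J - J0) < \<epsilon> \<Longrightarrow> z \<in> ?K \<Longrightarrow> Im z \<ge> 0 \<Longrightarrow>
       slice_emb J z \<in> \<Omega> \<and> f (slice_emb J z) = B z + J * C z"
    by (rule symmetric_stem[OF \<Omega> f J0 cK neK cnjK conn sub], assumption, rule that)
  have C0: "C z = 0" if "z \<in> ?K" "Im z = 0" for z
  proof -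
    have "cnj z = z" using that(2) by (simp add: complex_eq_iff)
    then have "C z = - C z" using BC(2)[OF that(1)] by metis
    then have "C z + C z = 0" by (rule eq_neg_iff_add_eq_0[THEN iffD1])
    then have "2 *\<^sub>R C z = 0" by (simp only: scaleR_2)
    then show ?thesis by simp
  qed
  \<comment> \<open>\<open>ftilde\<close> is the slice function of \<open>(B, C)\<close>; points of the lower half plane are points of the
    upper half plane of the slice of \<open>-I\<close>\<close>
  have ft_upper: "ftilde (slice_emb I z) = B z + I * C z"
    if I: "I \<in> imag_units" and z: "z \<in> frontier E" and y: "Im z > 0" for I z
  proof -
    have zK: "z \<in> ?K" using z by (simp add: frontier_def)
    have "slice_emb I z \<in> frontier U"
      using cl[OF I zK] E_iff[OF I, of z] z opE opU by (simp add: frontier_def interior_open)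
    then have "ftilde (slice_emb I z) = spherical_value f \<Omega> (slice_emb J0 z) +
        of_real (Im z) * I * spherical_deriv f \<Omega> (slice_emb J0 z)"
      using assms(11)[OF y I, of "Re z"] by (simp only: slice_emb_def)
    also have "\<dots> = B z + of_real (Im z) * I * (C z /\<^sub>R Im z)"
      using spherical_value_deriv[OF J0 y \<epsilon> rep[OF _ _ zK]] y by simp
    also have "\<dots> = B z + I * C z" using y by (simp add: of_real_def)
    finally show ?thesis .
  qed
  have ft: "ftilde (slice_emb I z) = B z + I * C z"
    if I: "I \<in> imag_units" and z: "z \<in> frontier E" for I z
  proof -
    have zK: "z \<in> ?K" and zE: "z \<notin> E" using z opE by (simp_all add: frontier_def interior_open)
    consider "Im z > 0" | "Im z < 0" | "Im z = 0" by linarith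
    then show ?thesis
    proof cases
      case 1
      then show ?thesis by (rule ft_upper[OF I z])
    next
      case 2
      have "cnj z \<in> frontier E"
        using cnjK[OF zK] cnjE[of "cnj z"] zE opE by (auto simp: frontier_def interior_open)
      then have "ftilde (slice_emb (- I) (cnj z)) = B (cnj z) + (- I) * C (cnj z)"
        using 2 by (intro ft_upper imag_units_uminus I) simp_all
      then show ?thesis using BC[OF zK] by (simp add: slice_emb_cnj)
    next
      case 3
      then have re: "slice_emb J z = of_real (Re z)" for J by (simp add: slice_emb_def)
      have "of_real (Re z) \<in> frontier U"
        using cl[OF I zK] E_iff[OF I, of z] zE opU unfolding re by (simp add: frontier_def interior_open)
      then have "ftilde (of_real (Re z)) = f (of_real (Re z))"
        using assms(12) by (simp add: spherical_value_def)
      also have "\<dots> = B z" using rep[OF J0 _ zK] \<epsilon> 3 C0[OF zK 3] by (simp add: re)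
      finally show ?thesis using C0[OF zK 3] by (simp add: re)
    qed
  qed
  have formula: "has_boundary_integral I U
      (\<lambda>s. cauchy_kernel s (slice_emb M \<zeta>) * inverse (of_real (2 * pi) * I)) ftilde (B \<zeta> + M * C \<zeta>)"
    if I: "I \<in> imag_units" and M: "M \<in> imag_units" and \<zeta>: "\<zeta> \<in> E" for I M \<zeta>
    unfolding has_boundary_integral_def
  proof (intro conjI allI impI)
    obtain \<Gamma>0 where \<Gamma>0: "jordan_boundary J0 U \<Gamma>0" using assms(9) by blast
    have "jordan_boundary I U \<Gamma>0"
      using \<Gamma>0 unfolding jordan_boundary_iff[OF I] jordan_boundary_iff[OF J0] E_eq[OF I] E_eq[OF J0] .
    then show "\<exists>\<Gamma>. jordan_boundary I U \<Gamma> \<and> (\<forall>\<gamma>\<in>\<Gamma>. counterclockwise \<gamma>)"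
      using jordan_boundary_counterclockwise[OF I] by metis
  next
    fix \<Gamma> assume \<Gamma>: "jordan_boundary I U \<Gamma> \<and> (\<forall>\<gamma>\<in>\<Gamma>. counterclockwise \<gamma>)"
    then have jf: "jordan_frontier E \<Gamma>"
      unfolding jordan_boundary_iff[OF I] jordan_frontier_def E_eq[OF I]
      using opE \<open>bounded E\<close> by blast
    obtain J where J: "J \<in> imag_units" "orthogonal I J"
      using exists_orthogonal_imag_unit[OF I] by blast
    let ?g = "\<lambda>z. B z + I * C z"
    let ?F = "\<lambda>z. coord1 I (?g z)" and ?G = "\<lambda>z. coord2 I J (?g z)"
    note hol = coord_holomorphic[OF stem_left_holomorphic[OF stem I] I J]
    note split = quat_splitting(1)[OF I J]
    have h: "ftilde (slice_emb I z) = slice_emb I (?F z) + slice_emb I (?G z) * J"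
      if "z \<in> frontier E" for z
      unfolding split using I that by (rule ft)
    have \<zeta>K: "\<zeta> \<in> ?K" using \<zeta> closure_subset by blast
    obtain w where w: "\<And>\<gamma>. \<gamma> \<in> \<Gamma> \<Longrightarrow> has_slice_integral I \<gamma>
         (\<lambda>s. cauchy_kernel s (slice_emb M \<zeta>) * inverse (of_real (2 * pi) * I)) ftilde (w \<gamma>)"
      and sum: "(\<Sum>\<gamma>\<in>\<Gamma>. boundary_sign E \<gamma> *\<^sub>R w \<gamma>) =
         plus_factor M I * (slice_emb I (?F \<zeta>) + slice_emb I (?G \<zeta>) * J) +
         minus_factor M I * (slice_emb I (?F (cnj \<zeta>)) + slice_emb I (?G (cnj \<zeta>)) * J)"
      by (rule Cauchy_formula_slice[OF M I J jf W hol \<zeta> cnjE[OF \<zeta>] h], assumption, rule that)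
    have "(\<Sum>\<gamma>\<in>\<Gamma>. boundary_sign E \<gamma> *\<^sub>R w \<gamma>) =
         plus_factor M I * (B \<zeta> + I * C \<zeta>) + minus_factor M I * (B \<zeta> - I * C \<zeta>)"
      unfolding sum split by (simp add: BC[OF \<zeta>K])
    also have "\<dots> = B \<zeta> + M * C \<zeta>" by (rule factor_representation[OF I])
    finally show "\<exists>w. (\<forall>\<gamma>\<in>\<Gamma>. has_slice_integral I \<gamma>
         (\<lambda>s. cauchy_kernel s (slice_emb M \<zeta>) * inverse (of_real (2 * pi) * I)) ftilde (w \<gamma>)) \<and>
         B \<zeta> + M * C \<zeta> = (\<Sum>\<gamma>\<in>\<Gamma>. boundary_sign (slice_emb I -` U) \<gamma> *\<^sub>R w \<gamma>)"
      unfolding E_eq[OF I] using w by (intro exI[of _ w]) simp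
  qed
  show ?thesis
  proof (intro exI[of _ \<epsilon>] conjI \<epsilon> ballI)
    fix I q
    assume I: "I \<in> imag_units"
      and q: "q \<in> (\<Union>J\<in>{J\<in>imag_units. norm (J - J0) < \<epsilon>}. U \<inter> upper_slice J) \<union> (U \<inter> \<real>)"
    have "\<exists>M \<zeta>. M \<in> imag_units \<and> norm (M - J0) < \<epsilon> \<and> Im \<zeta> \<ge> 0 \<and> q = slice_emb M \<zeta>"
    proof (cases "q \<in> \<real>")
      case True
      then obtain x where "q = of_real x" by (rule Reals_cases)
      then have "q = slice_emb J0 (of_real x)" by (simp add: slice_emb_simps)
      then show ?thesis using J0 \<epsilon> by (intro exI[of _ J0] exI[of _ "of_real x"]) simp
    next
      case False
      then obtain M where M: "M \<in> imag_units" "norm (M - J0) < \<epsilon>" "q \<in> upper_slice M"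
        using q by blast
      then obtain x y where "q = of_real x + of_real y * M" "y > 0" unfolding upper_slice_def by blast
      then have "q = slice_emb M (Complex x y)" "Im (Complex x y) \<ge> 0" by (simp_all add: slice_emb_def)
      then show ?thesis using M by blast
    qed
    then obtain M \<zeta> where M: "M \<in> imag_units" "norm (M - J0) < \<epsilon>" "Im \<zeta> \<ge> 0" "q = slice_emb M \<zeta>"
      by blast
    have "q \<in> U" using q by blast
    then have \<zeta>: "\<zeta> \<in> E" using E_iff[OF M(1)] M(4) by simp
    then have "\<zeta> \<in> ?K" using closure_subset by blast
    then have "f q = B \<zeta> + M * C \<zeta>" using rep[OF M(1,2) _ M(3)] M(4) by simp
    then show "has_boundary_integral I U
        (\<lambda>s. cauchy_kernel s q * inverse (of_real (2 * pi) * I)) ftilde (f q)"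
      using formula[OF I M(1) \<zeta>] M(4) by simp
  qed
qed

end
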